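(* Let $\alpha$ be a strongly continuous rotationally symmetric norm on $L^\infty(\mathbb T)$ and let $f:\mathbb D\to\mathbb C$. The following are equivalent: (1) $f\in H^\alpha(\mathbb D)$; (2) $f\in H(\mathbb D)$ (i.e. $f$ is analytic on $\mathbb D$) and $\sup_{0<r<1}\alpha(f_r)<\infty$.
   Context: $\mathbb D$ is the open unit disk, $\mathbb T$ the unit circle, $m$ normalized arc length on $\mathbb T$; functions on $\mathbb T$ equal a.e. are identified. For $f:\mathbb D\to\mathbb C$ and $0<r<1$, $f_r:\mathbb T\to\mathbb C$ is $f_r(e^{it})=f(re^{it})$. A rotationally symmetric norm is a norm $\alpha$ on $L^\infty(\mathbb T)$ with $\alpha(1)=1$, $\alpha(|h|)=\alpha(h)$, and $\alpha(z\mapsto h(\overline wz))=\alpha(h)$ for all $h\in L^\infty(\mathbb T)$, $w\in\mathbb T$. For any measurable $h:\mathbb T\to\mathbb C$ put $\alpha(h)=\sup\{\alpha(s):s\text{ a simple function},\ |s|\le|h|\}$. $\mathcal L^\alpha(\mathbb T)$ is the set of measurable $h$ with $\alpha(h)<\infty$, and $L^\alpha(\mathbb T)$ is the $\alpha$-closure of $L^\infty(\mathbb T)$ in $\mathcal L^\alpha(\mathbb T)$. $\alpha$ is strongly continuous if $\lim_{m(E)\to0^+}\alpha(\chi_E)=0$ and $L^\alpha(\mathbb T)=\mathcal L^\alpha(\mathbb T)$. $H^\alpha(\mathbb T)$ is the $\alpha$-closed linear span of $\{1,z,z^2,\ldots\}$. $H^1(\mathbb D)$ is the classical Hardy space; each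 $f\in H^1(\mathbb D)$ is the Poisson integral of its radial boundary function $F\in H^1(\mathbb T)$. $H^\alpha(\mathbb D)=\{f\in H^1(\mathbb D):F\in H^\alpha(\mathbb T)\}$. *)

theory Defs
  imports "HOL-Analysis.Analysis" "HOL-Complex_Analysis.Complex_Analysis"
begin

text \<open>
  Functions on the unit circle are functions of type \<open>complex \<Rightarrow> complex\<close> of which only the
  values on \<open>sphere 0 1\<close> matter. Measurability is Borel measurability: modulo null sets this
  yields the same function classes as Lebesgue measurability.
\<close>

definition circle_measure :: "complex measure" where
  "circle_measure =
     distr (uniform_measure lborel {0..2 * pi}) (restrict_space borel (sphere 0 1)) cis"

definition Linf_circle :: "(complex \<Rightarrow> complex) set" where
  "Linf_circle = {h \<in> borel_measurable circle_measure.
     \<exists>C::real. AE z in circle_measure. norm (h z) \<le> C}"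

text \<open>
  A norm is a real-valued functional on functions, constrained only on \<open>Linf_circle\<close>. It
  descends to classes modulo a.e. equality: if \<open>g = h\<close> a.e. then \<open>\<alpha> (g - h) = 0\<close>, whence
  \<open>\<alpha> g = \<alpha> h\<close> by the triangle inequality.
\<close>

definition rotationally_symmetric_norm :: "((complex \<Rightarrow> complex) \<Rightarrow> real) \<Rightarrow> bool" where
  "rotationally_symmetric_norm \<alpha> \<longleftrightarrow>
     (\<forall>h\<in>Linf_circle. 0 \<le> \<alpha> h) \<and>
     (\<forall>h\<in>Linf_circle. \<alpha> h = 0 \<longleftrightarrow> (AE z in circle_measure. h z = 0)) \<and>
     (\<forall>h\<in>Linf_circle. \<forall>c. \<alpha> (\<lambda>z. c * h z) = norm c * \<alpha> h) \<and>
     (\<forall>g\<in>Linf_circle. \<forall>h\<in>Linf_circle. \<alpha> (\<lambda>z. g z + h z) \<le> \<alpha> g + \<alpha> h) \<and>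
     \<alpha> (\<lambda>z. 1) = 1 \<and>
     (\<forall>h\<in>Linf_circle. \<alpha> (\<lambda>z. complex_of_real (norm (h z))) = \<alpha> h) \<and>
     (\<forall>h\<in>Linf_circle. \<forall>w\<in>sphere 0 1. \<alpha> (\<lambda>z. h (cnj w * z)) = \<alpha> h)"

definition norm_ext :: "((complex \<Rightarrow> complex) \<Rightarrow> real) \<Rightarrow> (complex \<Rightarrow> complex) \<Rightarrow> ennreal" where
  "norm_ext \<alpha> h =
     (SUP s \<in> {s. simple_function circle_measure s \<and>
                  (AE z in circle_measure. norm (s z) \<le> norm (h z))}. ennreal (\<alpha> s))"

definition script_L :: "((complex \<Rightarrow> complex) \<Rightarrow> real) \<Rightarrow> (complex \<Rightarrow> complex) set" where
  "script_L \<alpha> = {h \<in> borel_measurable circle_measure. norm_ext \<alpha> h < \<infinity>}"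

definition norm_closure ::
  "((complex \<Rightarrow> complex) \<Rightarrow> real) \<Rightarrow> (complex \<Rightarrow> complex) set \<Rightarrow> (complex \<Rightarrow> complex) set" where
  "norm_closure \<alpha> S = {h \<in> script_L \<alpha>. \<forall>\<epsilon>::ennreal>0. \<exists>g\<in>S. norm_ext \<alpha> (\<lambda>z. h z - g z) < \<epsilon>}"

definition L_space :: "((complex \<Rightarrow> complex) \<Rightarrow> real) \<Rightarrow> (complex \<Rightarrow> complex) set" where
  "L_space \<alpha> = norm_closure \<alpha> Linf_circle"

definition strongly_continuous_norm :: "((complex \<Rightarrow> complex) \<Rightarrow> real) \<Rightarrow> bool" where
  "strongly_continuous_norm \<alpha> \<longleftrightarrow>
     (\<forall>\<epsilon>::real>0. \<exists>\<delta>::real>0. \<forall>E\<in>sets circle_measure.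
        0 < measure circle_measure E \<and> measure circle_measure E < \<delta> \<longrightarrow> \<alpha> (indicator E) < \<epsilon>) \<and>
     L_space \<alpha> = script_L \<alpha>"

definition analytic_polynomials :: "(complex \<Rightarrow> complex) set" where
  "analytic_polynomials = {p. \<exists>n c. p = (\<lambda>z. \<Sum>k\<le>n. c k * z ^ k)}"

definition hardy_circle :: "((complex \<Rightarrow> complex) \<Rightarrow> real) \<Rightarrow> (complex \<Rightarrow> complex) set" where
  "hardy_circle \<alpha> = norm_closure \<alpha> analytic_polynomials"

definition dilate :: "(complex \<Rightarrow> complex) \<Rightarrow> real \<Rightarrow> complex \<Rightarrow> complex" where
  "dilate f r = (\<lambda>z. f (complex_of_real r * z))"

definition hardy1_disk :: "(complex \<Rightarrow> complex) set" where
  "hardy1_disk = {f. f holomorphic_on ball 0 1 \<and>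
     (SUP r\<in>{0<..<1}. \<integral>\<^sup>+ z. ennreal (norm (dilate f r z)) \<partial>circle_measure) < \<infinity>}"

text \<open>
  The radial boundary function is determined only up to null sets, hence a relation.
\<close>

definition radial_boundary :: "(complex \<Rightarrow> complex) \<Rightarrow> (complex \<Rightarrow> complex) \<Rightarrow> bool" where
  "radial_boundary f F \<longleftrightarrow> F \<in> borel_measurable circle_measure \<and>
     (AE z in circle_measure. ((\<lambda>r. dilate f r z) \<longlongrightarrow> F z) (at_left 1))"

definition hardy_disk :: "((complex \<Rightarrow> complex) \<Rightarrow> real) \<Rightarrow> (complex \<Rightarrow> complex) set" where
  "hardy_disk \<alpha> = {f \<in> hardy1_disk. \<exists>F. radial_boundary f F \<and> F \<in> hardy_circle \<alpha>}"

end

theory Submission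
  imports Defs
begin

text \<open>
  An \<open>H\<^sup>1\<close> function is a product of two \<open>H\<^sup>2\<close> functions, hence a limit of polynomials uniformly in
  the \<open>L\<^sup>1\<close> means over all circles; with the maximal inequality this gives a boundary function
  \<open>F\<close> to which the dilates \<open>f\<^sub>r\<close> converge radially almost everywhere and in \<open>L\<^sup>1\<close>, so that
  \<open>f\<close> is the Poisson integral of \<open>F\<close>.

  Strong continuity makes harmonic polynomials \<open>\<alpha>\<close>-dense, and dilation contracts \<open>\<alpha>\<close> on
  them by rotation invariance and the maximum principle. By density
  \<open>\<alpha> (f\<^sub>r - u\<^sub>r) \<le> \<alpha> (F - u)\<close> for every harmonic polynomial \<open>u\<close>. Taking \<open>u = 0\<close> bounds the
  dilates; taking \<open>u\<close> close to \<open>F\<close> shows \<open>f\<^sub>r \<rightarrow> F\<close> in \<open>\<alpha>\<close>, so \<open>F\<close> is a limit of Taylor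
  polynomials of dilates of \<open>f\<close>. That \<open>\<alpha> F\<close> is finite when the \<open>\<alpha> f\<^sub>r\<close> are bounded follows
  from convergence in measure and strong continuity.
\<close>

section \<open>Integration on the circle\<close>

text \<open>Two difficulties shape the argument. Taylor truncation is not uniformly bounded in the
  L^1 means, so Taylor polynomials of \<open>f\<close> itself need not approximate \<open>f\<close>
  in all these means at once; for square means Parseval gives exactly this uniformity, which is the
  reason for the factorization. Infinite Blaschke products are avoided by factoring approximating
  polynomials, which have finitely many zeros, and passing to a limit by Montel's theorem. Nothing
  in the definition of \<alpha> relates it to integration, so an integral of rotates of a function
  is not immediately controlled by \<alpha>. Averages are therefore taken over roots of unity, where
  the triangle inequality suffices and where the mean value property of a harmonic polynomial is
  exact. Dilation to radius 0 then gives \<open>norm (u 0) \<le> \<alpha> u\<close>, and this single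
  inequality is the origin of the comparison of the L^1 norm with \<alpha>. Numerical constants such
  as 320 come from covering and dyadic summation; only their finiteness matters.\<close>

abbreviation circle_measure_mu ("\<mu>") where "\<mu> \<equiv> circle_measure"

abbreviation sq_mean :: "(complex \<Rightarrow> complex) \<Rightarrow> real \<Rightarrow> real" where
  "sq_mean g r \<equiv> LINT z|\<mu>. (norm (dilate g r z))\<^sup>2"

abbreviation L1_boundary :: "(complex \<Rightarrow> complex) \<Rightarrow> (complex \<Rightarrow> complex) \<Rightarrow> bool" where
  "L1_boundary f F \<equiv> ((\<lambda>r. LINT z|\<mu>. norm (dilate f r z - F z)) \<longlongrightarrow> 0) (at_left 1)"

lemma space_circle [simp]: "space \<mu> = sphere 0 1"
  by (simp add: circle_measure_def space_restrict_space)

lemma sets_circle [simp, measurable_cong]: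
  "sets \<mu> = sets (restrict_space borel (sphere 0 1))"
  by (simp add: circle_measure_def)

lemma measurable_cis_circle [measurable]:
  "cis \<in> measurable borel (restrict_space borel (sphere 0 1))"
  by (intro measurable_restrict_space2 borel_measurable_continuous_onI continuous_intros) auto

lemma emeasure_circle:
  assumes [measurable]: "A \<in> sets \<mu>"
  shows "emeasure \<mu> A = emeasure lborel {t\<in>{0..2*pi}. cis t \<in> A} / ennreal (2*pi)"
proof -
  have A [measurable]: "A \<in> sets (restrict_space borel (sphere 0 1))" using assms by simp
  have 1: "{t\<in>{0..2*pi}. cis t \<in> A} = {0..2*pi} \<inter> (cis -` A \<inter> space borel)" by auto
  have 2: "cis -` A \<inter> space borel \<in> sets borel"
    by (rule measurable_sets[OF measurable_cis_circle A])
  show ?thesis unfolding circle_measure_def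
    using 2 by (subst emeasure_distr) (simp_all only: 1 | auto cong: measurable_cong_sets)+
qed

lemma emeasure_circle_space [simp]: "emeasure \<mu> (sphere 0 1) = 1"
proof -
  have "sphere 0 1 \<in> sets \<mu>" using sets.top[of \<mu>] by (simp del: sets_circle)
  moreover have "{t\<in>{0..2*pi}. cis t \<in> sphere 0 1} = {0..2*pi}" by auto
  ultimately show ?thesis by (simp add: emeasure_circle ennreal_divide_self del: sets_circle)
qed

interpretation circle: finite_measure \<mu>
  by standard simp

lemma measure_circle_space [simp]: "measure \<mu> (sphere 0 1) = 1"
  by (simp add: measure_def)

lemma measurable_circle:
  fixes \<phi> :: "complex \<Rightarrow> 'a::topological_space"
  assumes "continuous_on (sphere 0 1) \<phi>"
  shows "\<phi> \<in> borel_measurable \<mu>"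
  using borel_measurable_continuous_on_restrict[OF assms] by (simp cong: measurable_cong_sets)

lemma borel_measurable_circle_borel [measurable_dest]:
  "\<phi> \<in> borel_measurable borel \<Longrightarrow> \<phi> \<in> borel_measurable \<mu>"
  by (simp cong: measurable_cong_sets add: measurable_restrict_space1)

lemma integrable_circle_bounded:
  fixes \<phi> :: "complex \<Rightarrow> 'a::{banach,second_countable_topology}"
  assumes "\<phi> \<in> borel_measurable \<mu>" "AE z in \<mu>. norm (\<phi> z) \<le> B"
  shows "integrable \<mu> \<phi>"
  using circle.integrable_const_bound[OF assms(2,1)] .

lemma integrable_circle_continuous:
  fixes \<phi> :: "complex \<Rightarrow> 'a::{banach,second_countable_topology}"
  assumes "continuous_on (sphere 0 1) \<phi>"
  shows "integrable \<mu> \<phi>"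
proof -
  have "bounded (\<phi> ` sphere 0 1)"
    using assms by (simp add: compact_continuous_image compact_imp_bounded)
  then obtain B where "\<And>z. z \<in> sphere 0 1 \<Longrightarrow> norm (\<phi> z) \<le> B"
    unfolding bounded_iff by blast
  thus ?thesis
    by (intro integrable_circle_bounded[of _ B] measurable_circle assms AE_I2) auto
qed

lemma integral_circle:
  fixes \<phi> :: "complex \<Rightarrow> complex"
  assumes "continuous_on (sphere 0 1) \<phi>"
  shows "(LINT z|\<mu>. \<phi> z) = integral {0..2*pi} (\<lambda>t. \<phi> (cis t)) / (2*pi)"
proof -
  have [measurable]: "\<phi> \<in> borel_measurable (restrict_space borel (sphere 0 1))"
    using measurable_circle[OF assms] by (simp cong: measurable_cong_sets)
  have "(LINT z|\<mu>. \<phi> z) = (LINT t|uniform_measure lborel {0..2*pi}. \<phi> (cis t))"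
    unfolding circle_measure_def by (subst integral_distr) (auto cong: measurable_cong_sets)
  also have "uniform_measure lborel {0..2*pi} = density lborel (\<lambda>t. ennreal (indicator {0..2*pi} t / (2*pi)))"
    unfolding uniform_measure_def
    by (intro density_cong) (auto simp: divide_ennreal[symmetric] indicator_def ennreal_divide_eq_top_iff)
  also have "(LINT t|density lborel (\<lambda>t. ennreal (indicator {0..2*pi} t / (2*pi))). \<phi> (cis t)) =
     (LINT t|lborel. (indicator {0..2*pi} t / (2*pi)) *\<^sub>R \<phi> (cis t))"
    by (subst integral_density) auto
  also have "\<dots> = (LINT t|lborel. indicator {0..2*pi} t *\<^sub>R \<phi> (cis t) / (2*pi))"
    by (intro Bochner_Integration.integral_cong) (auto simp: indicator_def scaleR_conv_of_real)
  also have "\<dots> = (LINT t:{0..2*pi}|lborel. \<phi> (cis t)) / (2*pi)"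
    by (simp add: set_lebesgue_integral_def)
  also have "(LINT t:{0..2*pi}|lborel. \<phi> (cis t)) = integral {0..2*pi} (\<lambda>t. \<phi> (cis t))"
  proof (rule set_borel_integral_eq_integral)
    have "continuous_on {0..2*pi} (\<lambda>t. \<phi> (cis t))"
      by (rule continuous_on_compose2[OF assms]) (auto intro!: continuous_intros)
    thus "set_integrable lborel {0..2 * pi} (\<lambda>t. \<phi> (cis t))"
      by (rule borel_integrable_atLeastAtMost')
  qed
  finally show ?thesis .
qed

text \<open>Along w = cis t one has dw / w = i dt, so the contour integral of \<phi> w / w is 2 pi i
  times the mean of \<phi>. This lets Cauchy's formula be used for integrals against \<mu>.\<close>

lemma integral_circle_contour:
  assumes "continuous_on (sphere 0 1) \<phi>"
    and "((\<lambda>w. \<phi> w / w) has_contour_integral (2 * of_real pi * \<i> * I)) (circlepath 0 1)"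
  shows "(LINT z|\<mu>. \<phi> z) = I"
proof -
  have "((\<lambda>t. \<phi> (cis t) / cis t * cis t * \<i>) has_integral (2 * of_real pi * \<i> * I)) {0..2*pi}"
    using assms(2) unfolding circlepath_def
    by (subst (asm) has_contour_integral_part_circlepath_iff) (auto simp: mult_ac)
  hence "((\<lambda>t. \<phi> (cis t) * \<i>) has_integral (2 * of_real pi * \<i> * I)) {0..2*pi}"
    by simp
  from has_integral_mult_left[OF this, of "-\<i>"]
  have "((\<lambda>t. \<phi> (cis t)) has_integral (2 * of_real pi * I)) {0..2*pi}"
    by (simp add: mult_ac)
  thus ?thesis using integral_circle[OF assms(1)] by (simp add: integral_unique)
qed

section \<open>The Poisson kernel and reproduction on the closed disc\<close>

definition poisson :: "complex \<Rightarrow> complex \<Rightarrow> real" where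
  "poisson a w = (1 - (norm a)\<^sup>2) / (norm (w - a))\<^sup>2"

lemma continuous_on_poisson:
  assumes "norm a < 1" shows "continuous_on (sphere 0 1) (poisson a)"
  unfolding poisson_def using assms by (intro continuous_intros) auto

lemma poisson_nonneg: "norm a \<le> 1 \<Longrightarrow> 0 \<le> poisson a w"
  by (simp add: poisson_def power_le_one)

text \<open>For w on the circle, |w - a|^2 w = (w - a)(1 - cnj a w). Hence the Poisson integrand
  divided by w is the Cauchy integrand of G w = (1 - |a|^2) g w / (1 - cnj a w). The pole of G lies
  outside the closed disc and G a = g a, so Cauchy's formula applies.\<close>

lemma poisson_holomorphic:
  fixes g :: "complex \<Rightarrow> complex"
  assumes g: "g holomorphic_on cball 0 1" and a: "norm a < 1"
  shows "(LINT w|\<mu>. poisson a w * g w) = g a"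
proof (rule integral_circle_contour)
  have "continuous_on (sphere 0 1) g"
    using g holomorphic_on_imp_continuous_on continuous_on_subset by force
  thus "continuous_on (sphere 0 1) (\<lambda>w. poisson a w * g w)"
    using continuous_on_poisson[OF a] by (intro continuous_intros)
  define G where "G w = (1 - (norm a)\<^sup>2) * g w / (1 - cnj a * w)" for w
  have nz: "1 - cnj a * w \<noteq> 0" if "norm w \<le> 1" for w
  proof
    assume "1 - cnj a * w = 0"
    hence "norm (cnj a * w) = 1" by simp
    moreover have "norm a * norm w < 1" using a that
      by (metis mult_le_cancel_left1 norm_ge_zero not_less order_le_less_trans mult_left_le)
    ultimately show False by (simp add: norm_mult)
  qed
  have "G holomorphic_on cball 0 1" unfolding G_def using g nz by (intro holomorphic_intros) auto
  from Cauchy_integral_circlepath_simple[OF this, of a] a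
  have "((\<lambda>u. G u / (u - a)) has_contour_integral 2 * of_real pi * \<i> * G a) (circlepath 0 1)" by simp
  moreover have "G a = g a"
  proof -
    have "1 - cnj a * a = complex_of_real (1 - (norm a)\<^sup>2)"
      using complex_norm_square[of a] by (simp add: mult.commute)
    thus ?thesis using nz[of a] a unfolding G_def by auto
  qed
  ultimately have *: "((\<lambda>u. G u / (u - a)) has_contour_integral 2 * of_real pi * \<i> * g a) (circlepath 0 1)"
    by simp
  show "((\<lambda>w. complex_of_real (poisson a w) * g w / w) has_contour_integral
     2 * of_real pi * \<i> * g a) (circlepath 0 1)"
  proof (rule has_contour_integral_eq[OF *])
    fix w assume "w \<in> path_image (circlepath 0 1)"
    hence w: "norm w = 1" by simp
    have wc: "w * cnj w = 1" using complex_norm_square[of w] w by simp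
    have w0: "w \<noteq> 0" using w by auto
    have wa: "w \<noteq> a" using w a by auto
    have "complex_of_real ((norm (w - a))\<^sup>2) * w = (w - a) * (cnj w * w - cnj a * w)"
      by (simp only: complex_norm_square complex_cnj_diff) (simp add: algebra_simps)
    hence eq: "complex_of_real ((norm (w - a))\<^sup>2) * w = (w - a) * (1 - cnj a * w)" using wc by (simp add: mult.commute)
    have "complex_of_real (poisson a w) * g w / w = (1 - (norm a)\<^sup>2) * g w / (complex_of_real ((norm (w - a))\<^sup>2) * w)"
      by (simp add: poisson_def)
    also have "\<dots> = G w / (w - a)"
      unfolding eq G_def by simp
    finally show "G w / (w - a) = complex_of_real (poisson a w) * g w / w" by simp
  qed
qed

lemma poisson_le:
  assumes "norm a < 1" "norm w = 1"
  shows "poisson a w \<le> 2 / (1 - norm a)"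
proof -
  have d: "1 - norm a \<le> norm (w - a)" using norm_triangle_ineq2[of w a] assms by simp
  have "poisson a w \<le> (1 - (norm a)\<^sup>2) / (1 - norm a)\<^sup>2"
    unfolding poisson_def using assms d
    by (intro divide_left_mono power_mono mult_pos_pos) (auto simp: power_le_one)
  also have "\<dots> = (1 + norm a) / (1 - norm a)"
  proof -
    have "1 - (norm a)\<^sup>2 = (1 + norm a) * (1 - norm a)" by (simp add: power2_eq_square algebra_simps)
    thus ?thesis using assms by (simp add: power2_eq_square)
  qed
  also have "\<dots> \<le> 2 / (1 - norm a)" using assms by (intro divide_right_mono) auto
  finally show ?thesis .
qed

lemma mean_value_holomorphic:
  fixes g :: "complex \<Rightarrow> complex"
  assumes "g holomorphic_on cball 0 1"
  shows "(LINT w|\<mu>. g w) = g 0"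
proof -
  have "(LINT w|\<mu>. g w) = (LINT w|\<mu>. poisson 0 w * g w)"
    by (intro Bochner_Integration.integral_cong) (auto simp: poisson_def)
  thus ?thesis using poisson_holomorphic[OF assms, of 0] by simp
qed

section \<open>The radial maximal inequality\<close>

text \<open>With y = x/2, the inequality y \<le> tan y gives sin x = 2 sin y cos y \<ge> 2 y (cos
  y)^2 = y (1 + cos x), and cos x \<ge> 0 on this range.\<close>

lemma half_le_sin:
  fixes x :: real
  assumes "0 \<le> x" "x \<le> pi / 2"
  shows "x / 2 \<le> sin x"
proof -
  define y where "y = x / 2"
  have y: "0 \<le> y" "y < pi / 2" using assms pi_gt_zero unfolding y_def by linarith+
  have c: "0 < cos y" using y by (intro cos_gt_zero_pi) auto
  have "y \<le> tan y" using abs_tan_ge[of y] y tan_pos_pi2_le[of y] by auto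
  hence "y * cos y \<le> sin y" using c by (simp add: tan_def field_simps)
  hence "2 * (y * cos y) * cos y \<le> 2 * sin y * cos y" using c by (intro mult_right_mono) auto
  also have "\<dots> = sin x" using sin_double[of y] by (simp add: y_def)
  finally have "y * (2 * (cos y)\<^sup>2) \<le> sin x" by (simp add: power2_eq_square mult_ac)
  moreover have "2 * (cos y)\<^sup>2 = 1 + cos x" using cos_double_cos[of y] by (simp add: y_def)
  moreover have "0 \<le> cos x" using assms by (intro cos_ge_zero) auto
  ultimately have "y * 1 \<le> sin x"
    using mult_left_mono[of 1 "2 * (cos y)\<^sup>2" y] y by simp
  thus ?thesis by (simp add: y_def)
qed

text \<open>The left side is the distance from |x| to the nearer of the zeros 0 and pi of the sine.
  With x half a difference of angles, the lemma turns a bound on a chord into a bound on the angular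
  distance modulo 2 pi.\<close>

lemma min_le_two_abs_sin:
  fixes x :: real
  assumes "\<bar>x\<bar> \<le> pi"
  shows "min \<bar>x\<bar> (pi - \<bar>x\<bar>) \<le> 2 * \<bar>sin x\<bar>"
proof -
  have 1: "\<bar>sin x\<bar> = sin \<bar>x\<bar>" using assms by (auto simp: abs_if sin_ge_zero not_less)
      (use sin_ge_zero[of "-x"] sin_ge_zero[of x] in auto)
  show ?thesis
  proof (cases "\<bar>x\<bar> \<le> pi / 2")
    case True
    thus ?thesis using half_le_sin[of "\<bar>x\<bar>"] 1 by auto
  next
    case False
    thus ?thesis using half_le_sin[of "pi - \<bar>x\<bar>"] 1 assms by (auto simp: sin_diff)
  qed
qed

lemma norm_cis_diff: "norm (cis s - cis t) = 2 * \<bar>sin ((s - t) / 2)\<bar>"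
proof -
  have "cis s - cis t = cis t * (cis (s - t) - 1)" by (simp add: right_diff_distrib cis_mult)
  hence "norm (cis s - cis t) = norm (cis (s - t) - 1)" by (simp add: norm_mult)
  also have "\<dots> = 2 * \<bar>sin ((s - t) / 2)\<bar>"
    using dist_exp_i_1[of "s - t"] by (simp add: cis_conv_exp)
  finally show ?thesis .
qed

lemma sphere_Int_sets [measurable]: "A \<in> sets borel \<Longrightarrow> sphere 0 1 \<inter> A \<in> sets \<mu>"
  by (auto simp: sets_restrict_space)

lemma sphere_sets_circle [simp]: "sphere 0 1 \<in> sets (restrict_space borel (sphere 0 1))"
  by (auto simp: sets_restrict_space)

lemma emeasure_circle_ball_le:
  assumes "norm z = 1" "0 \<le> e"
  shows "emeasure \<mu> (sphere 0 1 \<inter> ball z e) \<le> ennreal (2 * e)"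
proof -
  obtain \<theta> where \<theta>: "0 \<le> \<theta>" "\<theta> < 2 * pi" "z = cis \<theta>"
    using assms(1) by (metis Arg2pi_eq Arg2pi_ge_0 Arg2pi_lt_2pi cis_conv_exp mult.left_neutral of_real_1)
  \<comment> \<open>The chord bound confines t to distance at most 2e from \<theta> modulo 2 pi, and
    for t in \<open>{0..2*pi}\<close> three translates are enough. Each interval has length 4e; the
    total 12e divided by 2 pi is at most 2e because pi > 3.\<close>
  define I where "I s = {s - 2 * e..s + 2 * e}" for s :: real
  have "{t\<in>{0..2*pi}. cis t \<in> sphere 0 1 \<inter> ball z e} \<subseteq> I \<theta> \<union> (I (\<theta> - 2 * pi) \<union> I (\<theta> + 2 * pi))"
  proof (intro subsetI, rule ccontr)
    fix t assume "t \<in> {t\<in>{0..2*pi}. cis t \<in> sphere 0 1 \<inter> ball z e}"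
      and "t \<notin> I \<theta> \<union> (I (\<theta> - 2 * pi) \<union> I (\<theta> + 2 * pi))"
    hence t: "t \<in> {0..2*pi}" "cis t \<in> ball z e" "t \<notin> I (\<theta> + 2 * pi)" "t \<notin> I (\<theta> - 2 * pi)" "t \<notin> I \<theta>"
      by auto
    have "norm (cis t - cis \<theta>) < e" using t(2) \<theta> by (simp add: dist_norm norm_minus_commute)
    hence "min \<bar>(t - \<theta>) / 2\<bar> (pi - \<bar>(t - \<theta>) / 2\<bar>) < e"
      using min_le_two_abs_sin[of "(t - \<theta>) / 2"] t(1) \<theta> unfolding norm_cis_diff
      by (intro order_le_less_trans[OF min_le_two_abs_sin]) (auto simp: abs_le_iff)
    hence "\<bar>t - \<theta>\<bar> < 2 * e \<or> 2 * pi - 2 * e < \<bar>t - \<theta>\<bar>"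
      by (auto simp: min_less_iff_disj)
    moreover have "0 \<le> t" "t \<le> 2 * pi" "\<not> (\<theta> - 2 * pi - 2 * e \<le> t \<and> t \<le> \<theta> - 2 * pi + 2 * e)"
      "\<not> (\<theta> + 2 * pi - 2 * e \<le> t \<and> t \<le> \<theta> + 2 * pi + 2 * e)" using t by (auto simp: I_def)
    ultimately have "\<theta> - 2 * e \<le> t \<and> t \<le> \<theta> + 2 * e" using \<theta> assms(2) by linarith
    thus False using t by (simp add: I_def)
  qed
  hence "emeasure lborel {t\<in>{0..2*pi}. cis t \<in> sphere 0 1 \<inter> ball z e} \<le>
    emeasure lborel (I \<theta> \<union> (I (\<theta> - 2 * pi) \<union> I (\<theta> + 2 * pi)))"
    by (intro emeasure_mono) (auto simp: I_def)
  also have "\<dots> \<le> emeasure lborel (I \<theta>) + (emeasure lborel (I (\<theta> - 2 * pi)) + emeasure lborel (I (\<theta> + 2 * pi)))"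
    by (intro order_trans[OF emeasure_subadditive] add_mono order_refl) (auto simp: I_def)
  also have "\<dots> = ennreal (12 * e)"
    using assms by (simp add: I_def flip: ennreal_plus)
  finally have "emeasure \<mu> (sphere 0 1 \<inter> ball z e) \<le> ennreal (12 * e) / ennreal (2 * pi)"
    by (subst emeasure_circle, measurable) (auto intro: divide_right_mono_ennreal)
  also have "\<dots> = ennreal (12 * e / (2 * pi))"
    using assms by (subst divide_ennreal) auto
  also have "\<dots> \<le> ennreal (2 * e)"
  proof (rule ennreal_leI)
    show "12 * e / (2 * pi) \<le> 2 * e"
      using pi_gt3 assms(2) mult_right_mono[of 3 pi e] by (simp add: field_simps)
  qed
  finally show ?thesis .
qed

text \<open>Arcs are traces of discs on the circle, which makes the planar Vitali covering lemma
  applicable.\<close>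

lemma hardy_littlewood_circle:
  fixes \<phi> :: "complex \<Rightarrow> ennreal"
  assumes [measurable]: "\<phi> \<in> borel_measurable \<mu>"
    and fin: "(\<integral>\<^sup>+w. \<phi> w \<partial>\<mu>) \<le> ennreal A" and l: "0 < l" and A: "0 \<le> A"
    and E: "E \<subseteq> sphere 0 1"
    and large: "\<And>z. z \<in> E \<Longrightarrow>
      \<exists>e>0. ennreal (l * e) < (\<integral>\<^sup>+w. \<phi> w * indicator (ball z e) w \<partial>\<mu>)"
  shows "emeasure \<mu> E \<le> ennreal (10 * A / l)"
proof -
  define \<nu> where "\<nu> = density \<mu> \<phi>"
  have [simp]: "sets \<nu> = sets \<mu>" "space \<nu> = sphere 0 1"
    by (simp_all add: \<nu>_def)
  define S where "S z e = sphere 0 1 \<inter> ball z e" for z :: complex and e :: real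
  have [measurable]: "S z e \<in> sets \<mu>" for z e
    unfolding S_def by (rule sphere_Int_sets) auto
  have \<nu>S: "emeasure \<nu> (S z e) = (\<integral>\<^sup>+w. \<phi> w * indicator (ball z e) w \<partial>\<mu>)" for z e
    unfolding \<nu>_def by (subst emeasure_density, measurable) (auto intro!: nn_integral_cong simp: S_def indicator_def)
  define K where "K = {(z, e). z \<in> E \<and> 0 < e \<and> ennreal (l * e) < emeasure \<nu> (S z e)}"
  have "emeasure \<nu> (sphere 0 1) \<le> ennreal A"
    using fin unfolding \<nu>_def by (subst emeasure_density) (auto cong: nn_integral_cong_simp
       intro!: order_trans[OF nn_integral_mono fin] simp: indicator_def)
  hence tot: "emeasure \<nu> X \<le> ennreal A" for X
    using emeasure_space[of \<nu> X] by simp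
  obtain C where C: "countable C" "C \<subseteq> K"
     "pairwise (\<lambda>i j. disjnt (ball (fst i) (snd i)) (ball (fst j) (snd j))) C"
     "E \<subseteq> (\<Union>i\<in>C. ball (fst i) (5 * snd i))"
  proof (rule Vitali_covering_lemma_balls[where S = E and K = K and a = fst and r = snd and B = "A / l"])
    show "E \<subseteq> (\<Union>i\<in>K. ball (fst i) (snd i))"
      using large unfolding K_def \<nu>S by force
    \<comment> \<open>The disc of index i satisfies l e < \<nu>-mass \<le> A, so the radii are
      bounded by A / l, as the covering lemma demands.\<close>
    fix i assume i: "i \<in> K"
    hence "ennreal (l * snd i) < ennreal A" using tot unfolding K_def by (auto intro: less_le_trans)
    hence "l * snd i < A" using A i l by (subst (asm) ennreal_less_iff) (auto simp: K_def)
    thus "0 < snd i \<and> snd i \<le> A / l" using i l by (auto simp: K_def field_simps)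
  qed blast
  \<comment> \<open>The countable family \<open>C\<close> may be finite or infinite. It is indexed
    by a set \<open>N\<close> of naturals, and \<open>X\<close>, \<open>Y\<close> are empty off
    \<open>N\<close>, so that sums and unions can run over all naturals in either case.\<close>
  define N where "N = to_nat_on C ` C"
  define c where "c = from_nat_into C"
  have inj: "inj_on c N"
    unfolding c_def N_def using C(1) by (auto simp: inj_on_def)
  have cC: "c n \<in> C" if "n \<in> N" for n
    using that C(1) by (auto simp: c_def N_def)
  have surj: "\<exists>n\<in>N. i = c n" if "i \<in> C" for i
    using that C(1) by (auto simp: c_def N_def intro!: bexI[of _ "to_nat_on C i"])
  define X where "X n = (if n \<in> N then S (fst (c n)) (5 * snd (c n)) else {})" for n
  define Y where "Y n = (if n \<in> N then S (fst (c n)) (snd (c n)) else {})" for n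
  have [measurable]: "X n \<in> sets \<mu>" "Y n \<in> sets \<mu>" for n
    by (auto simp: X_def Y_def simp del: sets_circle)
  have disj: "disjoint_family Y"
    unfolding disjoint_family_on_def
  proof safe
    fix m n x assume mn: "m \<noteq> n" and x: "x \<in> Y m" "x \<in> Y n"
    hence N: "m \<in> N" "n \<in> N" by (auto simp: Y_def split: if_splits)
    hence "c m \<noteq> c n" using inj mn by (auto simp: inj_on_def)
    hence "disjnt (ball (fst (c m)) (snd (c m))) (ball (fst (c n)) (snd (c n)))"
      using C(3) cC N by (auto simp: pairwise_def)
    thus "x \<in> {}" using x N by (auto simp: Y_def S_def disjnt_iff)
  qed
  \<comment> \<open>The constant 10 is the Vitali enlargement factor 5 times the factor 2 of
    \<open>emeasure_circle_ball_le\<close>.\<close>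
  have XY: "emeasure \<mu> (X n) \<le> ennreal (10 / l) * emeasure \<nu> (Y n)" for n
  proof (cases "n \<in> N")
    case True
    obtain z e where ze: "c n = (z, e)" by force
    hence K: "(z, e) \<in> K" using cC[OF True] C(2) by auto
    hence z: "norm z = 1" "0 < e" using E by (auto simp: K_def)
    have "emeasure \<mu> (X n) \<le> ennreal (2 * (5 * e))"
      using emeasure_circle_ball_le[OF z(1), of "5 * e"] z True ze by (simp add: X_def S_def)
    also have "\<dots> = ennreal (10 / l) * ennreal (l * e)"
      using l z by (simp add: ennreal_mult[symmetric])
    also have "\<dots> \<le> ennreal (10 / l) * emeasure \<nu> (S z e)"
      using K by (intro mult_left_mono) (auto simp: K_def)
    finally show ?thesis using True ze by (simp add: Y_def)
  qed (simp add: X_def)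
  have "E \<subseteq> (\<Union>n. X n)"
  proof
    fix x assume x: "x \<in> E"
    then obtain i where i: "i \<in> C" "x \<in> ball (fst i) (5 * snd i)" using C(4) by blast
    obtain n where "n \<in> N" "i = c n" using surj[OF i(1)] by blast
    thus "x \<in> (\<Union>n. X n)" using i x E by (auto simp: X_def S_def intro!: exI[of _ n])
  qed
  hence "emeasure \<mu> E \<le> emeasure \<mu> (\<Union>n. X n)"
    by (intro emeasure_mono) (auto simp del: sets_circle)
  also have "\<dots> \<le> (\<Sum>n. emeasure \<mu> (X n))"
    by (intro emeasure_subadditive_countably) (auto simp del: sets_circle)
  also have "\<dots> \<le> (\<Sum>n. ennreal (10 / l) * emeasure \<nu> (Y n))"
    using XY by (intro suminf_le) auto
  also have "\<dots> = ennreal (10 / l) * (\<Sum>n. emeasure \<nu> (Y n))"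
    by (rule ennreal_suminf_cmult)
  also have "(\<Sum>n. emeasure \<nu> (Y n)) = emeasure \<nu> (\<Union>n. Y n)"
    using disj by (intro suminf_emeasure) (auto simp del: sets_circle)
  also have "ennreal (10 / l) * \<dots> \<le> ennreal (10 / l) * ennreal A"
    by (intro mult_left_mono tot) auto
  also have "\<dots> = ennreal (10 * A / l)"
    using A l by (simp add: ennreal_mult[symmetric])
  finally show ?thesis .
qed

text \<open>Let \<delta> = 1 - r. If w lies at distance d from z with 2^k \<delta> \<le> d < 2^(k+1)
  \<delta>, then |w - r z| \<ge> d/2 and 1 - r^2 \<le> 2 \<delta>, so the kernel is at most 2
  \<delta> / (2^k \<delta> / 2)^2 = 8 / (4^k \<delta>); for d < 2 \<delta> the trivial bound 2 /
  \<delta> suffices. The condition on \<open>n\<close> makes the largest disc have radius above 2,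
  so that it contains the whole circle.\<close>

lemma poisson_le_dyadic:
  assumes r: "0 \<le> r" "r < 1" and z: "norm z = 1" and w: "norm w = 1"
    and n: "2 < 2 ^ Suc n * (1 - r)"
  shows "poisson (of_real r * z) w \<le>
    (\<Sum>k\<le>n. 8 / (4 ^ k * (1 - r)) * indicator (ball z (2 ^ Suc k * (1 - r))) w)"
proof -
  define \<delta> where "\<delta> = 1 - r"
  define d where "d = norm (w - z)"
  have \<delta>: "0 < \<delta>" using r by (simp add: \<delta>_def)
  have d2: "d \<le> 2" unfolding d_def using norm_triangle_ineq4[of w z] z w by simp
  define k where "k = (LEAST k. d < 2 ^ Suc k * \<delta>)"
  have dn: "d < 2 ^ Suc n * \<delta>" using d2 n by (simp add: \<delta>_def)
  have k1: "d < 2 ^ Suc k * \<delta>" unfolding k_def by (rule LeastI) (rule dn)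
  have kn: "k \<le> n" unfolding k_def by (rule Least_le) (rule dn)
  have na: "norm (of_real r * z) = r" using r z by (simp add: norm_mult)
  have main: "poisson (of_real r * z) w \<le> 8 / (4 ^ k * \<delta>)"
  proof (cases "k = 0")
    case True
    have "poisson (of_real r * z) w \<le> 2 / \<delta>"
      using poisson_le[of "of_real r * z" w] na r w by (simp add: \<delta>_def)
    also have "\<dots> \<le> 8 / \<delta>" using \<delta> by (intro divide_right_mono) auto
    finally show ?thesis using True by simp
  next
    case False
    then obtain j where j: "k = Suc j" using not0_implies_Suc by blast
    hence "\<not> d < 2 ^ Suc j * \<delta>" unfolding k_def by (metis lessI not_less_Least)
    hence dk: "2 ^ k * \<delta> \<le> d" using j by simp
    have "\<delta> \<le> norm (w - of_real r * z)"
      using norm_triangle_ineq2[of w "of_real r * z"] na w by (simp add: \<delta>_def)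
    moreover have "d \<le> norm (w - of_real r * z) + norm (of_real r * z - z)"
      unfolding d_def using norm_triangle_ineq[of "w - of_real r * z" "of_real r * z - z"] by simp
    moreover have "norm (of_real r * z - z) = \<delta>"
    proof -
      have "of_real r * z - z = of_real (r - 1) * z" by (simp add: algebra_simps)
      thus ?thesis using z r by (simp only: norm_mult norm_of_real) (simp add: \<delta>_def)
    qed
    ultimately have "d \<le> 2 * norm (w - of_real r * z)" by simp
    hence half: "2 ^ k * \<delta> / 2 \<le> norm (w - of_real r * z)" using dk by simp
    have pos: "0 < 2 ^ k * \<delta> / 2" using \<delta> by simp
    have "poisson (of_real r * z) w \<le> (1 - r\<^sup>2) / (2 ^ k * \<delta> / 2)\<^sup>2"
      unfolding poisson_def na using half pos r
      by (intro divide_left_mono power_mono mult_pos_pos zero_less_power) (auto simp: power_le_one)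
    also have "\<dots> \<le> (2 * \<delta>) / (2 ^ k * \<delta> / 2)\<^sup>2"
    proof (intro divide_right_mono)
      have "1 - r\<^sup>2 = (1 + r) * \<delta>" by (simp add: \<delta>_def power2_eq_square algebra_simps)
      thus "1 - r\<^sup>2 \<le> 2 * \<delta>" using r \<delta> by (simp add: mult_right_mono)
    qed auto
    also have "\<dots> = 8 / (4 ^ k * \<delta>)"
    proof -
      have "(2 ^ k :: real)\<^sup>2 = 4 ^ k" by (simp add: power_mult[symmetric] mult.commute[of k] power_mult)
      thus ?thesis using \<delta> by (simp add: power_mult_distrib power_divide power2_eq_square field_simps)
    qed
    finally show ?thesis .
  qed
  also have "\<dots> = 8 / (4 ^ k * \<delta>) * indicator (ball z (2 ^ Suc k * \<delta>)) w"
    using k1 by (simp add: d_def dist_norm norm_minus_commute)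
  also have "\<dots> \<le> (\<Sum>k\<le>n. 8 / (4 ^ k * \<delta>) * indicator (ball z (2 ^ Suc k * \<delta>)) w)"
    using kn \<delta> by (intro member_le_sum[of k "{..n}" "\<lambda>k. 8 / (4 ^ k * \<delta>) * indicator (ball z (2 ^ Suc k * \<delta>)) w"])
      (auto simp: indicator_def)
  finally show ?thesis by (simp add: \<delta>_def)
qed

text \<open>Integrating the dyadic bound against |g|, the k-th disc contributes at most 8 / (4^k
  \<delta>) times c 2^(k+1) \<delta>, that is 16 c / 2^k. The geometric series gives 32 c,
  independently of r.\<close>

lemma radial_bound_of_averages:
  assumes g: "g holomorphic_on cball 0 1" and z: "norm z = 1" and r: "0 \<le> r" "r < 1" and c: "0 \<le> c"
    and avg: "\<And>e. 0 < e \<Longrightarrow>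
      (\<integral>\<^sup>+w. ennreal (norm (g w)) * indicator (ball z e) w \<partial>\<mu>) \<le> ennreal (c * e)"
  shows "norm (g (of_real r * z)) \<le> 32 * c"
proof -
  define \<delta> where "\<delta> = 1 - r"
  have \<delta>: "0 < \<delta>" using r by (simp add: \<delta>_def)
  obtain n0 :: nat where "2 / \<delta> < 2 ^ n0" using real_arch_pow[of 2 "2 / \<delta>"] by auto
  moreover have "(2::real) ^ n0 \<le> 2 ^ Suc n0" by simp
  ultimately have n0: "2 < 2 ^ Suc n0 * \<delta>" using \<delta> by (simp add: field_simps)
  define a where "a = of_real r * z"
  have a: "norm a < 1" using r z by (simp add: a_def norm_mult)
  have cont: "continuous_on (sphere 0 1) g"
    using g holomorphic_on_imp_continuous_on continuous_on_subset by force
  have gm: "(\<lambda>w. ennreal (norm (g w))) \<in> borel_measurable \<mu>"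
    by (intro measurable_compose[OF measurable_circle measurable_ennreal] continuous_intros cont)
  note [measurable] = gm
  have [measurable]: "indicator (ball z e) \<in> borel_measurable \<mu>" for e
    by (intro borel_measurable_circle_borel borel_measurable_indicator) auto
  have "ennreal (norm (g a)) = ennreal (norm (LINT w|\<mu>. poisson a w * g w))"
    by (simp add: poisson_holomorphic[OF g a])
  also have "\<dots> \<le> (\<integral>\<^sup>+w. ennreal (norm (poisson a w * g w)) \<partial>\<mu>)"
    by (intro integral_norm_bound_ennreal integrable_circle_continuous continuous_intros continuous_on_poisson a cont)
  also have "\<dots> \<le> (\<integral>\<^sup>+w. (\<Sum>k\<le>n0. ennreal (8 / (4 ^ k * \<delta>)) *
     (ennreal (norm (g w)) * indicator (ball z (2 ^ Suc k * \<delta>)) w)) \<partial>\<mu>)"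
  proof (rule nn_integral_mono)
    fix w assume "w \<in> space \<mu>"
    hence w: "norm w = 1" by simp
    have "norm (poisson a w * g w) = poisson a w * norm (g w)"
      using poisson_nonneg[of a w] a by (simp add: norm_mult)
    also have "\<dots> \<le> (\<Sum>k\<le>n0. 8 / (4 ^ k * \<delta>) * indicator (ball z (2 ^ Suc k * \<delta>)) w) * norm (g w)"
      using poisson_le_dyadic[OF r z w, of n0] n0 unfolding a_def \<delta>_def
      by (intro mult_right_mono) auto
    also have "\<dots> = (\<Sum>k\<le>n0. 8 / (4 ^ k * \<delta>) * (norm (g w) * indicator (ball z (2 ^ Suc k * \<delta>)) w))"
      unfolding sum_distrib_right by (simp add: mult_ac)
    finally have "ennreal (norm (poisson a w * g w)) \<le>
       ennreal (\<Sum>k\<le>n0. 8 / (4 ^ k * \<delta>) * (norm (g w) * indicator (ball z (2 ^ Suc k * \<delta>)) w))"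
      by (rule ennreal_leI)
    also have "\<dots> = (\<Sum>k\<le>n0. ennreal (8 / (4 ^ k * \<delta>) * (norm (g w) * indicator (ball z (2 ^ Suc k * \<delta>)) w)))"
      using \<delta> by (intro sum_ennreal[symmetric]) (auto simp: indicator_def)
    also have "\<dots> = (\<Sum>k\<le>n0. ennreal (8 / (4 ^ k * \<delta>)) *
     (ennreal (norm (g w)) * indicator (ball z (2 ^ Suc k * \<delta>)) w))"
      using \<delta> by (intro sum.cong refl) (auto simp: indicator_def ennreal_mult[symmetric])
    finally show "ennreal (norm (poisson a w * g w)) \<le> \<dots>" .
  qed
  also have "\<dots> = (\<Sum>k\<le>n0. ennreal (8 / (4 ^ k * \<delta>)) *
     (\<integral>\<^sup>+w. ennreal (norm (g w)) * indicator (ball z (2 ^ Suc k * \<delta>)) w \<partial>\<mu>))"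
    by (subst nn_integral_sum) (auto intro!: sum.cong nn_integral_cmult)
  also have "\<dots> \<le> (\<Sum>k\<le>n0. ennreal (8 / (4 ^ k * \<delta>)) * ennreal (c * (2 ^ Suc k * \<delta>)))"
    using \<delta> by (intro sum_mono mult_left_mono avg) auto
  also have "\<dots> = ennreal (\<Sum>k\<le>n0. (8 / (4 ^ k * \<delta>)) * (c * (2 ^ Suc k * \<delta>)))"
    using \<delta> c by (subst sum_ennreal[symmetric]) (auto simp flip: ennreal_mult intro!: sum.cong)
  also have "(\<Sum>k\<le>n0. (8 / (4 ^ k * \<delta>)) * (c * (2 ^ Suc k * \<delta>))) = 16 * c * (\<Sum>k\<le>n0. (1/2) ^ k)"
    unfolding sum_distrib_left
  proof (intro sum.cong refl)
    fix k
    have "(4::real) ^ k = 2 ^ k * 2 ^ k" by (simp flip: power_mult_distrib)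
    thus "(8 / (4 ^ k * \<delta>)) * (c * (2 ^ Suc k * \<delta>)) = 16 * c * (1/2) ^ k"
      using \<delta> by (simp add: field_simps power_divide)
  qed
  also have "\<dots> \<le> 16 * c * 2"
  proof (intro mult_left_mono)
    have "(\<Sum>k\<le>n0. (1/2::real) ^ k) \<le> suminf (\<lambda>k. (1/2) ^ k)"
      by (intro sum_le_suminf summable_geometric) auto
    also have "\<dots> = 2" by (simp add: suminf_geometric)
    finally show "(\<Sum>k\<le>n0. (1/2::real) ^ k) \<le> 2" .
  qed (use c in auto)
  finally have "ennreal (norm (g a)) \<le> ennreal (16 * c * 2)" by (auto simp: ennreal_leI)
  thus ?thesis using c by (simp add: a_def ennreal_le_iff)
qed

text \<open>By contraposition of \<open>radial_bound_of_averages\<close>, a value above l somewhere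
  on the radius to z forces some average of |g| around z to exceed the level l/32. The covering
  estimate at that level gives 10 times 32 = 320.\<close>

lemma maximal_inequality_cball:
  assumes g: "g holomorphic_on cball 0 1" and l: "0 < l"
    and A: "(\<integral>\<^sup>+w. ennreal (norm (g w)) \<partial>\<mu>) \<le> ennreal A" "0 \<le> A"
  shows "emeasure \<mu> {z\<in>sphere 0 1. \<exists>r\<in>{0..<1}. l < norm (g (of_real r * z))} \<le> ennreal (320 * A / l)"
proof -
  have cont: "continuous_on (sphere 0 1) g"
    using g holomorphic_on_imp_continuous_on continuous_on_subset by force
  have "emeasure \<mu> {z\<in>sphere 0 1. \<exists>r\<in>{0..<1}. l < norm (g (of_real r * z))} \<le> ennreal (10 * A / (l / 32))"
  proof (rule hardy_littlewood_circle[where \<phi> = "\<lambda>w. ennreal (norm (g w))"])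
    show "(\<lambda>w. ennreal (norm (g w))) \<in> borel_measurable \<mu>"
      by (intro measurable_compose[OF measurable_circle measurable_ennreal] continuous_intros cont)
    fix z assume "z \<in> {z\<in>sphere 0 1. \<exists>r\<in>{0..<1}. l < norm (g (of_real r * z))}"
    then obtain r where z: "norm z = 1" and r: "0 \<le> r" "r < 1" "l < norm (g (of_real r * z))" by auto
    show "\<exists>e>0. ennreal (l / 32 * e) < (\<integral>\<^sup>+w. ennreal (norm (g w)) * indicator (ball z e) w \<partial>\<mu>)"
    proof (rule ccontr)
      assume "\<not> ?thesis"
      hence "norm (g (of_real r * z)) \<le> 32 * (l / 32)"
        using l by (intro radial_bound_of_averages[OF g z r(1,2)]) (force simp: not_less)+
      thus False using r by simp
    qed
  qed (use A l in auto)
  thus ?thesis by (simp add: mult_ac)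
qed

text \<open>For each fixed r the set is relatively open in the circle, and openness survives unions
  over arbitrary, also uncountable, sets \<open>R\<close> of radii. This provides measurability of
  the sets where a radial maximal function is large.\<close>

lemma open_radial_sup:
  assumes "continuous_on (ball 0 1) h" and R: "R \<subseteq> {0..<1}"
  shows "{z\<in>sphere 0 1. \<exists>r\<in>R. l < norm (h (of_real r * z))} \<in> sets \<mu>"
proof -
  have "openin (top_of_set (sphere 0 1)) {z\<in>sphere 0 1. l < norm (h (of_real r * z))}" if "r \<in> R" for r
  proof -
    have "continuous_on (sphere 0 1) (\<lambda>z. norm (h (of_real r * z)))"
      by (intro continuous_on_norm continuous_on_compose2[OF assms(1)] continuous_intros)
        (use that R in \<open>auto simp: norm_mult\<close>)
    hence "openin (top_of_set (sphere 0 1)) (sphere 0 1 \<inter> (\<lambda>z. norm (h (of_real r * z))) -` {l<..})"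
      by (rule continuous_openin_preimage_gen) auto
    thus ?thesis by (simp add: vimage_def Int_def)
  qed
  hence "openin (top_of_set (sphere 0 1)) (\<Union>r\<in>R. {z\<in>sphere 0 1. l < norm (h (of_real r * z))})"
    by (intro openin_Union) auto
  moreover have "(\<Union>r\<in>R. {z\<in>sphere 0 1. l < norm (h (of_real r * z))}) =
     {z\<in>sphere 0 1. \<exists>r\<in>R. l < norm (h (of_real r * z))}" by auto
  ultimately obtain U where "open U" "{z\<in>sphere 0 1. \<exists>r\<in>R. l < norm (h (of_real r * z))} = sphere 0 1 \<inter> U"
    by (auto simp: openin_open)
  thus ?thesis using sphere_Int_sets[of U] by simp
qed

text \<open>Here \<open>h\<close> need not extend to the closed disc. The closed-disc inequality is
  applied to the dilates by \<open>R n\<close>, whose bound does not depend on n, and the sets for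
  radii below \<open>R n\<close> increase to the full set.\<close>

lemma maximal_inequality:
  assumes h: "h holomorphic_on ball 0 1" and l: "0 < l" and A: "0 \<le> A"
    and bound: "\<And>r. 0 < r \<Longrightarrow> r < 1 \<Longrightarrow> (\<integral>\<^sup>+w. ennreal (norm (dilate h r w)) \<partial>\<mu>) \<le> ennreal A"
  shows "emeasure \<mu> {z\<in>sphere 0 1. \<exists>r\<in>{0..<1}. l < norm (dilate h r z)} \<le> ennreal (320 * A / l)"
proof -
  \<comment> \<open>Starting from n + 2 keeps \<open>R n\<close> positive, since radii are divided
    by it below.\<close>
  define R where "R n = 1 - 1 / (real n + 2)" for n
  have R: "0 < R n" "R n < 1" for n by (auto simp: R_def)
  have Rmono: "R m \<le> R n" if "m \<le> n" for m n
    using that unfolding R_def by (intro diff_left_mono divide_left_mono) auto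
  define E where "E n = {z\<in>sphere 0 1. \<exists>r\<in>{0..<R n}. l < norm (dilate h r z)}" for n
  have E [measurable]: "E n \<in> sets \<mu>" for n
    unfolding E_def dilate_def using h R[of n]
    by (intro open_radial_sup holomorphic_on_imp_continuous_on) auto
  have EA: "emeasure \<mu> (E n) \<le> ennreal (320 * A / l)" for n
  proof -
    have g: "dilate h (R n) holomorphic_on cball 0 1"
      unfolding dilate_def
    proof (intro holomorphic_on_compose_gen[of "\<lambda>z. of_real (R n) * z", unfolded o_def, OF _ h] holomorphic_intros)
      have "R n * norm x < 1" if "norm x \<le> 1" for x :: complex
        using R[of n] that by (meson le_less_trans mult_left_le less_imp_le)
      thus "(\<lambda>z. complex_of_real (R n) * z) ` cball 0 1 \<subseteq> ball 0 1"
        using R[of n] by (auto simp: norm_mult)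
    qed
    have "E n \<subseteq> {z\<in>sphere 0 1. \<exists>r\<in>{0..<1}. l < norm (dilate h (R n) (of_real r * z))}"
    proof
      fix z assume "z \<in> E n"
      then obtain r where r: "0 \<le> r" "r < R n" "l < norm (dilate h r z)" "z \<in> sphere 0 1" by (auto simp: E_def)
      have "r / R n \<in> {0..<1}" using r R[of n] by auto
      moreover have "complex_of_real (R n) * (of_real (r / R n) * z) = of_real r * z"
        using R[of n] by (simp add: field_simps)
      ultimately show "z \<in> {z\<in>sphere 0 1. \<exists>r\<in>{0..<1}. l < norm (dilate h (R n) (of_real r * z))}"
        using r unfolding dilate_def by (auto intro!: bexI[of _ "r / R n"])
    qed
    hence "emeasure \<mu> (E n) \<le> emeasure \<mu> {z\<in>sphere 0 1. \<exists>r\<in>{0..<1}. l < norm (dilate h (R n) (of_real r * z))}"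
      using holomorphic_on_imp_continuous_on[OF holomorphic_on_subset[OF g ball_subset_cball]]
      by (intro emeasure_mono open_radial_sup) auto
    also have "\<dots> \<le> ennreal (320 * A / l)"
      by (intro maximal_inequality_cball g l A bound R)
    finally show ?thesis .
  qed
  have "{z\<in>sphere 0 1. \<exists>r\<in>{0..<1}. l < norm (dilate h r z)} = (\<Union>n. E n)"
  proof (intro equalityI subsetI)
    fix z assume "z \<in> {z\<in>sphere 0 1. \<exists>r\<in>{0..<1}. l < norm (dilate h r z)}"
    then obtain r where r: "0 \<le> r" "r < 1" "l < norm (dilate h r z)" "z \<in> sphere 0 1" by auto
    obtain n where "1 / (1 - r) < real n" using reals_Archimedean2 by blast
    hence "1 / (real n + 2) < 1 - r" using r by (simp add: field_simps)
    hence "r < R n" by (simp add: R_def)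
    thus "z \<in> (\<Union>n. E n)" using r by (auto simp: E_def intro!: exI[of _ n] bexI[of _ r])
  next
    fix z assume "z \<in> (\<Union>n. E n)"
    then obtain n r where "0 \<le> r" "r < R n" "l < norm (dilate h r z)" "z \<in> sphere 0 1" by (auto simp: E_def)
    thus "z \<in> {z\<in>sphere 0 1. \<exists>r\<in>{0..<1}. l < norm (dilate h r z)}" using R[of n] by (auto intro!: bexI[of _ r])
  qed
  moreover have "incseq E"
    unfolding incseq_def E_def using Rmono by (fastforce intro: less_le_trans)
  hence "(SUP n. emeasure \<mu> (E n)) = emeasure \<mu> (\<Union>n. E n)"
    using E by (intro SUP_emeasure_incseq) auto
  moreover have "(SUP n. emeasure \<mu> (E n)) \<le> ennreal (320 * A / l)"
    using EA by (intro SUP_least)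
  ultimately show ?thesis by simp
qed

section \<open>Hardy spaces on the disc\<close>

lemma holomorphic_dilate:
  assumes "f holomorphic_on ball 0 1" "0 \<le> r" "r < 1"
  shows "dilate f r holomorphic_on cball 0 1"
  unfolding dilate_def
proof (intro holomorphic_on_compose_gen[of "\<lambda>z. of_real r * z", unfolded o_def, OF _ assms(1)] holomorphic_intros)
  have "r * norm x < 1" if "norm x \<le> 1" for x :: complex
    using assms that by (meson le_less_trans mult_left_le)
  thus "(\<lambda>z. complex_of_real r * z) ` cball 0 1 \<subseteq> ball 0 1"
    using assms by (auto simp: norm_mult)
qed

lemma continuous_on_dilate:
  assumes "continuous_on (ball 0 1) f" "0 \<le> r" "r < 1"
  shows "continuous_on (sphere 0 1) (dilate f r)"
  unfolding dilate_def
  by (rule continuous_on_compose2[OF assms(1)]) (use assms in \<open>auto intro!: continuous_intros simp: norm_mult\<close>)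

lemma continuous_on_dilate_holomorphic [continuous_intros]:
  "f holomorphic_on ball 0 1 \<Longrightarrow> 0 \<le> r \<Longrightarrow> r < 1 \<Longrightarrow> continuous_on (sphere 0 1) (dilate f r)"
  by (intro continuous_on_dilate holomorphic_on_imp_continuous_on)

section \<open>Square means and Taylor approximation in H^2\<close>

lemma integral_monomials:
  "(LINT z|\<mu>. z ^ j * cnj z ^ k) = (if j = k then 1 else 0)"
proof -
  have *: "(LINT z|\<mu>. z ^ j * cnj z ^ k) = (if j = k then 1 else 0)" if "k \<le> j" for j k
  proof -
    have "(LINT z|\<mu>. z ^ j * cnj z ^ k) = (LINT z|\<mu>. z ^ (j - k))"
    proof (intro Bochner_Integration.integral_cong refl)
      fix z assume "z \<in> space \<mu>"
      hence "z * cnj z = 1" using complex_norm_square[of z] by simp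
      hence "z ^ k * cnj z ^ k = 1" by (metis power_mult_distrib power_one)
      moreover have "z ^ j = z ^ (j - k) * z ^ k" using that by (simp flip: power_add)
      ultimately show "z ^ j * cnj z ^ k = z ^ (j - k)" by (simp add: mult.assoc)
    qed
    also have "\<dots> = 0 ^ (j - k)"
      by (rule mean_value_holomorphic) (intro holomorphic_intros)
    finally show ?thesis using that by (auto simp: power_0_left)
  qed
  show ?thesis
  proof (cases "k \<le> j")
    case False
    have "(LINT z|\<mu>. z ^ j * cnj z ^ k) = (LINT z|\<mu>. cnj (z ^ k * cnj z ^ j))"
      by (simp add: mult.commute)
    also have "\<dots> = cnj (LINT z|\<mu>. z ^ k * cnj z ^ j)"
      by (rule Bochner_Integration.integral_cnj[of \<mu> "\<lambda>z. z ^ k * cnj z ^ j"])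
    finally show ?thesis using *[of j k] False by simp
  qed (use * in auto)
qed

lemma parseval_polynomial:
  "(LINT z|\<mu>. (norm (\<Sum>k<n. c k * z ^ k))\<^sup>2) = (\<Sum>k<n. (norm (c k))\<^sup>2)"
proof -
  have "complex_of_real (LINT z|\<mu>. (norm (\<Sum>k<n. c k * z ^ k))\<^sup>2) =
     (LINT z|\<mu>. complex_of_real ((norm (\<Sum>k<n. c k * z ^ k))\<^sup>2))"
    by (rule integral_complex_of_real[symmetric])
  also have "\<dots> = (LINT z|\<mu>. (\<Sum>j<n. \<Sum>k<n. (c j * cnj (c k)) * (z ^ j * cnj z ^ k)))"
    by (intro Bochner_Integration.integral_cong refl, unfold complex_norm_square)
       (simp add: sum_product mult_ac)
  also have "\<dots> = (\<Sum>j<n. \<Sum>k<n. LINT z|\<mu>. (c j * cnj (c k)) * (z ^ j * cnj z ^ k))"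
    by (subst Bochner_Integration.integral_sum Bochner_Integration.integrable_sum;
        (intro sum.cong refl Bochner_Integration.integral_sum)?;
        (intro Bochner_Integration.integrable_sum integrable_circle_continuous continuous_intros)?)
  also have "\<dots> = (\<Sum>j<n. \<Sum>k<n. if j = k then c j * cnj (c k) else 0)"
    by (intro sum.cong refl) (simp add: integral_monomials)
  also have "\<dots> = complex_of_real (\<Sum>k<n. (norm (c k))\<^sup>2)"
    by (simp add: sum.delta complex_norm_square flip: of_real_power)
  finally show ?thesis by (simp only: of_real_eq_iff)
qed

text \<open>The series converges at a radius s > r, hence absolutely at radius r, so its partial
  sums are uniformly bounded on that circle and dominated convergence applies to the polynomial
  identity. An arbitrary coefficient sequence is allowed, so that the remainder of a Taylor series,
  whose first coefficients are replaced by 0, is covered too.\<close>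

lemma parseval_dilate:
  assumes sums: "\<And>z. norm z < 1 \<Longrightarrow> (\<lambda>k. c k * z ^ k) sums g z" and r: "0 \<le> r" "r < 1"
  shows "(\<lambda>k. (norm (c k))\<^sup>2 * r ^ (2 * k)) sums (sq_mean g r)"
proof -
  obtain s where s: "r < s" "s < 1" using r dense by blast
  have "summable (\<lambda>k. c k * of_real s ^ k)"
    using sums[of "of_real s"] s r by (auto simp: sums_iff)
  hence summ: "summable (\<lambda>k. norm (c k * of_real r ^ k))"
    by (rule powser_insidea) (use s r in auto)
  define B where "B = (\<Sum>k. norm (c k * of_real r ^ k))"
  have rz: "norm (of_real r * z) < 1" if "norm z = 1" for z :: complex using that r by (simp add: norm_mult)
  have dl: "(\<lambda>n. (\<Sum>k<n. c k * of_real r ^ k * z ^ k)) \<longlonglongrightarrow> dilate g r z" if "norm z = 1" for z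
    using sums[OF rz[OF that]] by (simp add: sums_def power_mult_distrib dilate_def mult_ac)
  have Bb: "norm (\<Sum>k<n. c k * of_real r ^ k * z ^ k) \<le> B" if "norm z = 1" for n z
  proof -
    have "norm (\<Sum>k<n. c k * of_real r ^ k * z ^ k) \<le> (\<Sum>k<n. norm (c k * of_real r ^ k))"
      by (intro order_trans[OF norm_sum]) (simp add: norm_mult norm_power that)
    also have "\<dots> \<le> B" unfolding B_def by (intro sum_le_suminf summ) auto
    finally show ?thesis .
  qed
  have "(\<lambda>n. LINT z|\<mu>. (norm (\<Sum>k<n. c k * of_real r ^ k * z ^ k))\<^sup>2) \<longlonglongrightarrow>
     (sq_mean g r)"
  proof (rule integral_dominated_convergence[where w = "\<lambda>_. B\<^sup>2"])
    show 1: "(\<lambda>z. (norm (\<Sum>k<n. c k * of_real r ^ k * z ^ k))\<^sup>2) \<in> borel_measurable \<mu>" for n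
      by (intro measurable_circle continuous_intros)
    show "(\<lambda>z. (norm (dilate g r z))\<^sup>2) \<in> borel_measurable \<mu>"
      using dl by (intro borel_measurable_LIMSEQ_real[OF _ 1] tendsto_intros) auto
    show "AE z in \<mu>. (\<lambda>n. (norm (\<Sum>k<n. c k * of_real r ^ k * z ^ k))\<^sup>2) \<longlonglongrightarrow> (norm (dilate g r z))\<^sup>2"
      using dl by (intro AE_I2 tendsto_intros) auto
    show "AE z in \<mu>. norm ((norm (\<Sum>k<n. c k * of_real r ^ k * z ^ k))\<^sup>2) \<le> B\<^sup>2" for n
      using Bb by (intro AE_I2) (auto intro: power_mono)
  qed auto
  thus ?thesis
    unfolding sums_def parseval_polynomial using r
    by (simp add: norm_mult norm_power power_mult_distrib power_mult[symmetric] mult.commute)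
qed

definition tcoeff :: "(complex \<Rightarrow> complex) \<Rightarrow> nat \<Rightarrow> complex" where
  "tcoeff f k = (deriv ^^ k) f 0 / fact k"

lemma tcoeff_sums:
  "f holomorphic_on ball 0 1 \<Longrightarrow> norm z < 1 \<Longrightarrow> (\<lambda>k. tcoeff f k * z ^ k) sums f z"
  using holomorphic_power_series[of f 0 1 z] by (simp add: tcoeff_def)

lemma uniform_limit_taylor:
  assumes f: "f holomorphic_on ball 0 1" and R: "R < 1"
  shows "uniform_limit (cball 0 R) (\<lambda>n z. \<Sum>k<n. tcoeff f k * z ^ k) f sequentially"
proof (cases "R < 0")
  case False
  have "1 \<le> conv_radius (tcoeff f)"
  proof (rule conv_radius_geI_ex')
    fix r :: real assume "0 < r" "ereal r < 1"
    thus "summable (\<lambda>n. tcoeff f n * of_real r ^ n)"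
      using tcoeff_sums[OF f, of "of_real r"] by (auto simp: sums_iff)
  qed
  hence "ereal R < conv_radius (tcoeff f)" using R by (metis ereal_less(3) order_less_le_trans)
  from powser_uniform_limit[OF this, of 0]
  have "uniform_limit (cball 0 R) (\<lambda>n z. \<Sum>k<n. tcoeff f k * z ^ k) (\<lambda>z. \<Sum>k. tcoeff f k * z ^ k) sequentially"
    by simp
  thus ?thesis
    by (rule uniform_limit_cong'[THEN iffD1, rotated -1])
       (use tcoeff_sums[OF f] R in \<open>auto simp: sums_iff\<close>)
qed (simp add: uniform_limit_iff)

text \<open>By Parseval the square mean is a power series in r with nonnegative
  coefficients.\<close>

lemma hardy2_mono:
  assumes g: "g holomorphic_on ball 0 1" and r: "0 \<le> r" "r \<le> s" "s < 1"
  shows "(sq_mean g r) \<le> (sq_mean g s)"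
  by (rule sums_le[OF _ parseval_dilate parseval_dilate, OF _ tcoeff_sums[OF g] _ _ tcoeff_sums[OF g]])
     (use r in \<open>auto intro!: mult_left_mono power_mono\<close>)

text \<open>Bounded square means make the Taylor coefficients square summable, and Parseval bounds
  the square mean of the remainder by the tail of that series. The point is that one
  \<open>N\<close> serves all r.\<close>

lemma hardy2_taylor:
  assumes g: "g holomorphic_on ball 0 1"
    and A: "\<And>r. 0 < r \<Longrightarrow> r < 1 \<Longrightarrow> (sq_mean g r) \<le> A"
    and e: "0 < e"
  shows "\<exists>N. \<forall>r. 0 < r \<longrightarrow> r < 1 \<longrightarrow>
    (LINT z|\<mu>. (norm (dilate (\<lambda>z. g z - (\<Sum>k<N. tcoeff g k * z ^ k)) r z))\<^sup>2) \<le> e"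
proof -
  \<comment> \<open>Parseval is available only for r < 1. Cutting the series to a finite sum first
    makes the left side continuous up to r = 1.\<close>
  have fin: "(\<Sum>k<n. (norm (tcoeff g k))\<^sup>2) \<le> A" for n
  proof -
    have "(\<Sum>k<n. (norm (tcoeff g k))\<^sup>2 * r ^ (2 * k)) \<le> A" if "0 < r" "r < 1" for r :: real
    proof -
      have sm: "(\<lambda>k. (norm (tcoeff g k))\<^sup>2 * r ^ (2 * k)) sums (sq_mean g r)"
        using parseval_dilate[OF tcoeff_sums[OF g], of r] that by simp
      have "(\<Sum>k<n. (norm (tcoeff g k))\<^sup>2 * r ^ (2 * k)) \<le> (\<Sum>k. (norm (tcoeff g k))\<^sup>2 * r ^ (2 * k))"
        using sm that by (intro sum_le_suminf) (auto simp: sums_iff)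
      also have "\<dots> = (sq_mean g r)"
        using sm by (simp only: sums_iff)
      finally have "(\<Sum>k<n. (norm (tcoeff g k))\<^sup>2 * r ^ (2 * k)) \<le> (sq_mean g r)" .
      thus ?thesis using A[OF that] by simp
    qed
    hence "eventually (\<lambda>r. (\<Sum>k<n. (norm (tcoeff g k))\<^sup>2 * r ^ (2 * k)) \<le> A) (at_left 1)"
      using eventually_at_left_real[of 0 1] by (auto elim: eventually_mono)
    moreover have "((\<lambda>r::real. \<Sum>k<n. (norm (tcoeff g k))\<^sup>2 * r ^ (2 * k)) \<longlongrightarrow> (\<Sum>k<n. (norm (tcoeff g k))\<^sup>2 * 1 ^ (2 * k))) (at_left 1)"
      by (intro tendsto_intros)
    ultimately show ?thesis
      using tendsto_upperbound[of _ _ "at_left (1::real)" A] by auto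
  qed
  have summ: "summable (\<lambda>k. (norm (tcoeff g k))\<^sup>2)"
    using fin by (intro summableI_nonneg_bounded[of _ A]) auto
  from suminf_exist_split[OF e this] obtain N where "norm (\<Sum>k. (norm (tcoeff g (k + N)))\<^sup>2) < e" by blast
  hence tail: "(\<Sum>k. (norm (tcoeff g (k + N)))\<^sup>2) \<le> e" by simp
  define c where "c k = (if k < N then 0 else tcoeff g k)" for k
  have csum: "(\<lambda>k. c k * z ^ k) sums (g z - (\<Sum>k<N. tcoeff g k * z ^ k))" if "norm z < 1" for z
  proof -
    have "(\<lambda>k. tcoeff g k * z ^ k - (if k < N then tcoeff g k * z ^ k else 0)) sums
      (g z - (\<Sum>k<N. tcoeff g k * z ^ k))"
      using sums_If_finite_set[of "{..<N}" "\<lambda>k. tcoeff g k * z ^ k"]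
      by (intro sums_diff tcoeff_sums g that) auto
    moreover have "tcoeff g k * z ^ k - (if k < N then tcoeff g k * z ^ k else 0) = c k * z ^ k" for k
      by (simp add: c_def)
    ultimately show ?thesis by simp
  qed
  have "(LINT z|\<mu>. (norm (dilate (\<lambda>z. g z - (\<Sum>k<N. tcoeff g k * z ^ k)) r z))\<^sup>2) \<le> e"
    if r: "0 < r" "r < 1" for r
  proof -
    have cs: "(\<lambda>k. (norm (c k))\<^sup>2) sums (\<Sum>k. (norm (tcoeff g (k + N)))\<^sup>2)"
    proof -
      have "(\<lambda>k. (norm (c (k + N)))\<^sup>2) sums (\<Sum>k. (norm (tcoeff g (k + N)))\<^sup>2)"
        using summable_sums[OF summable_ignore_initial_segment[OF summ]] by (simp add: c_def)
      thus ?thesis by (subst (asm) sums_iff_shift) (simp add: c_def)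
    qed
    have "(LINT z|\<mu>. (norm (dilate (\<lambda>z. g z - (\<Sum>k<N. tcoeff g k * z ^ k)) r z))\<^sup>2)
      \<le> (\<Sum>k. (norm (tcoeff g (k + N)))\<^sup>2)"
      by (rule sums_le[OF _ parseval_dilate[OF csum] cs])
         (use r in \<open>auto intro!: mult_left_le power_le_one\<close>)
    thus ?thesis using tail by simp
  qed
  thus ?thesis by blast
qed

section \<open>Factorization of H^1 functions and approximation by polynomials\<close>

text \<open>This is the identity behind the Blaschke factor (z - a) / (1 - cnj a z): for |a| < 1 the
  right side vanishes on the circle and is positive in the disc, so the factor has modulus 1 on the
  circle and less than 1 inside.\<close>

lemma reflect_zero_identity:
  "(norm (1 - cnj a * z))\<^sup>2 - (norm (z - a))\<^sup>2 = (1 - (norm a)\<^sup>2) * (1 - (norm z)\<^sup>2)"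
proof -
  have "complex_of_real ((norm (1 - cnj a * z))\<^sup>2 - (norm (z - a))\<^sup>2) =
    complex_of_real ((1 - (norm a)\<^sup>2) * (1 - (norm z)\<^sup>2))"
    by (simp only: of_real_diff of_real_mult complex_norm_square of_real_1 complex_cnj_diff
        complex_cnj_mult complex_cnj_cnj complex_cnj_one) (simp add: algebra_simps)
  thus ?thesis by (simp only: of_real_eq_iff)
qed

text \<open>The polynomial \<open>q\<close> is \<open>p\<close> divided by the finite Blaschke
  product of its zeros in the disc: every factor z - a with |a| < 1 is replaced by 1 - cnj a z. The
  induction removes one such zero at a time and so accounts for multiplicities.\<close>

lemma reflect_zeros_polynomial:
  fixes p :: "complex poly"
  assumes "p \<noteq> 0"
  shows "\<exists>q. (\<forall>z\<in>ball 0 1. poly q z \<noteq> 0) \<and> (\<forall>z\<in>sphere 0 1. norm (poly q z) = norm (poly p z)) \<and>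
    (\<forall>z\<in>ball 0 1. norm (poly p z) \<le> norm (poly q z))"
  using assms
proof (induction "degree p" arbitrary: p rule: less_induct)
  case less
  show ?case
  proof (cases "\<exists>a\<in>ball 0 1. poly p a = 0")
    case False
    thus ?thesis by (intro exI[of _ p]) auto
  next
    case True
    then obtain a where a: "norm a < 1" "poly p a = 0" by auto
    then obtain p' where p': "p = [:-a, 1:] * p'" by (auto simp: poly_eq_0_iff_dvd)
    hence nz: "p' \<noteq> 0" using less.prems by auto
    have "degree p' < degree p" unfolding p' using nz by (subst degree_mult_eq) auto
    from less.hyps[OF this nz] obtain q where q: "\<forall>z\<in>ball 0 1. poly q z \<noteq> 0"
      "\<forall>z\<in>sphere 0 1. norm (poly q z) = norm (poly p' z)"
      "\<forall>z\<in>ball 0 1. norm (poly p' z) \<le> norm (poly q z)" by blast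
    have pp: "poly p z = (z - a) * poly p' z" for z by (simp add: p' algebra_simps)
    have qq: "poly ([:1, -cnj a:] * q) z = (1 - cnj a * z) * poly q z" for z by (simp add: algebra_simps)
    show ?thesis
    proof (intro exI[of _ "[:1, -cnj a:] * q"] conjI ballI)
      fix z :: complex assume z: "z \<in> ball 0 1"
      have "0 < (1 - (norm a)\<^sup>2) * (1 - (norm z)\<^sup>2)"
        using a z by (intro mult_pos_pos) (auto simp: abs_square_less_1)
      hence lt: "(norm (z - a))\<^sup>2 < (norm (1 - cnj a * z))\<^sup>2" using reflect_zero_identity[of a z] by simp
      hence "1 - cnj a * z \<noteq> 0" by (metis norm_zero not_less zero_le_power2 zero_power2)
      thus "poly ([:1, -cnj a:] * q) z \<noteq> 0" using q(1) z by (simp only: qq) auto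
      have "norm (z - a) \<le> norm (1 - cnj a * z)" using lt by (meson less_imp_le norm_ge_zero power_less_imp_less_base)
      thus "norm (poly p z) \<le> norm (poly ([:1, -cnj a:] * q) z)"
        unfolding pp qq norm_mult using q(3) z by (intro mult_mono) auto
    next
      fix z :: complex assume z: "z \<in> sphere 0 1"
      hence "(norm (1 - cnj a * z))\<^sup>2 = (norm (z - a))\<^sup>2" using reflect_zero_identity[of a z] by simp
      hence "norm (1 - cnj a * z) = norm (z - a)" by (simp add: power2_eq_iff_nonneg)
      thus "norm (poly ([:1, -cnj a:] * q) z) = norm (poly p z)"
        unfolding pp qq norm_mult using q(2) z by simp
    qed
  qed
qed

lemma integral_dilate_tendsto_boundary:
  fixes \<psi> :: "complex \<Rightarrow> real"
  assumes "continuous_on (cball 0 1) \<psi>"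
  shows "(\<lambda>n. LINT z|\<mu>. \<psi> (of_real (1 - 1 / (real n + 1)) * z)) \<longlonglongrightarrow> (LINT z|\<mu>. \<psi> z)"
proof -
  define R where "R n = 1 - 1 / (real n + 1)" for n
  have R: "0 \<le> R n" "R n \<le> 1" for n by (auto simp: R_def)
  have Rl: "R \<longlonglongrightarrow> 1"
    unfolding R_def using tendsto_diff[OF tendsto_const LIMSEQ_inverse_real_of_nat]
    by (auto simp: inverse_eq_divide add_ac)
  have cb: "of_real (R n) * z \<in> cball 0 1" if "norm z = 1" for n and z :: complex
    using R[of n] that by (simp add: norm_mult)
  have "bounded (\<psi> ` cball 0 1)"
    using assms by (simp add: compact_continuous_image compact_imp_bounded)
  then obtain B where B: "\<And>z. z \<in> cball 0 1 \<Longrightarrow> norm (\<psi> z) \<le> B"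
    unfolding bounded_iff by blast
  have "(\<lambda>n. LINT z|\<mu>. \<psi> (of_real (R n) * z)) \<longlonglongrightarrow> (LINT z|\<mu>. \<psi> z)"
  proof (rule integral_dominated_convergence[where w = "\<lambda>_. B"])
    show "\<psi> \<in> borel_measurable \<mu>"
      by (intro measurable_circle continuous_on_subset[OF assms]) auto
    show "(\<lambda>z. \<psi> (of_real (R n) * z)) \<in> borel_measurable \<mu>" for n
      by (intro measurable_circle continuous_on_compose2[OF assms] continuous_intros)
         (use cb in auto)
    show "AE z in \<mu>. (\<lambda>n. \<psi> (of_real (R n) * z)) \<longlonglongrightarrow> \<psi> z"
    proof (rule AE_I2)
      fix z assume "z \<in> space \<mu>"
      hence z: "norm z = 1" by simp
      show "(\<lambda>n. \<psi> (of_real (R n) * z)) \<longlonglongrightarrow> \<psi> z"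
      proof (rule continuous_on_tendsto_compose[OF assms])
        show "(\<lambda>n. of_real (R n) * z) \<longlonglongrightarrow> z"
          using tendsto_mult[OF tendsto_of_real[OF Rl] tendsto_const[of z]] by simp
        show "z \<in> cball 0 1" using z by simp
        show "\<forall>\<^sub>F n in sequentially. of_real (R n) * z \<in> cball 0 1"
          using cb[OF z] by (intro always_eventually allI)
      qed
    qed
    show "AE z in \<mu>. norm (\<psi> (of_real (R n) * z)) \<le> B" for n
      using B cb by (intro AE_I2) auto
  qed simp
  thus ?thesis by (simp add: R_def)
qed

text \<open>With \<open>q\<close> obtained from \<open>p\<close> by reflecting the zeros in the disc, take \<open>g\<^sup>2 = q\<close> and
  \<open>h = p / g\<close>.\<close>

lemma polynomial_factorization:
  fixes p :: "complex poly"
  assumes A: "(LINT z|\<mu>. norm (poly p z)) \<le> A"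
  shows "\<exists>g h. g holomorphic_on ball 0 1 \<and> h holomorphic_on ball 0 1 \<and>
    (\<forall>z\<in>ball 0 1. poly p z = g z * h z \<and> (norm (h z))\<^sup>2 \<le> (norm (g z))\<^sup>2 \<and>
       (norm (g z))\<^sup>2 \<le> 2 * A / (1 - norm z)) \<and>
    (\<forall>r. 0 < r \<longrightarrow> r < 1 \<longrightarrow> (sq_mean g r) \<le> A)"
proof (cases "p = 0")
  case True
  thus ?thesis using A by (intro exI[of _ "\<lambda>_. 0"]) (auto simp: dilate_def)
next
  case False
  from reflect_zeros_polynomial[OF this] obtain q where
    q: "\<forall>z\<in>ball 0 1. poly q z \<noteq> 0" "\<forall>z\<in>sphere 0 1. norm (poly q z) = norm (poly p z)"
      "\<forall>z\<in>ball 0 1. norm (poly p z) \<le> norm (poly q z)" by blast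
  have
    q0: "norm z < 1 \<Longrightarrow> poly q z \<noteq> 0" and
    q1: "norm z = 1 \<Longrightarrow> norm (poly q z) = norm (poly p z)" and
    q2: "norm z < 1 \<Longrightarrow> norm (poly p z) \<le> norm (poly q z)" for z
    using q by auto
  have qA: "(LINT z|\<mu>. norm (poly q z)) \<le> A"
    using A q1 by (subst Bochner_Integration.integral_cong[OF refl, of \<mu> _ "\<lambda>z. norm (poly p z)"]) auto
  have hol: "poly q holomorphic_on S" "poly p holomorphic_on S" for S
    by (intro holomorphic_intros)+
  have "simply_connected (ball 0 1 :: complex set)" by (simp add: convex_imp_simply_connected)
  hence "\<exists>g. g holomorphic_on ball 0 1 \<and> (\<forall>z\<in>ball 0 1. poly q z = (g z)\<^sup>2)"
    using hol q0 by (subst (asm) simply_connected_eq_holomorphic_sqrt) auto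
  then obtain g where g: "g holomorphic_on ball 0 1" "\<And>z. norm z < 1 \<Longrightarrow> poly q z = (g z)\<^sup>2" by auto
  have g0: "g z \<noteq> 0" if "norm z < 1" for z using g(2)[OF that] q0[OF that] by auto
  have gq: "(norm (g z))\<^sup>2 = norm (poly q z)" if "norm z < 1" for z
    using g(2)[OF that] by (simp add: norm_power)
  define h where "h z = poly p z / g z" for z
  have h: "h holomorphic_on ball 0 1"
    unfolding h_def using g g0 hol by (intro holomorphic_intros) auto
  \<comment> \<open>A pointwise growth bound depending on \<open>p\<close> only through
    \<open>A\<close>. It is what later makes the factors of a sequence of polynomials a locally
    bounded family.\<close>
  have "norm (g z) ^ 2 \<le> 2 * A / (1 - norm z)" if z: "norm z < 1" for z
  proof -
    have "norm (poly q z) = norm (LINT w|\<mu>. poisson z w * poly q w)"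
      using poisson_holomorphic[OF hol(1) z] by simp
    also have "\<dots> \<le> (LINT w|\<mu>. norm (poisson z w * poly q w))" by (rule integral_norm_bound)
    also have "\<dots> \<le> (LINT w|\<mu>. 2 / (1 - norm z) * norm (poly q w))"
    proof (intro integral_mono integrable_circle_continuous continuous_intros continuous_on_poisson z)
      fix w assume "w \<in> space \<mu>"
      thus "norm (poisson z w * poly q w) \<le> 2 / (1 - norm z) * norm (poly q w)"
        using mult_right_mono[OF poisson_le[OF z, of w], of "norm (poly q w)"] poisson_nonneg[of z w] z
        by (simp add: norm_mult)
    qed
    also have "\<dots> \<le> 2 / (1 - norm z) * A" using qA z by (simp add: divide_right_mono)
    finally show ?thesis using gq[OF z] by simp
  qed
  moreover have "(norm (h z))\<^sup>2 \<le> (norm (g z))\<^sup>2" if z: "norm z < 1" for z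
  proof -
    have "norm (h z) * norm (g z) = norm (poly p z)" using g0[OF z] by (simp add: h_def norm_divide)
    also have "\<dots> \<le> norm (g z) * norm (g z)" using q2[OF z] gq[OF z] by (simp add: power2_eq_square)
    finally show ?thesis using g0[OF z] by (intro power_mono) auto
  qed
  \<comment> \<open>The square root \<open>g\<close> lives only on the open disc, so its means
    cannot be evaluated on the unit circle. Those at radius \<open>R n\<close> are means of |q| and
    converge to the boundary mean of |q|; monotonicity in the radius then bounds the mean at
    r.\<close>
  moreover have "(sq_mean g r) \<le> A" if r: "0 < r" "r < 1" for r
  proof -
    define R where "R n = 1 - 1 / (real n + 1)" for n
    have R: "0 \<le> R n" "R n < 1" for n by (auto simp: R_def)
    have "(\<lambda>n. LINT z|\<mu>. norm (poly q (of_real (R n) * z))) \<longlonglongrightarrow> (LINT z|\<mu>. norm (poly q z))"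
      unfolding R_def by (rule integral_dilate_tendsto_boundary) (intro continuous_intros)
    moreover have "(LINT z|\<mu>. norm (poly q (of_real (R n) * z))) =
      (sq_mean g (R n))" for n
      using R[of n] by (intro Bochner_Integration.integral_cong refl) (simp add: gq dilate_def norm_mult)
    ultimately have lim: "(\<lambda>n. LINT z|\<mu>. (norm (dilate g (R n) z))\<^sup>2) \<longlonglongrightarrow> (LINT z|\<mu>. norm (poly q z))"
      by simp
    have "(sq_mean g r) \<le> (LINT z|\<mu>. norm (poly q z))"
    proof (rule LIMSEQ_le_const[OF lim])
      obtain N where N: "1 / (1 - r) < real N" using reals_Archimedean2 by blast
      have "r \<le> R n" if "n \<ge> N" for n
      proof -
        have "1 / (1 - r) < real n + 1" using N that by linarith
        hence "1 / (real n + 1) < 1 - r" using r by (simp add: field_simps)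
        thus ?thesis by (simp add: R_def)
      qed
      thus "\<exists>N. \<forall>n\<ge>N. (sq_mean g r) \<le> (sq_mean g (R n))"
        using R r by (intro exI[of _ N] allI impI hardy2_mono g) auto
    qed
    thus ?thesis using qA by simp
  qed
  moreover have "poly p z = g z * h z" if "norm z < 1" for z using g0[OF that] by (simp add: h_def)
  ultimately show ?thesis using g(1) h by (intro exI[of _ g] exI[of _ h]) auto
qed

lemma hardy2_bound_limit:
  assumes G: "\<And>n. G n holomorphic_on ball 0 1" and g: "g holomorphic_on ball 0 1"
    and lim: "\<And>z. norm z < 1 \<Longrightarrow> (\<lambda>n. G n z) \<longlonglongrightarrow> g z"
    and B: "\<And>n z. norm z < 1 \<Longrightarrow> (norm (G n z))\<^sup>2 \<le> C / (1 - norm z)"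
    and A: "\<And>n. (sq_mean (G n) r) \<le> A" and r: "0 < r" "r < 1"
  shows "(sq_mean g r) \<le> A"
proof (rule LIMSEQ_le_const2)
  show "(\<lambda>n. LINT z|\<mu>. (norm (dilate (G n) r z))\<^sup>2) \<longlonglongrightarrow> (sq_mean g r)"
  proof (rule integral_dominated_convergence[where w = "\<lambda>_. C / (1 - r)"])
    show "AE z in \<mu>. (\<lambda>n. (norm (dilate (G n) r z))\<^sup>2) \<longlonglongrightarrow> (norm (dilate g r z))\<^sup>2"
      using r by (intro AE_I2 tendsto_intros) (auto simp: dilate_def norm_mult intro!: lim)
    show "AE z in \<mu>. norm ((norm (dilate (G n) r z))\<^sup>2) \<le> C / (1 - r)" for n
    proof (rule AE_I2)
      fix z assume "z \<in> space \<mu>"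
      thus "norm ((norm (dilate (G n) r z))\<^sup>2) \<le> C / (1 - r)"
        using r B[of "of_real r * z" n] by (simp add: dilate_def norm_mult)
    qed
    show "(\<lambda>z. (norm (dilate (G n) r z))\<^sup>2) \<in> borel_measurable \<mu>" for n
      using r by (intro measurable_circle continuous_intros G) auto
    show "(\<lambda>z. (norm (dilate g r z))\<^sup>2) \<in> borel_measurable \<mu>"
      using r by (intro measurable_circle continuous_intros g) auto
  qed simp
qed (use A in blast)

text \<open>Each dilate of \<open>f\<close> by \<open>R n\<close> is uniformly approximated by a
  polynomial, with error below 1 / (n + 1) \<le> 1; this accounts for \<open>A + 1\<close>. The
  polynomials are factored with uniform bounds, and a subsequence along which both factors converge
  produces the factors of \<open>f\<close>. The square-mean bounds pass to the limit on each fixed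
  circle.\<close>

lemma hardy1_factorization:
  assumes f: "f holomorphic_on ball 0 1"
    and A: "\<And>r. 0 < r \<Longrightarrow> r < 1 \<Longrightarrow> (LINT z|\<mu>. norm (dilate f r z)) \<le> A"
  shows "\<exists>g h. g holomorphic_on ball 0 1 \<and> h holomorphic_on ball 0 1 \<and>
    (\<forall>z\<in>ball 0 1. f z = g z * h z) \<and>
    (\<forall>r. 0 < r \<longrightarrow> r < 1 \<longrightarrow> (sq_mean g r) \<le> A + 1 \<and>
       (sq_mean h r) \<le> A + 1)"
proof -
  define R where "R n = 1 - 1 / (real n + 2)" for n
  have R: "0 < R n" "R n < 1" for n by (auto simp: R_def)
  have Rl: "R \<longlonglongrightarrow> 1" unfolding R_def by real_asymp
  have "\<exists>p. \<forall>z\<in>cball 0 1. norm (poly p z - dilate f (R n) z) < 1 / (real n + 1)" for n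
  proof -
    have "\<forall>\<^sub>F N in sequentially. \<forall>x\<in>cball 0 (R n). dist (\<Sum>k<N. tcoeff f k * x ^ k) (f x) < 1 / (real n + 1)"
      using uniform_limit_taylor[OF f R(2)[of n]] by (rule uniform_limitD) auto
    then obtain N where N0: "\<forall>x\<in>cball 0 (R n). dist (\<Sum>k<N. tcoeff f k * x ^ k) (f x) < 1 / (real n + 1)"
      unfolding eventually_sequentially by blast
    have N: "norm ((\<Sum>k<N. tcoeff f k * x ^ k) - f x) < 1 / (real n + 1)" if "norm x \<le> R n" for x
      using N0[rule_format, of x] that by (simp add: dist_norm)
    define p where "p = (\<Sum>k<N. monom (tcoeff f k * of_real (R n) ^ k) k)"
    have "poly p z = (\<Sum>k<N. tcoeff f k * (of_real (R n) * z) ^ k)" for z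
      by (simp add: p_def poly_sum poly_monom power_mult_distrib mult_ac)
    moreover have "norm (of_real (R n) * z) \<le> R n" if "norm z \<le> 1" for z :: complex
      using that R(1)[of n] by (simp add: norm_mult mult_left_le)
    ultimately show ?thesis using N by (intro exI[of _ p]) (auto simp: dilate_def)
  qed
  then obtain p where "\<And>n. \<forall>z\<in>cball 0 1. norm (poly (p n) z - dilate f (R n) z) < 1 / (real n + 1)"
    by metis
  hence p: "\<And>n z. norm z \<le> 1 \<Longrightarrow> norm (poly (p n) z - dilate f (R n) z) < 1 / (real n + 1)" by simp
  have pA: "(LINT z|\<mu>. norm (poly (p n) z)) \<le> A + 1" for n
  proof -
    have "(LINT z|\<mu>. norm (poly (p n) z)) \<le> (LINT z|\<mu>. norm (dilate f (R n) z) + 1)"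
    proof (intro integral_mono integrable_circle_continuous continuous_intros f)
      fix z assume "z \<in> space \<mu>"
      hence "norm (poly (p n) z - dilate f (R n) z) < 1 / (real n + 1)" using p by simp
      also have "\<dots> \<le> 1" by simp
      finally show "norm (poly (p n) z) \<le> norm (dilate f (R n) z) + 1"
        using norm_triangle_ineq2[of "poly (p n) z" "dilate f (R n) z"] by simp
    qed (use R[of n] in auto)
    also have "\<dots> = (LINT z|\<mu>. norm (dilate f (R n) z)) + 1"
      using R[of n] f by (subst Bochner_Integration.integral_add)
        (auto intro!: integrable_circle_continuous continuous_intros)
    finally show ?thesis using A[OF R(1,2)[of n]] by simp
  qed
  have plim: "(\<lambda>n. poly (p n) z) \<longlonglongrightarrow> f z" if z: "norm z < 1" for z
  proof -
    have "(\<lambda>n. f (of_real (R n) * z)) \<longlonglongrightarrow> f z"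
    proof (rule continuous_on_tendsto_compose[OF holomorphic_on_imp_continuous_on[OF f]])
      show "(\<lambda>n. of_real (R n) * z) \<longlonglongrightarrow> z"
        using tendsto_mult[OF tendsto_of_real[OF Rl] tendsto_const[of z]] by simp
      have "norm (of_real (R n) * z) < 1" for n
        using R[of n] z by (simp add: norm_mult) (meson le_less_trans less_imp_le mult_left_le_one_le norm_ge_zero)
      thus "\<forall>\<^sub>F n in sequentially. of_real (R n) * z \<in> ball 0 1" by simp
    qed (use z in auto)
    moreover have "(\<lambda>n. poly (p n) z - dilate f (R n) z) \<longlonglongrightarrow> 0"
    proof (rule Lim_null_comparison)
      show "\<forall>\<^sub>F n in sequentially. norm (poly (p n) z - dilate f (R n) z) \<le> 1 / (real n + 1)"
        using p z by (intro always_eventually allI) (auto intro: less_imp_le)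
      show "(\<lambda>n. 1 / (real n + 1)) \<longlonglongrightarrow> 0" by real_asymp
    qed
    ultimately show ?thesis
      using tendsto_add[of "\<lambda>n. poly (p n) z - dilate f (R n) z" 0 sequentially "\<lambda>n. f (of_real (R n) * z)" "f z"]
      by (simp add: dilate_def)
  qed
  obtain g h where gh: "\<And>n. g n holomorphic_on ball 0 1" "\<And>n. h n holomorphic_on ball 0 1"
    "\<And>n z. norm z < 1 \<Longrightarrow> poly (p n) z = g n z * h n z"
    "\<And>n z. norm z < 1 \<Longrightarrow> (norm (h n z))\<^sup>2 \<le> (norm (g n z))\<^sup>2"
    "\<And>n z. norm z < 1 \<Longrightarrow> (norm (g n z))\<^sup>2 \<le> 2 * (A + 1) / (1 - norm z)"
    "\<And>n r. 0 < r \<Longrightarrow> r < 1 \<Longrightarrow> (sq_mean (g n) r) \<le> A + 1"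
  proof -
    define Q where "Q n g h \<longleftrightarrow> g holomorphic_on ball 0 1 \<and> h holomorphic_on ball 0 1 \<and>
      (\<forall>z\<in>ball 0 1. poly (p n) z = g z * h z \<and> (norm (h z))\<^sup>2 \<le> (norm (g z))\<^sup>2 \<and>
         (norm (g z))\<^sup>2 \<le> 2 * (A + 1) / (1 - norm z)) \<and>
      (\<forall>r. 0 < r \<longrightarrow> r < 1 \<longrightarrow> (sq_mean g r) \<le> A + 1)" for n g h
    have "\<exists>g h. Q n g h" for n unfolding Q_def by (rule polynomial_factorization[OF pA])
    then obtain g h where "\<And>n. Q n (g n) (h n)" by metis
    thus ?thesis by (intro that[of g h]) (simp_all add: Q_def)
  qed
  have hb: "(norm (h n z))\<^sup>2 \<le> 2 * (A + 1) / (1 - norm z)" if "norm z < 1" for n z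
    using order_trans[OF gh(4)[OF that] gh(5)[OF that]] .
  have hg: "norm (h n z) \<le> norm (g n z)" if "norm z < 1" for n z using gh(4)[OF that] by simp
  have hA: "(sq_mean (h n) r) \<le> A + 1" if r: "0 < r" "r < 1" for n r
  proof -
    have "(sq_mean (h n) r) \<le> (sq_mean (g n) r)"
      using gh(1,2) r
      by (intro integral_mono integrable_circle_continuous continuous_intros)
         (simp_all add: dilate_def norm_mult hg)
    thus ?thesis using gh(6)[OF r, of n] by simp
  qed
  \<comment> \<open>The normal family: both sequences of factors lie in \<open>H\<close>, since the
    bound for \<open>g n\<close> dominates \<open>h n\<close> as well.\<close>
  define H where "H = {u. u holomorphic_on ball 0 1 \<and> (\<forall>z\<in>ball 0 1. (norm (u z))\<^sup>2 \<le> 2 * (A + 1) / (1 - norm z))}"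
  have "0 \<le> (LINT z|\<mu>. norm (poly (p 0) z))" by simp
  hence A1: "0 \<le> A + 1" using pA[of 0] by linarith
  have bdd: "\<exists>B. \<forall>u\<in>H. \<forall>z\<in>K. norm (u z) \<le> B" if K: "compact K" "K \<subseteq> ball 0 1" for K
  proof -
    have "\<exists>\<rho><1. \<forall>z\<in>K. norm z \<le> \<rho>"
    proof (cases "K = {}")
      case False
      obtain x where "x \<in> K" "\<forall>y\<in>K. norm y \<le> norm x"
        using continuous_attains_sup[OF K(1) False, of norm] continuous_on_norm_id by auto
      thus ?thesis using K(2) by (intro exI[of _ "norm x"]) auto
    qed (auto intro: exI[of _ 0])
    then obtain \<rho> where \<rho>: "\<rho> < 1" "\<forall>z\<in>K. norm z \<le> \<rho>" by blast
    show ?thesis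
    proof (intro exI ballI)
      fix u z assume u: "u \<in> H" and z: "z \<in> K"
      hence "(norm (u z))\<^sup>2 \<le> 2 * (A + 1) / (1 - norm z)" using K by (auto simp: H_def)
      also have "\<dots> \<le> 2 * (A + 1) / (1 - \<rho>)"
        using \<rho> z A1 by (intro divide_left_mono mult_pos_pos) (auto intro: le_less_trans)
      finally show "norm (u z) \<le> sqrt (2 * (A + 1) / (1 - \<rho>))" by (rule real_le_rsqrt)
    qed
  qed
  have montel: "\<exists>u \<sigma>. u holomorphic_on ball 0 1 \<and> strict_mono (\<sigma> :: nat \<Rightarrow> nat) \<and> (\<forall>z\<in>ball 0 1. (\<lambda>n. F (\<sigma> n) z) \<longlonglongrightarrow> u z)"
    if "range F \<subseteq> H" for F
  proof -
    have "u holomorphic_on ball 0 1" if "u \<in> H" for u using that by (simp add: H_def)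
    from Montel[OF open_ball this bdd that]
    obtain u and \<sigma> :: "nat \<Rightarrow> nat" where "u holomorphic_on ball 0 1" "strict_mono \<sigma>"
      "\<And>z. z \<in> ball 0 1 \<Longrightarrow> (\<lambda>n. F (\<sigma> n) z) \<longlonglongrightarrow> u z" by metis
    thus ?thesis by (intro exI[of _ u] exI[of _ \<sigma>]) simp
  qed
  have gH: "range g \<subseteq> H" using gh(1,5) unfolding H_def by auto
  have hH: "range (\<lambda>n. h (\<sigma> n)) \<subseteq> H" for \<sigma> :: "nat \<Rightarrow> nat" using gh(2) hb unfolding H_def by auto
  obtain G \<sigma> where G: "G holomorphic_on ball 0 1" "strict_mono (\<sigma> :: nat \<Rightarrow> nat)"
    "\<forall>z\<in>ball 0 1. (\<lambda>n. g (\<sigma> n) z) \<longlonglongrightarrow> G z"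
    using montel[OF gH] by blast
  obtain K \<tau> where K: "K holomorphic_on ball 0 1" "strict_mono (\<tau> :: nat \<Rightarrow> nat)"
    "\<forall>z\<in>ball 0 1. (\<lambda>n. h (\<sigma> (\<tau> n)) z) \<longlonglongrightarrow> K z"
    using montel[OF hH[of \<sigma>]] by blast
  have G': "(\<lambda>n. g (\<sigma> (\<tau> n)) z) \<longlonglongrightarrow> G z" if "norm z < 1" for z
    using LIMSEQ_subseq_LIMSEQ[OF G(3)[rule_format] K(2), of z] that by (simp add: o_def)
  have "f z = G z * K z" if z: "norm z < 1" for z
  proof (rule LIMSEQ_unique)
    have "strict_mono (\<lambda>n. \<sigma> (\<tau> n))" using strict_mono_o[OF G(2) K(2)] by (simp add: o_def)
    from LIMSEQ_subseq_LIMSEQ[OF plim[OF z] this]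
    show "(\<lambda>n. poly (p (\<sigma> (\<tau> n))) z) \<longlonglongrightarrow> f z" by (simp add: o_def)
    show "(\<lambda>n. poly (p (\<sigma> (\<tau> n))) z) \<longlonglongrightarrow> G z * K z"
      unfolding gh(3)[OF z] using z K(3) by (intro tendsto_mult G') auto
  qed
  moreover have "(sq_mean G r) \<le> A + 1" if "0 < r" "r < 1" for r
    by (rule hardy2_bound_limit[of "\<lambda>n. g (\<sigma> (\<tau> n))", where C = "2 * (A + 1)"]) (use gh G(1) G' that in auto)
  moreover have "(sq_mean K r) \<le> A + 1" if "0 < r" "r < 1" for r
    by (rule hardy2_bound_limit[of "\<lambda>n. h (\<sigma> (\<tau> n))", where C = "2 * (A + 1)"]) (use gh hb hA K that in auto)
  ultimately show ?thesis using G(1) K(1) by (intro exI[of _ G] exI[of _ K]) auto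
qed

text \<open>The approximant is the product of Taylor polynomials of the two factors. With remainders
  u of g and v of h, the error is g v + u (h - v); both remainders have small square means uniformly
  in r, and the other factors have bounded ones.\<close>

lemma hardy1_polynomial_dense:
  assumes f: "f holomorphic_on ball 0 1"
    and A: "\<And>r. 0 < r \<Longrightarrow> r < 1 \<Longrightarrow> (LINT z|\<mu>. norm (dilate f r z)) \<le> A"
    and e: "0 < e"
  shows "\<exists>P :: complex poly. \<forall>r. 0 < r \<longrightarrow> r < 1 \<longrightarrow>
    (LINT z|\<mu>. norm (dilate (\<lambda>z. f z - poly P z) r z)) \<le> e"
proof -
  obtain g h where g: "g holomorphic_on ball 0 1" and h: "h holomorphic_on ball 0 1"
    and fgh: "\<And>z. norm z < 1 \<Longrightarrow> f z = g z * h z"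
    and gA: "\<And>r. 0 < r \<Longrightarrow> r < 1 \<Longrightarrow> (sq_mean g r) \<le> A + 1"
    and hA: "\<And>r. 0 < r \<Longrightarrow> r < 1 \<Longrightarrow> (sq_mean h r) \<le> A + 1"
    using hardy1_factorization[OF f A] by auto
  have "0 \<le> (LINT z|\<mu>. norm (dilate f (1/2) z))" by simp
  also have "\<dots> \<le> A" by (rule A) auto
  finally have A0: "0 \<le> A" .
  \<comment> \<open>The five terms estimated below add up to at most t (2 A + 4), which this choice
    makes at most e; the cap at 1 is used to replace the cubic term by t.\<close>
  define t where "t = min 1 (e / (2 * A + 4))"
  have t: "0 < t" "t \<le> 1" using e A0 by (auto simp: t_def)
  have te: "t * (2 * A + 4) \<le> e"
  proof -
    have "t \<le> e / (2 * A + 4)" by (simp add: t_def)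
    thus ?thesis using A0 by (simp add: pos_le_divide_eq)
  qed
  define T where "T u N = (\<Sum>k<N. monom (tcoeff u k) k)" for u N
  have T: "poly (T u N) z = (\<Sum>k<N. tcoeff u k * z ^ k)" for u N z
    by (simp add: T_def poly_sum poly_monom)
  obtain N where N: "\<And>r. 0 < r \<Longrightarrow> r < 1 \<Longrightarrow>
    (LINT z|\<mu>. (norm (dilate (\<lambda>z. g z - poly (T g N) z) r z))\<^sup>2) \<le> t\<^sup>2"
    using hardy2_taylor[OF g gA, of "t\<^sup>2"] t unfolding T by auto
  obtain M where M: "\<And>r. 0 < r \<Longrightarrow> r < 1 \<Longrightarrow>
    (LINT z|\<mu>. (norm (dilate (\<lambda>z. h z - poly (T h M) z) r z))\<^sup>2) \<le> t\<^sup>2"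
    using hardy2_taylor[OF h hA, of "t\<^sup>2"] t unfolding T by auto
  define u where "u z = g z - poly (T g N) z" for z
  define v where "v z = h z - poly (T h M) z" for z
  have uv: "u holomorphic_on ball 0 1" "v holomorphic_on ball 0 1"
    unfolding u_def v_def using g h by (auto intro!: holomorphic_intros)
  have "(LINT z|\<mu>. norm (dilate (\<lambda>z. f z - poly (T g N * T h M) z) r z)) \<le> e"
    if r: "0 < r" "r < 1" for r
  proof -
    have int: "integrable \<mu> (\<lambda>z. (norm (dilate w r z))\<^sup>2)" if "w holomorphic_on ball 0 1" for w
      using r that by (intro integrable_circle_continuous continuous_intros) auto
    \<comment> \<open>A weighted form of x y \<le> t/2 x^2 + y^2 / (2t): bounded square means
      receive a weight of order t, while those of the remainders, which are at most t^2, can afford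
      the weight 1 / (2t). Using squares keeps the estimate additive without the Cauchy-Schwarz
      inequality.\<close>
    define W where "W z = t / 2 * (norm (dilate g r z))\<^sup>2 + 1 / (2 * t) * (norm (dilate v r z))\<^sup>2 +
      t * (norm (dilate h r z))\<^sup>2 + t * (norm (dilate v r z))\<^sup>2 + 1 / (2 * t) * (norm (dilate u r z))\<^sup>2" for z
    have "(LINT z|\<mu>. norm (dilate (\<lambda>z. f z - poly (T g N * T h M) z) r z)) \<le> (LINT z|\<mu>. W z)"
    proof (rule integral_mono)
      show "integrable \<mu> (\<lambda>z. norm (dilate (\<lambda>z. f z - poly (T g N * T h M) z) r z))"
        using r f by (intro integrable_circle_continuous continuous_intros holomorphic_intros) auto
      show "integrable \<mu> W"
        unfolding W_def using g h uv
        by (intro Bochner_Integration.integrable_add integrable_mult_right int)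
      fix z assume "z \<in> space \<mu>"
      hence rz: "norm (of_real r * z) < 1" using r by (simp add: norm_mult)
      define a b c d where "a = norm (dilate g r z)" and "b = norm (dilate v r z)"
        and "c = norm (dilate h r z)" and "d = norm (dilate u r z)"
      have amgm: "x * y \<le> t / 2 * x\<^sup>2 + 1 / (2 * t) * y\<^sup>2" for x y :: real
      proof -
        have "0 \<le> (t * x - y)\<^sup>2 / (2 * t)" using t by simp
        also have "\<dots> = t / 2 * x\<^sup>2 + 1 / (2 * t) * y\<^sup>2 - x * y"
          using t by (simp add: power2_eq_square field_simps)
        finally show ?thesis by simp
      qed
      have "dilate (\<lambda>z. f z - poly (T g N * T h M) z) r z =
        dilate g r z * dilate v r z + dilate u r z * (dilate h r z - dilate v r z)"
        using fgh[OF rz] by (simp add: dilate_def u_def v_def algebra_simps)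
      also have "norm \<dots> \<le> norm (dilate g r z * dilate v r z) + norm (dilate u r z * (dilate h r z - dilate v r z))"
        by (rule norm_triangle_ineq)
      also have "\<dots> \<le> a * b + d * (c + b)"
        unfolding norm_mult a_def b_def c_def d_def by (intro add_mono mult_left_mono norm_triangle_ineq4) auto
      also have "\<dots> \<le> a * b + (t / 2 * (c + b)\<^sup>2 + 1 / (2 * t) * d\<^sup>2)"
        using amgm[of "c + b" d] by (simp add: mult.commute)
      also have "\<dots> \<le> (t / 2 * a\<^sup>2 + 1 / (2 * t) * b\<^sup>2) + (t / 2 * (2 * c\<^sup>2 + 2 * b\<^sup>2) + 1 / (2 * t) * d\<^sup>2)"
      proof (intro add_mono amgm mult_left_mono order_refl)
        show "(c + b)\<^sup>2 \<le> 2 * c\<^sup>2 + 2 * b\<^sup>2"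
          using sum_squares_bound[of c b] by (simp add: power2_sum)
      qed (use t in auto)
      also have "\<dots> = W z" by (simp add: W_def a_def b_def c_def d_def algebra_simps)
      finally show "norm (dilate (\<lambda>z. f z - poly (T g N * T h M) z) r z) \<le> W z" .
    qed
    also have "\<dots> = t / 2 * (sq_mean g r) +
      1 / (2 * t) * (sq_mean v r) +
      t * (sq_mean h r) +
      t * (sq_mean v r) +
      1 / (2 * t) * (sq_mean u r)"
      unfolding W_def
      by (simp only: Bochner_Integration.integral_add Bochner_Integration.integrable_add
          integrable_mult_right int g h uv Bochner_Integration.integral_mult_right_zero)
    also have "\<dots> \<le> t / 2 * (A + 1) + 1 / (2 * t) * t\<^sup>2 + t * (A + 1) + t * t\<^sup>2 + 1 / (2 * t) * t\<^sup>2"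
      using r t N[OF r] M[OF r] by (intro add_mono mult_left_mono gA hA) (auto simp: u_def[abs_def] v_def[abs_def])
    also have "\<dots> \<le> t / 2 * (A + 1) + t / 2 + t * (A + 1) + t * 1 + t / 2"
      using t by (intro add_mono mult_left_mono) (auto simp: power2_eq_square field_simps mult_le_one)
    also have "\<dots> \<le> t * (2 * A + 4)"
    proof -
      have "0 \<le> t * A" using t A0 by simp
      thus ?thesis using t by (simp add: algebra_simps)
    qed
    finally show ?thesis using te by simp
  qed
  thus ?thesis by blast
qed

section \<open>Existence of the boundary function\<close>

lemma eventually_dilate_near:
  fixes u :: "complex \<Rightarrow> complex"
  assumes "continuous_on (cball 0 1) u" "0 < e"
  shows "\<forall>\<^sub>F r in at_left 1. 0 < r \<and> r < 1 \<and> (\<forall>z\<in>sphere 0 1. norm (u (of_real r * z) - u z) < e)"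
proof -
  have "uniformly_continuous_on (cball 0 1) u"
    using assms by (intro compact_uniformly_continuous) auto
  then obtain d where d: "0 < d"
    "\<And>x y. x \<in> cball 0 1 \<Longrightarrow> y \<in> cball 0 1 \<Longrightarrow> dist y x < d \<Longrightarrow> dist (u y) (u x) < e"
    using assms(2) unfolding uniformly_continuous_on_def by metis
  have "\<forall>\<^sub>F r in at_left (1::real). r \<in> {max 0 (1 - d)<..<1}"
    using d by (intro eventually_at_left_real) auto
  thus ?thesis
  proof (rule eventually_mono)
    fix r assume r: "r \<in> {max 0 (1 - d)<..<1}"
    have "norm (u (of_real r * z) - u z) < e" if z: "norm z = 1" for z
    proof -
      have "of_real r * z - z = of_real (r - 1) * z" by (simp add: algebra_simps)
      hence "dist (of_real r * z) z = 1 - r" using z r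
        by (simp only: dist_norm norm_mult norm_of_real) auto
      thus ?thesis using d(2)[of z "of_real r * z"] z r by (auto simp: norm_mult dist_norm)
    qed
    thus "0 < r \<and> r < 1 \<and> (\<forall>z\<in>sphere 0 1. norm (u (of_real r * z) - u z) < e)" using r by auto
  qed
qed

lemma eventually_unit: "\<forall>\<^sub>F r in at_left (1::real). 0 < r \<and> r < 1"
  using eventually_at_left_real[of 0 1] by (auto elim: eventually_mono)

text \<open>The error bound holds along the entire radius at once, so the limits j \<rightarrow>
  \<infinity> and r \<rightarrow> 1 can be interchanged. The polynomials extend continuously to the
  endpoint z, where the same bound makes them Cauchy.\<close>

lemma radial_limit_of_polynomials:
  fixes P :: "nat \<Rightarrow> complex poly"
  assumes near: "\<And>j r. J \<le> j \<Longrightarrow> 0 \<le> r \<Longrightarrow> r < 1 \<Longrightarrow> norm (f (of_real r * z) - poly (P j) (of_real r * z)) \<le> (1/2) ^ j"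
  shows "(\<lambda>j. poly (P j) z) \<longlonglongrightarrow> lim (\<lambda>j. poly (P j) z)"
    "((\<lambda>r. dilate f r z) \<longlongrightarrow> lim (\<lambda>j. poly (P j) z)) (at_left 1)"
proof -
  have Pr: "((\<lambda>r. poly (P j) (of_real r * z)) \<longlongrightarrow> poly (P j) z) (at_left (1::real))" for j
  proof -
    have "((\<lambda>r. poly (P j) (of_real r * z)) \<longlongrightarrow> poly (P j) (of_real 1 * z)) (at_left (1::real))"
      by (intro tendsto_intros)
    thus ?thesis by simp
  qed
  have diff: "norm (poly (P i) z - poly (P j) z) \<le> (1/2) ^ i + (1/2) ^ j" if "J \<le> i" "J \<le> j" for i j
  proof (rule tendsto_upperbound)
    show "((\<lambda>r. norm (poly (P i) (of_real r * z) - poly (P j) (of_real r * z))) \<longlongrightarrow> norm (poly (P i) z - poly (P j) z)) (at_left (1::real))"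
      by (intro tendsto_intros Pr)
    show "\<forall>\<^sub>F r in at_left (1::real). norm (poly (P i) (of_real r * z) - poly (P j) (of_real r * z)) \<le> (1/2) ^ i + (1/2) ^ j"
      using eventually_unit
    proof (rule eventually_mono)
      fix r :: real assume r: "0 < r \<and> r < 1"
      have "norm (poly (P i) (of_real r * z) - poly (P j) (of_real r * z)) \<le>
        norm (f (of_real r * z) - poly (P i) (of_real r * z)) + norm (f (of_real r * z) - poly (P j) (of_real r * z))"
        by norm
      thus "norm (poly (P i) (of_real r * z) - poly (P j) (of_real r * z)) \<le> (1/2) ^ i + (1/2) ^ j"
        using near[OF that(1), of r] near[OF that(2), of r] r by linarith
    qed
  qed simp
  have half: "\<exists>n\<ge>J. (1/2::real) ^ n < e" if e: "0 < e" for e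
  proof -
    obtain n where n: "(1/2::real) ^ n < e" using real_arch_pow_inv[of e "1/2"] e by auto
    have "(1/2::real) ^ (n + J) \<le> (1/2) ^ n" by (intro power_decreasing) auto
    hence "(1/2::real) ^ (n + J) < e" using n by (rule le_less_trans)
    thus ?thesis by (intro exI[of _ "n + J"]) simp
  qed
  have "Cauchy (\<lambda>j. poly (P j) z)"
  proof (rule metric_CauchyI)
    fix e :: real assume "0 < e"
    then obtain n where n: "J \<le> n" "(1/2::real) ^ n < e / 2" using half[of "e/2"] by auto
    show "\<exists>M. \<forall>m\<ge>M. \<forall>n\<ge>M. dist (poly (P m) z) (poly (P n) z) < e"
    proof (intro exI allI impI)
      fix i j assume ij: "n \<le> i" "n \<le> j"
      have "(1/2::real) ^ i \<le> (1/2) ^ n" "(1/2::real) ^ j \<le> (1/2) ^ n" using ij by (auto intro!: power_decreasing)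
      moreover have "dist (poly (P i) z) (poly (P j) z) \<le> (1/2) ^ i + (1/2) ^ j"
        using diff[of i j] n ij by (simp add: dist_norm)
      ultimately show "dist (poly (P i) z) (poly (P j) z) < e" using n(2) by linarith
    qed
  qed
  thus lim: "(\<lambda>j. poly (P j) z) \<longlonglongrightarrow> lim (\<lambda>j. poly (P j) z)"
    using Cauchy_convergent_iff convergent_LIMSEQ_iff by blast
  define L where "L = lim (\<lambda>j. poly (P j) z)"
  have PL: "norm (poly (P i) z - L) \<le> (1/2) ^ i" if "J \<le> i" for i
  proof (rule LIMSEQ_le)
    show "(\<lambda>j. norm (poly (P i) z - poly (P j) z)) \<longlonglongrightarrow> norm (poly (P i) z - L)"
      using lim unfolding L_def by (intro tendsto_intros)
    have "(\<lambda>j. (1/2::real) ^ i + (1/2) ^ j) \<longlonglongrightarrow> (1/2) ^ i + 0"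
      by (intro tendsto_add tendsto_const LIMSEQ_power_zero) auto
    thus "(\<lambda>j. (1/2::real) ^ i + (1/2) ^ j) \<longlonglongrightarrow> (1/2) ^ i" by simp
  qed (use diff that in auto)
  show "((\<lambda>r. dilate f r z) \<longlongrightarrow> lim (\<lambda>j. poly (P j) z)) (at_left 1)"
    unfolding L_def[symmetric]
  proof (rule tendstoI)
    fix e :: real assume "0 < e"
    then obtain n where n: "J \<le> n" "(1/2::real) ^ n < e / 3" using half[of "e/3"] by auto
    have "\<forall>\<^sub>F r in at_left (1::real). dist (poly (P n) (of_real r * z)) (poly (P n) z) < e / 3"
      using Pr[of n] \<open>0 < e\<close> by (intro tendstoD) auto
    with eventually_unit show "\<forall>\<^sub>F r in at_left 1. dist (dilate f r z) L < e"
    proof (rule eventually_elim2)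
      fix r :: real assume r: "0 < r \<and> r < 1" "dist (poly (P n) (of_real r * z)) (poly (P n) z) < e / 3"
      have "dist (dilate f r z) L \<le> norm (f (of_real r * z) - poly (P n) (of_real r * z)) +
        dist (poly (P n) (of_real r * z)) (poly (P n) z) + norm (poly (P n) z - L)"
        unfolding dilate_def dist_norm by norm
      thus "dist (dilate f r z) L < e"
        using near[OF n(1), of r] PL[OF n(1)] n(2) r by simp
    qed
  qed
qed

text \<open>The L^1 errors are 4^-j, and the maximal inequality at level 2^-j leaves exceptional
  sets of measure at most 320 / 2^j. These are summable, so by Borel-Cantelli almost every radius
  eventually satisfies the bound required by \<open>radial_limit_of_polynomials\<close>. The
  convergence in L^1 follows by comparison with one polynomial, which is uniformly continuous up to
  the circle.\<close>

theorem hardy1_boundary: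
  assumes f: "f holomorphic_on ball 0 1"
    and A: "\<And>r. 0 < r \<Longrightarrow> r < 1 \<Longrightarrow> (LINT z|\<mu>. norm (dilate f r z)) \<le> A"
  shows "\<exists>F. radial_boundary f F \<and> integrable \<mu> F \<and>
    L1_boundary f F"
proof -
  have "\<exists>P :: complex poly. \<forall>r. 0 < r \<longrightarrow> r < 1 \<longrightarrow>
    (LINT z|\<mu>. norm (dilate (\<lambda>z. f z - poly P z) r z)) \<le> (1/4) ^ j" for j :: nat
    by (rule hardy1_polynomial_dense[OF f A]) auto
  then obtain P where "\<forall>j r. 0 < r \<longrightarrow> r < 1 \<longrightarrow>
    (LINT z|\<mu>. norm (dilate (\<lambda>z. f z - poly (P j) z) r z)) \<le> (1/4) ^ j" by metis
  hence P: "(LINT z|\<mu>. norm (dilate (\<lambda>z. f z - poly (P j) z) r z)) \<le> (1/4) ^ j"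
    if "0 < r" "r < 1" for j r using that by blast
  define D where "D j z = f z - poly (P j) z" for j z
  have D: "D j holomorphic_on ball 0 1" for j unfolding D_def using f by (intro holomorphic_intros)
  have Dint: "integrable \<mu> (\<lambda>z. norm (dilate (D j) r z))" if "0 < r" "r < 1" for j r
    using D that by (intro integrable_circle_continuous continuous_intros) auto
  have Dn: "(\<integral>\<^sup>+z. ennreal (norm (dilate (D j) r z)) \<partial>\<mu>) \<le> ennreal ((1/4) ^ j)"
    if "0 < r" "r < 1" for j r
    using P[OF that, of j] Dint[OF that, of j]
    by (subst nn_integral_eq_integral) (auto simp: D_def[abs_def] intro!: ennreal_leI)
  define E where "E j = {z\<in>sphere 0 1. \<exists>r\<in>{0..<1}. (1/2) ^ j < norm (dilate (D j) r z)}" for j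
  have Es: "E j \<in> sets \<mu>" for j
    unfolding E_def dilate_def by (intro open_radial_sup holomorphic_on_imp_continuous_on D) auto
  have Em: "emeasure \<mu> (E j) \<le> ennreal (320 * (1/2) ^ j)" for j
  proof -
    have "emeasure \<mu> (E j) \<le> ennreal (320 * (1/4) ^ j / (1/2) ^ j)"
      unfolding E_def by (rule maximal_inequality[OF D _ _ Dn]) auto
    also have "320 * (1/4) ^ j / (1/2) ^ j = 320 * (1/2::real) ^ j"
      using power_mult_distrib[of "1/2::real" "1/2" j] by simp
    finally show ?thesis .
  qed
  have "AE z in \<mu>. eventually (\<lambda>j. z \<in> space \<mu> - E j) sequentially"
  proof (rule borel_cantelli_AE1[OF Es])
    show "emeasure \<mu> (E j) < \<infinity>" for j
      using le_less_trans[OF Em[of j]] by simp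
    show "summable (\<lambda>j. measure \<mu> (E j))"
    proof (rule summable_comparison_test')
      show "summable (\<lambda>j. 320 * (1/2::real) ^ j)" by (intro summable_mult summable_geometric) auto
      show "norm (measure \<mu> (E j)) \<le> 320 * (1/2) ^ j" for j
        using enn2real_mono[OF Em[of j]] by (simp add: measure_def)
    qed
  qed
  hence AEJ: "AE z in \<mu>. \<exists>J. \<forall>j\<ge>J. \<forall>r. 0 \<le> r \<longrightarrow> r < 1 \<longrightarrow>
     norm (f (of_real r * z) - poly (P j) (of_real r * z)) \<le> (1/2) ^ j"
  proof (rule AE_mp, intro AE_I2 impI)
    fix z assume z: "z \<in> space \<mu>" and "eventually (\<lambda>j. z \<in> space \<mu> - E j) sequentially"
    then obtain J where "\<And>j. J \<le> j \<Longrightarrow> z \<notin> E j" by (auto simp: eventually_sequentially)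
    thus "\<exists>J. \<forall>j\<ge>J. \<forall>r. 0 \<le> r \<longrightarrow> r < 1 \<longrightarrow>
       norm (f (of_real r * z) - poly (P j) (of_real r * z)) \<le> (1/2) ^ j"
      using z unfolding E_def D_def dilate_def by (intro exI[of _ J]) (auto simp: not_less)
  qed
  \<comment> \<open>Defining \<open>F\<close> as a limit of a sequence of polynomials, rather than
    as a limit in the continuous variable r, gives measurability directly.\<close>
  define F where "F z = lim (\<lambda>j. poly (P j) z)" for z
  have radial: "AE z in \<mu>. ((\<lambda>r. dilate f r z) \<longlongrightarrow> F z) (at_left 1)"
    using AEJ unfolding F_def by eventually_elim (blast intro: radial_limit_of_polynomials(2))
  have Pm: "poly (P j) \<in> borel_measurable \<mu>" for j
    by (intro measurable_circle continuous_intros)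
  have Fm [measurable]: "F \<in> borel_measurable \<mu>"
    unfolding F_def[abs_def] by (intro borel_measurable_lim_metric Pm)
  \<comment> \<open>Fatou's lemma is applied along this sequence of radii; it carries the L^1 error
    bound of the interior circles over to the boundary.\<close>
  define R where "R n = 1 - 1 / (real n + 2)" for n
  have R: "0 < R n" "R n < 1" for n by (auto simp: R_def)
  have "R \<longlonglongrightarrow> 1" unfolding R_def by real_asymp
  hence Rl: "filterlim R (at_left 1) sequentially"
    using R by (auto simp: filterlim_at intro!: always_eventually less_imp_neq)
  have PF: "(\<integral>\<^sup>+z. ennreal (norm (poly (P j) z - F z)) \<partial>\<mu>) \<le> ennreal ((1/4) ^ j)" for j
  proof -
    have "(\<integral>\<^sup>+z. ennreal (norm (poly (P j) z - F z)) \<partial>\<mu>) =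
      (\<integral>\<^sup>+z. liminf (\<lambda>n. ennreal (norm (dilate (D j) (R n) z))) \<partial>\<mu>)"
    proof (rule nn_integral_cong_AE)
      show "AE z in \<mu>. ennreal (norm (poly (P j) z - F z)) = liminf (\<lambda>n. ennreal (norm (dilate (D j) (R n) z)))"
        using radial
      proof eventually_elim
        fix z assume z: "((\<lambda>r. dilate f r z) \<longlongrightarrow> F z) (at_left 1)"
        have "((\<lambda>r. poly (P j) (of_real r * z)) \<longlongrightarrow> poly (P j) (of_real 1 * z)) (at_left (1::real))"
          by (intro tendsto_intros)
        with z have "((\<lambda>r. dilate (D j) r z) \<longlongrightarrow> F z - poly (P j) z) (at_left 1)"
          unfolding D_def dilate_def by (intro tendsto_diff) auto
        hence "(\<lambda>n. dilate (D j) (R n) z) \<longlonglongrightarrow> F z - poly (P j) z" by (rule filterlim_compose[OF _ Rl])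
        hence "(\<lambda>n. ennreal (norm (dilate (D j) (R n) z))) \<longlonglongrightarrow> ennreal (norm (F z - poly (P j) z))"
          by (intro tendsto_ennrealI tendsto_norm)
        from lim_imp_Liminf[OF _ this]
        show "ennreal (norm (poly (P j) z - F z)) = liminf (\<lambda>n. ennreal (norm (dilate (D j) (R n) z)))"
          by (simp add: norm_minus_commute)
      qed
    qed
    also have "\<dots> \<le> liminf (\<lambda>n. \<integral>\<^sup>+z. ennreal (norm (dilate (D j) (R n) z)) \<partial>\<mu>)"
      using Dint[OF R] by (intro nn_integral_liminf) (auto dest: borel_measurable_integrable)
    also have "\<dots> \<le> liminf (\<lambda>n. ennreal ((1/4) ^ j))"
      by (intro Liminf_mono always_eventually allI Dn R)
    also have "\<dots> = ennreal ((1/4) ^ j)" by (simp add: Liminf_const)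
    finally show ?thesis .
  qed
  have PFi: "integrable \<mu> (\<lambda>z. poly (P j) z - F z)" for j
  proof (rule integrableI_bounded)
    show "(\<lambda>z. poly (P j) z - F z) \<in> borel_measurable \<mu>" using Pm[of j] by measurable
    show "(\<integral>\<^sup>+z. ennreal (norm (poly (P j) z - F z)) \<partial>\<mu>) < \<infinity>"
      by (rule le_less_trans[OF PF]) simp
  qed
  have Pi: "integrable \<mu> (poly (P j))" for j
    by (intro integrable_circle_continuous continuous_intros)
  have Fi: "integrable \<mu> F"
    using Bochner_Integration.integrable_diff[OF Pi PFi, of 0 0] by simp
  have PFr: "(LINT z|\<mu>. norm (poly (P j) z - F z)) \<le> (1/4) ^ j" for j
    using PF[of j] PFi[of j] by (subst (asm) nn_integral_eq_integral) auto
  have "L1_boundary f F"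
  proof (rule tendstoI)
    fix e :: real assume e: "0 < e"
    obtain j where j: "(1/4::real) ^ j < e / 3" using real_arch_pow_inv[of "e/3" "1/4"] e by auto
    have "\<forall>\<^sub>F r in at_left 1. 0 < r \<and> r < 1 \<and> (\<forall>z\<in>sphere 0 1. norm (poly (P j) (of_real r * z) - poly (P j) z) < e / 3)"
      using e by (intro eventually_dilate_near continuous_intros) auto
    thus "\<forall>\<^sub>F r in at_left 1. dist (LINT z|\<mu>. norm (dilate f r z - F z)) 0 < e"
    proof (rule eventually_mono)
      fix r :: real assume r: "0 < r \<and> r < 1 \<and> (\<forall>z\<in>sphere 0 1. norm (poly (P j) (of_real r * z) - poly (P j) z) < e / 3)"
      have fi: "integrable \<mu> (dilate f r)"
        using r f by (intro integrable_circle_continuous continuous_intros) auto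
      have "(LINT z|\<mu>. norm (dilate f r z - F z)) \<le>
        (LINT z|\<mu>. norm (dilate (D j) r z) + e / 3 + norm (poly (P j) z - F z))"
      proof (rule integral_mono)
        fix z assume "z \<in> space \<mu>"
        hence "norm (poly (P j) (of_real r * z) - poly (P j) z) \<le> e / 3" using r by (auto intro: less_imp_le)
        moreover have "norm (dilate f r z - F z) \<le> norm (dilate (D j) r z) +
          norm (poly (P j) (of_real r * z) - poly (P j) z) + norm (poly (P j) z - F z)"
          unfolding D_def dilate_def by norm
        ultimately show "norm (dilate f r z - F z) \<le> norm (dilate (D j) r z) + e / 3 + norm (poly (P j) z - F z)" by simp
      qed (use fi Fi Dint PFi r in auto)
      also have "\<dots> = (LINT z|\<mu>. norm (dilate (D j) r z)) + e / 3 + (LINT z|\<mu>. norm (poly (P j) z - F z))"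
        using Dint[of r j] PFi[of j] r by simp
      also have "\<dots> \<le> (1/4) ^ j + e / 3 + (1/4) ^ j"
        using P[of r j] PFr[of j] r by (intro add_mono) (auto simp: D_def[abs_def])
      also have "\<dots> < e" using j by simp
      finally show "dist (LINT z|\<mu>. norm (dilate f r z - F z)) 0 < e"
        by (simp add: dist_real_def)
    qed
  qed
  thus ?thesis using radial Fm Fi by (intro exI[of _ F]) (auto simp: radial_boundary_def)
qed

section \<open>Rotationally symmetric norms\<close>

lemma LinfI:
  "h \<in> borel_measurable \<mu> \<Longrightarrow> AE z in \<mu>. norm (h z) \<le> C \<Longrightarrow> h \<in> Linf_circle"
  unfolding Linf_circle_def by blast

lemma Linf_measurable [dest]: "h \<in> Linf_circle \<Longrightarrow> h \<in> borel_measurable \<mu>"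
  by (simp add: Linf_circle_def)

lemma Linf_bound:
  assumes "h \<in> Linf_circle"
  obtains C where "0 \<le> C" "AE z in \<mu>. norm (h z) \<le> C"
proof -
  obtain C :: real where C: "AE z in \<mu>. norm (h z) \<le> C"
    using assms by (auto simp: Linf_circle_def)
  have "AE z in \<mu>. norm (h z) \<le> max 0 C" using C by eventually_elim auto
  thus ?thesis using that[of "max 0 C"] by simp
qed

lemma Linf_dominated:
  assumes "h \<in> Linf_circle" "g \<in> borel_measurable \<mu>"
    "AE z in \<mu>. norm (g z) \<le> norm (h z)"
  shows "g \<in> Linf_circle"
proof -
  obtain C where "AE z in \<mu>. norm (h z) \<le> C" using Linf_bound[OF assms(1)] by blast
  with assms(3) have "AE z in \<mu>. norm (g z) \<le> C" by eventually_elim simp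
  thus ?thesis using assms(2) by (rule LinfI[rotated])
qed

lemma Linf_continuous:
  assumes "continuous_on (sphere 0 1) h"
  shows "h \<in> Linf_circle"
proof -
  have "bounded (h ` sphere 0 1)"
    using assms by (simp add: compact_continuous_image compact_imp_bounded)
  then obtain B where "\<And>z. z \<in> sphere 0 1 \<Longrightarrow> norm (h z) \<le> B"
    unfolding bounded_iff by blast
  thus ?thesis
    by (intro LinfI[of _ B] measurable_circle assms AE_I2) auto
qed

lemma Linf_const [simp, intro]: "(\<lambda>z. c) \<in> Linf_circle"
  by (intro Linf_continuous continuous_intros)

lemma Linf_add [intro]:
  assumes "g \<in> Linf_circle" "h \<in> Linf_circle"
  shows "(\<lambda>z. g z + h z) \<in> Linf_circle"
proof -
  obtain B where B: "AE z in \<mu>. norm (g z) \<le> B"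
    using Linf_bound[OF assms(1)] by blast
  obtain C where "AE z in \<mu>. norm (h z) \<le> C"
    using Linf_bound[OF assms(2)] by blast
  with B have "AE z in \<mu>. norm (g z + h z) \<le> B + C"
    by eventually_elim (rule norm_triangle_mono)
  thus ?thesis using assms by (intro LinfI[OF borel_measurable_add]) auto
qed

lemma Linf_mult [intro]:
  assumes "g \<in> Linf_circle" "h \<in> Linf_circle"
  shows "(\<lambda>z. g z * h z) \<in> Linf_circle"
proof -
  obtain B where B: "AE z in \<mu>. norm (g z) \<le> B" "0 \<le> B"
    using Linf_bound[OF assms(1)] by blast
  obtain C where "AE z in \<mu>. norm (h z) \<le> C"
    using Linf_bound[OF assms(2)] by blast
  with B(1) have "AE z in \<mu>. norm (g z * h z) \<le> B * C"
    by eventually_elim (use B(2) in \<open>auto simp: norm_mult intro!: mult_mono\<close>)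
  thus ?thesis using assms by (intro LinfI[OF borel_measurable_times]) auto
qed

lemma Linf_diff [intro]:
  "g \<in> Linf_circle \<Longrightarrow> h \<in> Linf_circle \<Longrightarrow> (\<lambda>z. g z - h z) \<in> Linf_circle"
  using Linf_add[of g "\<lambda>z. (-1) * h z"] Linf_mult[of "\<lambda>z. -1" h] by simp

lemma Linf_norm [intro]:
  "h \<in> Linf_circle \<Longrightarrow> (\<lambda>z. complex_of_real (norm (h z))) \<in> Linf_circle"
  by (rule Linf_dominated[of h]) auto

lemma Linf_indicator [intro]:
  "E \<in> sets \<mu> \<Longrightarrow> indicator E \<in> Linf_circle"
  by (intro LinfI[of _ 1] borel_measurable_indicator AE_I2) (auto simp: indicator_def)

lemma Linf_simple:
  assumes "simple_function \<mu> s"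
  shows "s \<in> Linf_circle"
proof -
  have "finite (s ` space \<mu>)" using assms by (rule simple_functionD)
  hence "bounded (s ` space \<mu>)" by (rule finite_imp_bounded)
  then obtain B where "\<And>z. z \<in> space \<mu> \<Longrightarrow> norm (s z) \<le> B"
    unfolding bounded_iff by blast
  thus ?thesis
    by (intro LinfI[of _ B] borel_measurable_simple_function assms AE_I2)
qed

lemma Linf_integrable:
  assumes "h \<in> Linf_circle"
  shows "integrable \<mu> h"
  using Linf_bound[OF assms] integrable_circle_bounded[OF Linf_measurable[OF assms]] by blast

text \<open>Real and imaginary parts are rounded down to multiples of e/2; boundedness leaves only
  finitely many values. The bound is required at every point of the circle, hence the use of bounded
  representatives for elements of \<open>Linf_circle\<close>.\<close>

lemma uniform_simple:
  assumes h: "h \<in> borel_measurable \<mu>" and C: "\<And>z. z \<in> sphere 0 1 \<Longrightarrow> norm (h z) \<le> C"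
    and e: "0 < e"
  shows "\<exists>s :: complex \<Rightarrow> complex. simple_function \<mu> s \<and> (\<forall>z\<in>sphere 0 1. norm (h z - s z) \<le> e)"
proof -
  define d where "d = e / 2"
  have d: "0 < d" using e by (simp add: d_def)
  define s where "s z = Complex (d * of_int \<lfloor>Re (h z) / d\<rfloor>) (d * of_int \<lfloor>Im (h z) / d\<rfloor>)" for z
  have rnd: "\<bar>x - d * of_int \<lfloor>x / d\<rfloor>\<bar> \<le> d" for x
  proof -
    have "of_int \<lfloor>x / d\<rfloor> * d \<le> x" "x \<le> (of_int \<lfloor>x / d\<rfloor> + 1) * d"
      using d floor_divide_lower[OF d, of x] floor_divide_upper[OF d, of x] by (auto intro: less_imp_le)
    thus ?thesis by (simp add: algebra_simps abs_le_iff)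
  qed
  have near: "norm (h z - s z) \<le> e" for z
  proof -
    have "norm (h z - s z) \<le> \<bar>Re (h z - s z)\<bar> + \<bar>Im (h z - s z)\<bar>" by (rule cmod_le)
    also have "\<dots> \<le> d + d" unfolding s_def using rnd by (intro add_mono) auto
    finally show ?thesis by (simp add: d_def)
  qed
  define N where "N = \<lceil>C / d\<rceil> + 1"
  have fl: "\<lfloor>x / d\<rfloor> \<in> {-N..N}" if "\<bar>x\<bar> \<le> C" for x
  proof -
    have 1: "x / d \<le> C / d" "- (C / d) \<le> x / d" using that d by (auto simp: field_simps abs_le_iff)
    have "\<lfloor>x / d\<rfloor> \<le> N" unfolding N_def using 1 by linarith
    moreover have "- N \<le> \<lfloor>x / d\<rfloor>" unfolding N_def using 1 by linarith
    ultimately show ?thesis by simp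
  qed
  have "simple_function \<mu> s"
  proof (rule simple_function_borel_measurable)
    have [measurable]: "h \<in> borel_measurable \<mu>" by fact
    show "s \<in> borel_measurable \<mu>" unfolding s_def[abs_def] Complex_eq by measurable
    have "s ` space \<mu> \<subseteq> (\<lambda>(a, b). Complex (d * of_int a) (d * of_int b)) ` ({-N..N} \<times> {-N..N})"
    proof
      fix y assume "y \<in> s ` space \<mu>"
      then obtain z where z: "norm z = 1" "y = s z" by auto
      have "\<bar>Re (h z)\<bar> \<le> C" "\<bar>Im (h z)\<bar> \<le> C"
        using C[of z] z abs_Re_le_cmod[of "h z"] abs_Im_le_cmod[of "h z"] by auto
      thus "y \<in> (\<lambda>(a, b). Complex (d * of_int a) (d * of_int b)) ` ({-N..N} \<times> {-N..N})"
        unfolding z(2) s_def by (intro image_eqI[of _ _ "(\<lfloor>Re (h z) / d\<rfloor>, \<lfloor>Im (h z) / d\<rfloor>)"] SigmaI fl) simp_all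
    qed
    thus "finite (s ` space \<mu>)" by (rule finite_subset) auto
  qed
  thus ?thesis using near by blast
qed

lemma bounded_representative:
  assumes "h \<in> Linf_circle"
  obtains h' C where "h' \<in> borel_measurable \<mu>" "\<And>z. norm (h' z) \<le> C"
    "AE z in \<mu>. h' z = h z" "0 \<le> C"
proof -
  obtain C where C: "0 \<le> C" "AE z in \<mu>. norm (h z) \<le> C"
    using Linf_bound[OF assms] by blast
  have [measurable]: "h \<in> borel_measurable \<mu>" using assms by blast
  show ?thesis
  proof (rule that[of "\<lambda>z. if norm (h z) \<le> C then h z else 0" C])
    show "AE z in \<mu>. (if norm (h z) \<le> C then h z else 0) = h z"
      using C(2) by eventually_elim auto
  qed (use C in auto)
qed

locale rotsym_norm =
  fixes \<alpha> :: "(complex \<Rightarrow> complex) \<Rightarrow> real"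
  assumes rotsym: "rotationally_symmetric_norm \<alpha>"
begin

lemma nonneg: "h \<in> Linf_circle \<Longrightarrow> 0 \<le> \<alpha> h"
  and zero_iff: "h \<in> Linf_circle \<Longrightarrow> \<alpha> h = 0 \<longleftrightarrow> (AE z in \<mu>. h z = 0)"
  and scale: "h \<in> Linf_circle \<Longrightarrow> \<alpha> (\<lambda>z. c * h z) = norm c * \<alpha> h"
  and triangle: "g \<in> Linf_circle \<Longrightarrow> h \<in> Linf_circle \<Longrightarrow> \<alpha> (\<lambda>z. g z + h z) \<le> \<alpha> g + \<alpha> h"
  and one: "\<alpha> (\<lambda>z. 1) = 1"
  and norm_eq: "h \<in> Linf_circle \<Longrightarrow> \<alpha> (\<lambda>z. complex_of_real (norm (h z))) = \<alpha> h"
  and rotate: "h \<in> Linf_circle \<Longrightarrow> norm w = 1 \<Longrightarrow> \<alpha> (\<lambda>z. h (cnj w * z)) = \<alpha> h"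
  using rotsym unfolding rotationally_symmetric_norm_def by auto

lemma const: "\<alpha> (\<lambda>z. c) = norm c"
  using scale[of "\<lambda>z. 1" c] one by simp

lemma diff_commute:
  assumes "g \<in> Linf_circle" "h \<in> Linf_circle"
  shows "\<alpha> (\<lambda>z. g z - h z) = \<alpha> (\<lambda>z. h z - g z)"
  using scale[OF Linf_diff[OF assms], of "-1"] by simp

lemma triangle_diff:
  assumes "g \<in> Linf_circle" "h \<in> Linf_circle"
  shows "\<alpha> g \<le> \<alpha> h + \<alpha> (\<lambda>z. g z - h z)"
  using triangle[OF assms(2) Linf_diff[OF assms]] by simp

lemma cong_AE:
  assumes "g \<in> Linf_circle" "h \<in> Linf_circle" "AE z in \<mu>. g z = h z"
  shows "\<alpha> g = \<alpha> h"
proof -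
  have "\<alpha> (\<lambda>z. g z - h z) = 0" using assms by (subst zero_iff) auto
  moreover have "\<alpha> (\<lambda>z. h z - g z) = 0" using assms by (subst zero_iff) auto
  ultimately show ?thesis using triangle_diff[of g h] triangle_diff[of h g] assms by linarith
qed

text \<open>The product \<open>c h\<close> with \<open>0 \<le> c \<le> 1\<close> is the average of \<open>\<omega> h\<close> and \<open>cnj \<omega> h\<close>, where
  \<open>\<omega>\<close> is unimodular with real part \<open>c\<close>.\<close>

lemma mono:
  assumes s: "s \<in> Linf_circle" and h: "h \<in> Linf_circle"
    and le: "AE z in \<mu>. norm (s z) \<le> norm (h z)"
  shows "\<alpha> s \<le> \<alpha> h"
proof -
  have [measurable]: "s \<in> borel_measurable \<mu>" "h \<in> borel_measurable \<mu>"
    using s h by auto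
  \<comment> \<open>The minimum keeps c in [0,1] also on the null set where the hypothesis fails, so
    that \<omega> is unimodular everywhere. Where h vanishes, division by zero gives c = 0, which is
    correct because s vanishes there too.\<close>
  define c where "c z = min 1 (norm (s z) / norm (h z))" for z
  have c: "0 \<le> c z" "c z \<le> 1" for z by (auto simp: c_def)
  define \<omega> where "\<omega> z = complex_of_real (c z) + \<i> * complex_of_real (sqrt (1 - (c z)\<^sup>2))" for z
  have [measurable]: "\<omega> \<in> borel_measurable \<mu>" unfolding \<omega>_def[abs_def] c_def by measurable
  have n\<omega>: "norm (\<omega> z) = 1" for z
    using c[of z] by (simp add: \<omega>_def cmod_def power_le_one)
  have re: "\<omega> z + cnj (\<omega> z) = complex_of_real (2 * c z)" for z
    by (simp add: \<omega>_def complex_eq_iff)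
  have \<omega>L: "\<omega> \<in> Linf_circle" "(\<lambda>z. cnj (\<omega> z)) \<in> Linf_circle"
    by (auto intro!: LinfI[of _ 1] simp: n\<omega>
        intro: measurable_compose[OF _ borel_measurable_continuous_onI[OF continuous_on_cnj[OF continuous_on_id]]])
  have \<omega>h: "(\<lambda>z. \<omega> z * h z) \<in> Linf_circle" "(\<lambda>z. cnj (\<omega> z) * h z) \<in> Linf_circle"
    using \<omega>L h by auto
  have eq: "\<alpha> (\<lambda>z. \<omega> z * h z) = \<alpha> h" "\<alpha> (\<lambda>z. cnj (\<omega> z) * h z) = \<alpha> h"
    using norm_eq[OF \<omega>h(1)] norm_eq[OF \<omega>h(2)] norm_eq[OF h] by (simp_all add: norm_mult n\<omega>)
  define k where "k z = (1/2) * (\<omega> z * h z + cnj (\<omega> z) * h z)" for z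
  have kL: "k \<in> Linf_circle" unfolding k_def[abs_def] using \<omega>L h by (intro Linf_mult Linf_add) auto
  have "\<alpha> s = \<alpha> (\<lambda>z. complex_of_real (norm (s z)))" using norm_eq[OF s] by simp
  also have "\<dots> = \<alpha> (\<lambda>z. complex_of_real (norm (k z)))"
  proof (rule cong_AE)
    show "AE z in \<mu>. complex_of_real (norm (s z)) = complex_of_real (norm (k z))"
      using le
    proof eventually_elim
      fix z assume "norm (s z) \<le> norm (h z)"
      hence "norm (s z) = c z * norm (h z)" by (auto simp: c_def min_def field_simps)
      moreover have "k z = complex_of_real (c z) * h z"
        using re[of z] by (simp add: k_def distrib_right[symmetric])
      ultimately show "complex_of_real (norm (s z)) = complex_of_real (norm (k z))"
        using c[of z] by (simp add: norm_mult)
    qed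
  qed (use s kL in auto)
  also have "\<dots> = \<alpha> k" using norm_eq[OF kL] .
  also have "\<dots> = (1/2) * \<alpha> (\<lambda>z. \<omega> z * h z + cnj (\<omega> z) * h z)"
    unfolding k_def using \<omega>h by (subst scale) auto
  also have "\<dots> \<le> (1/2) * (\<alpha> h + \<alpha> h)"
    using triangle[OF \<omega>h] by (simp add: eq)
  finally show ?thesis by simp
qed

lemma le_bound:
  assumes "h \<in> Linf_circle" "AE z in \<mu>. norm (h z) \<le> C" "0 \<le> C"
  shows "\<alpha> h \<le> C"
  using mono[OF assms(1), of "\<lambda>z. of_real C"] assms by (simp add: const)

section \<open>The extension of the norm to measurable functions\<close>

text \<open>The supremum defining \<open>norm_ext\<close> sees simple functions only. This lemma
  admits every bounded function as a competitor, which is needed as soon as a simple function is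
  multiplied by a measurable weight or truncated.\<close>

lemma le_norm_ext:
  assumes k: "k \<in> Linf_circle" and le: "AE z in \<mu>. norm (k z) \<le> norm (a z)"
  shows "ennreal (\<alpha> k) \<le> norm_ext \<alpha> a"
proof (rule ennreal_le_epsilon)
  fix e :: real assume e: "0 < e"
  obtain k' C where k': "k' \<in> borel_measurable \<mu>" "\<And>z. norm (k' z) \<le> C"
    "AE z in \<mu>. k' z = k z" "0 \<le> C" by (rule bounded_representative[OF k], rule that)
  have k'L: "k' \<in> Linf_circle" using k' by (intro LinfI[of _ C]) auto
  obtain s where s: "simple_function \<mu> s" "\<And>z. norm z = 1 \<Longrightarrow> norm (k' z - s z) \<le> e / 2"
    using uniform_simple[OF k'(1,2), of "e / 2"] e by auto
  note sL = Linf_simple[OF s(1)]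
  \<comment> \<open>Lowering the modulus of s by e/2 absorbs the approximation error: |s'| \<le>
    |k'| keeps s' admissible, while |k'| \<le> s' + e costs only e.\<close>
  define s' where "s' z = complex_of_real (max 0 (norm (s z) - e / 2))" for z
  have s': "simple_function \<mu> s'"
    unfolding s'_def[abs_def] by (rule simple_function_compose1[OF s(1)])
  note s'L = Linf_simple[OF s']
  have "\<alpha> k = \<alpha> k'" using k'(3) by (intro cong_AE k k'L) auto
  also have "\<dots> \<le> \<alpha> (\<lambda>z. s' z + of_real e)"
  proof (intro mono k'L Linf_add s'L Linf_const AE_I2)
    fix z assume "z \<in> space \<mu>"
    hence "norm (k' z) \<le> norm (s z) + e / 2" using s(2)[of z] norm_triangle_ineq2[of "k' z" "s z"] by simp
    also have "\<dots> \<le> max 0 (norm (s z) - e / 2) + e" by simp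
    also have "\<dots> = norm (s' z + of_real e)"
      using e by (simp add: s'_def flip: of_real_add)
    finally show "norm (k' z) \<le> norm (s' z + of_real e)" .
  qed
  also have "\<dots> \<le> \<alpha> s' + e" using triangle[OF s'L, of "\<lambda>z. of_real e"] e by (simp add: const)
  finally have "ennreal (\<alpha> k) \<le> ennreal (\<alpha> s' + e)" by (rule ennreal_leI)
  also have "\<dots> = ennreal (\<alpha> s') + ennreal e" using nonneg[OF s'L] e by simp
  also have "ennreal (\<alpha> s') \<le> norm_ext \<alpha> a"
    unfolding norm_ext_def
  proof (rule SUP_upper, safe)
    show "AE z in \<mu>. norm (s' z) \<le> norm (a z)"
      using le k'(3) AE_space
    proof eventually_elim
      fix z assume z: "norm (k z) \<le> norm (a z)" "k' z = k z" "z \<in> space \<mu>"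
      hence "norm (s z) - e / 2 \<le> norm (k' z)"
        using s(2)[of z] norm_triangle_ineq2[of "s z" "k' z"] by (simp add: norm_minus_commute)
      thus "norm (s' z) \<le> norm (a z)" using z by (simp add: s'_def)
    qed
  qed (rule s')
  finally show "ennreal (\<alpha> k) \<le> norm_ext \<alpha> a + ennreal e" by simp
qed

lemma norm_ext_Linf:
  assumes "h \<in> Linf_circle"
  shows "norm_ext \<alpha> h = ennreal (\<alpha> h)"
proof (rule antisym)
  show "norm_ext \<alpha> h \<le> ennreal (\<alpha> h)"
    unfolding norm_ext_def using assms
    by (intro SUP_least ennreal_leI mono) (auto intro: Linf_simple)
qed (rule le_norm_ext[OF assms], simp)

lemma norm_ext_mono:
  assumes "AE z in \<mu>. norm (c z) \<le> norm (a z)"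
  shows "norm_ext \<alpha> c \<le> norm_ext \<alpha> a"
  unfolding norm_ext_def
proof (intro SUP_subset_mono Collect_mono impI conjI)
  fix s :: "complex \<Rightarrow> complex" assume s: "simple_function \<mu> s \<and> (AE z in \<mu>. norm (s z) \<le> norm (c z))"
  thus "simple_function \<mu> s" by blast
  from s have "AE z in \<mu>. norm (s z) \<le> norm (c z)" by blast
  with assms show "AE z in \<mu>. norm (s z) \<le> norm (a z)" by eventually_elim simp
qed simp

text \<open>A simple function below |a| + |b| is split in the proportion |a| : |b|. The two pieces
  are bounded but in general not simple, so \<open>le_norm_ext\<close> is used for each. Where a and
  b both vanish the weights are 0 by division by zero, and s is 0 as well.\<close>

lemma norm_ext_triangle:
  assumes [measurable]: "a \<in> borel_measurable \<mu>" "b \<in> borel_measurable \<mu>"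
    and le: "AE z in \<mu>. norm (c z) \<le> norm (a z) + norm (b z)"
  shows "norm_ext \<alpha> c \<le> norm_ext \<alpha> a + norm_ext \<alpha> b"
  unfolding norm_ext_def[of \<alpha> c]
proof (rule SUP_least, safe)
  fix s :: "complex \<Rightarrow> complex"
  assume s: "simple_function \<mu> s" "AE z in \<mu>. norm (s z) \<le> norm (c z)"
  note sL = Linf_simple[OF s(1)]
  have [measurable]: "s \<in> borel_measurable \<mu>" using sL by blast
  have le': "AE z in \<mu>. norm (s z) \<le> norm (a z) + norm (b z)"
    using le s(2) by eventually_elim simp
  define t where "t z = norm (a z) / (norm (a z) + norm (b z))" for z
  define t' where "t' z = norm (b z) / (norm (a z) + norm (b z))" for z
  have frac: "x / (x + y) \<le> 1" "y / (x + y) \<le> 1" if "0 \<le> x" "0 \<le> y" for x y :: real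
    using that by (cases "x + y = 0"; force simp: divide_le_eq)+
  have [measurable]: "t \<in> borel_measurable \<mu>" "t' \<in> borel_measurable \<mu>"
    unfolding t_def[abs_def] t'_def[abs_def] by measurable
  have t: "0 \<le> t z" "t z \<le> 1" for z using frac(1) by (auto simp: t_def)
  have t': "0 \<le> t' z" "t' z \<le> 1" for z using frac(2) by (auto simp: t'_def)
  have sum: "t z + t' z = 1" if "norm (a z) + norm (b z) \<noteq> 0" for z
    using that unfolding t_def t'_def add_divide_distrib[symmetric] by simp
  define k where "k z = of_real (t z) * s z" for z
  define k' where "k' z = of_real (t' z) * s z" for z
  have kL: "k \<in> Linf_circle"
    by (rule Linf_dominated[OF sL]) (auto simp: k_def[abs_def] norm_mult t abs_of_nonneg intro!: mult_left_le_one_le AE_I2)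
  have k'L: "k' \<in> Linf_circle"
    by (rule Linf_dominated[OF sL]) (auto simp: k'_def[abs_def] norm_mult t' abs_of_nonneg intro!: mult_left_le_one_le AE_I2)
  have "\<alpha> s = \<alpha> (\<lambda>z. k z + k' z)"
  proof (rule cong_AE)
    show "AE z in \<mu>. s z = k z + k' z" using le'
    proof eventually_elim
      fix z assume z: "norm (s z) \<le> norm (a z) + norm (b z)"
      show "s z = k z + k' z"
      proof (cases "norm (a z) + norm (b z) = 0")
        case False
        have "k z + k' z = of_real (t z + t' z) * s z" by (simp add: k_def k'_def algebra_simps)
        thus ?thesis using sum[OF False] by simp
      qed (use z in \<open>simp add: k_def k'_def\<close>)
    qed
  qed (use sL kL k'L in auto)
  also have "\<dots> \<le> \<alpha> k + \<alpha> k'" by (rule triangle[OF kL k'L])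
  finally have "ennreal (\<alpha> s) \<le> ennreal (\<alpha> k + \<alpha> k')" by (rule ennreal_leI)
  also have "\<dots> = ennreal (\<alpha> k) + ennreal (\<alpha> k')" using nonneg kL k'L by simp
  also have "\<dots> \<le> norm_ext \<alpha> a + norm_ext \<alpha> b"
  proof (intro add_mono le_norm_ext kL k'L)
    show "AE z in \<mu>. norm (k z) \<le> norm (a z)" using le'
    proof eventually_elim
      fix z assume z: "norm (s z) \<le> norm (a z) + norm (b z)"
      have "norm (k z) = t z * norm (s z)" using t[of z] by (simp add: k_def norm_mult)
      also have "\<dots> \<le> t z * (norm (a z) + norm (b z))" using z t[of z] by (intro mult_left_mono)
      also have "\<dots> \<le> norm (a z)" by (simp add: t_def)
      finally show "norm (k z) \<le> norm (a z)" .
    qed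
    show "AE z in \<mu>. norm (k' z) \<le> norm (b z)" using le'
    proof eventually_elim
      fix z assume z: "norm (s z) \<le> norm (a z) + norm (b z)"
      have "norm (k' z) = t' z * norm (s z)" using t'[of z] by (simp add: k'_def norm_mult)
      also have "\<dots> \<le> t' z * (norm (a z) + norm (b z))" using z t'[of z] by (intro mult_left_mono)
      also have "\<dots> \<le> norm (b z)" by (simp add: t'_def)
      finally show "norm (k' z) \<le> norm (b z)" .
    qed
  qed
  finally show "ennreal (\<alpha> s) \<le> norm_ext \<alpha> a + norm_ext \<alpha> b" .
qed

end

section \<open>Harmonic polynomials\<close>

text \<open>On the circle these are the trigonometric polynomials. Written as p + cnj q they carry
  their harmonic extension with them, so that dilation is plain evaluation.\<close>

definition harmonic_polys :: "(complex \<Rightarrow> complex) set" where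
  "harmonic_polys = {\<lambda>z. poly p z + cnj (poly q z) | p q. True}"

lemma harmonicE:
  assumes "u \<in> harmonic_polys"
  obtains p q where "u = (\<lambda>z. poly p z + cnj (poly q z))"
  using assms by (auto simp: harmonic_polys_def)

lemma harmonicI: "(\<lambda>z. poly p z + cnj (poly q z)) \<in> harmonic_polys"
  unfolding harmonic_polys_def by blast

lemma harmonic_const: "(\<lambda>z. c) \<in> harmonic_polys"
  using harmonicI[of "[:c:]" 0] by simp

lemma harmonic_add:
  assumes "u \<in> harmonic_polys" "v \<in> harmonic_polys"
  shows "(\<lambda>z. u z + v z) \<in> harmonic_polys"
proof -
  obtain p q where u: "u = (\<lambda>z. poly p z + cnj (poly q z))" using assms(1) by (rule harmonicE)
  obtain p' q' where v: "v = (\<lambda>z. poly p' z + cnj (poly q' z))" using assms(2) by (rule harmonicE)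
  have "(\<lambda>z. u z + v z) = (\<lambda>z. poly (p + p') z + cnj (poly (q + q') z))"
    by (simp add: u v fun_eq_iff)
  thus ?thesis by (simp only: harmonicI)
qed

lemma harmonic_scale:
  assumes "u \<in> harmonic_polys"
  shows "(\<lambda>z. c * u z) \<in> harmonic_polys"
proof -
  obtain p q where u: "u = (\<lambda>z. poly p z + cnj (poly q z))" using assms by (rule harmonicE)
  have "(\<lambda>z. c * u z) = (\<lambda>z. poly (smult c p) z + cnj (poly (smult (cnj c) q) z))"
    by (simp add: u fun_eq_iff algebra_simps)
  thus ?thesis by (simp only: harmonicI)
qed

lemma harmonic_diff:
  "u \<in> harmonic_polys \<Longrightarrow> v \<in> harmonic_polys \<Longrightarrow> (\<lambda>z. u z - v z) \<in> harmonic_polys"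
  using harmonic_add[of u "\<lambda>z. (-1) * v z"] harmonic_scale[of v "-1"] by simp

lemma harmonic_continuous: "u \<in> harmonic_polys \<Longrightarrow> continuous_on S u"
  by (erule harmonicE) (auto intro!: continuous_intros)

lemma harmonic_Linf: "u \<in> harmonic_polys \<Longrightarrow> u \<in> Linf_circle"
  by (intro Linf_continuous harmonic_continuous)

lemma poisson_harmonic:
  fixes u :: "complex \<Rightarrow> complex"
  assumes "u \<in> harmonic_polys" and a: "norm a < 1"
  shows "(LINT w|\<mu>. poisson a w * u w) = u a"
proof -
  obtain p q where u: "u = (\<lambda>z. poly p z + cnj (poly q z))" using assms(1) by (rule harmonicE)
  have hol: "poly p holomorphic_on cball 0 1" for p :: "complex poly" by (intro holomorphic_intros)
  have int: "integrable \<mu> (\<lambda>w. poisson a w * poly p w)" for p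
    by (intro integrable_circle_continuous continuous_intros continuous_on_poisson a)
  have int': "integrable \<mu> (\<lambda>w. cnj (poisson a w * poly p w))" for p
    by (intro integrable_circle_continuous continuous_intros continuous_on_poisson a)
  have "(LINT w|\<mu>. poisson a w * u w) =
    (LINT w|\<mu>. poisson a w * poly p w + cnj (poisson a w * poly q w))"
    by (simp add: u algebra_simps)
  also have "\<dots> = (LINT w|\<mu>. poisson a w * poly p w) + (LINT w|\<mu>. cnj (poisson a w * poly q w))"
    by (intro Bochner_Integration.integral_add int int')
  also have "(LINT w|\<mu>. cnj (poisson a w * poly q w)) = cnj (LINT w|\<mu>. poisson a w * poly q w)"
    by (rule Bochner_Integration.integral_cnj[of \<mu> "\<lambda>w. poisson a w * poly q w"])
  finally show ?thesis by (simp add: poisson_holomorphic[OF hol a] u)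
qed

lemma integral_harmonic:
  fixes u :: "complex \<Rightarrow> complex"
  assumes "u \<in> harmonic_polys"
  shows "(LINT w|\<mu>. u w) = u 0"
proof -
  have "(LINT w|\<mu>. u w) = (LINT w|\<mu>. poisson 0 w * u w)"
    by (intro Bochner_Integration.integral_cong) (auto simp: poisson_def)
  thus ?thesis using poisson_harmonic[OF assms, of 0] by simp
qed

section \<open>Exact mean values over roots of unity\<close>

lemma sum_roots_of_unity_power:
  assumes "0 < m" "m < N"
  shows "(\<Sum>j<N. cis (2 * pi * real j / real N) ^ m) = 0"
proof -
  define \<omega> where "\<omega> = cis (2 * pi * real m / real N)"
  have N: "0 < N" using assms by simp
  have "\<omega> \<noteq> 1"
  proof
    assume "\<omega> = 1"
    hence "cos (2 * pi * real m / real N) = 1" by (simp add: \<omega>_def complex_eq_iff)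
    then obtain n :: int where "2 * pi * real m / real N = real_of_int n * 2 * pi"
      by (auto simp: cos_one_2pi_int)
    hence "real_of_int (int m) = real_of_int (n * int N)" using N by (simp add: field_simps)
    hence "int m = n * int N" by (simp only: of_int_eq_iff)
    hence "int N dvd int m" by simp
    hence "N dvd m" by simp
    thus False using assms by (auto dest: dvd_imp_le)
  qed
  moreover have "\<omega> ^ N = 1"
  proof -
    have "\<omega> ^ N = cis (real N * (2 * pi * real m / real N))" unfolding \<omega>_def by (rule Complex.DeMoivre)
    also have "real N * (2 * pi * real m / real N) = 2 * pi * real m" using N by simp
    also have "cis (2 * pi * real m) = 1" by (rule cis_multiple_2pi) simp
    finally show ?thesis .
  qed
  moreover have "(\<Sum>j<N. cis (2 * pi * real j / real N) ^ m) = (\<Sum>j<N. \<omega> ^ j)"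
    by (intro sum.cong refl) (simp add: \<omega>_def Complex.DeMoivre mult_ac)
  ultimately show ?thesis by (simp add: geometric_sum)
qed

text \<open>As a polynomial in w, p (x + w y) has degree below N, so summation over the N-th roots
  of unity annihilates every term but the constant one.\<close>

lemma polynomial_discrete_mean_value:
  fixes p :: "complex poly"
  assumes "degree p < N"
  shows "(\<Sum>j<N. poly p (x + cis (2 * pi * real j / real N) * y)) = of_nat N * poly p x"
proof -
  define q where "q = pcompose p [:x, y:]"
  have qp: "poly q w = poly p (x + w * y)" for w by (simp add: q_def poly_pcompose)
  have "degree q \<le> degree p * degree [:x, y:]" unfolding q_def by (rule degree_pcompose_le)
  also have "\<dots> \<le> degree p * 1" by (intro mult_left_mono) auto
  finally have dq: "degree q < N" using assms by simp
  have "(\<Sum>j<N. poly p (x + cis (2 * pi * real j / real N) * y)) =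
    (\<Sum>j<N. \<Sum>m\<le>degree q. coeff q m * cis (2 * pi * real j / real N) ^ m)"
    unfolding qp[symmetric] by (simp add: poly_altdef)
  also have "\<dots> = (\<Sum>m\<le>degree q. coeff q m * (\<Sum>j<N. cis (2 * pi * real j / real N) ^ m))"
    by (subst sum.swap) (simp add: sum_distrib_left)
  also have "\<dots> = (\<Sum>m\<le>degree q. if m = 0 then coeff q 0 * of_nat N else 0)"
    using dq by (intro sum.cong refl) (auto simp: sum_roots_of_unity_power)
  also have "\<dots> = of_nat N * poly q 0" by (simp add: poly_0_coeff_0)
  finally show ?thesis by (simp add: qp)
qed

text \<open>The same \<open>N\<close> works for all x and y. Thus a function u (\<zeta> z) of z is a
  finite average of functions u (w z) with one and the same family of points w for every z, to which
  the triangle inequality of a norm applies.\<close>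

lemma harmonic_discrete_mean_value:
  assumes "u \<in> harmonic_polys"
  shows "\<exists>N>0. \<forall>x y. (\<Sum>j<N. u (x + cis (2 * pi * real j / real N) * y)) = of_nat N * u x"
proof -
  obtain p q where u: "u = (\<lambda>z. poly p z + cnj (poly q z))" using assms by (rule harmonicE)
  define N where "N = Suc (max (degree p) (degree q))"
  have "degree p < N" "degree q < N" by (auto simp: N_def)
  note pq = polynomial_discrete_mean_value[OF this(1)] polynomial_discrete_mean_value[OF this(2)]
  have "(\<Sum>j<N. u (x + cis (2 * pi * real j / real N) * y)) = of_nat N * u x" for x y
    unfolding u by (simp only: sum.distrib cnj_sum[symmetric] pq) (simp add: algebra_simps)
  thus ?thesis by (intro exI[of _ N]) (auto simp: N_def)
qed

section \<open>Uniform density of harmonic polynomials\<close>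

text \<open>On the circle z cnj z = 1, so (a + z p) cnj q with q = b + z q' expands to a cnj q + cnj
  b z p + p cnj q'. The last term has shorter factors, and the others are conjugate-analytic and
  analytic. Hence trigonometric polynomials are closed under multiplication.\<close>

lemma poly_mult_cnj_harmonic:
  "\<exists>u\<in>harmonic_polys. \<forall>z\<in>sphere 0 1. poly p z * cnj (poly q z) = u z"
proof (induction p arbitrary: q)
  case 0
  show ?case by (intro bexI[of _ "\<lambda>z. 0"] harmonic_const) simp
next
  case (pCons a p)
  obtain b q' where q: "q = pCons b q'" by (cases q)
  obtain u where u: "u \<in> harmonic_polys" "\<forall>z\<in>sphere 0 1. poly p z * cnj (poly q' z) = u z"
    using pCons.IH by blast
  define v where "v z = poly (smult (cnj b) (pCons 0 p)) z + cnj (poly (smult (cnj a) q) z) + u z" for z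
  have "v \<in> harmonic_polys"
    unfolding v_def[abs_def] by (intro harmonic_add[OF harmonicI u(1)])
  moreover have "poly (pCons a p) z * cnj (poly q z) = v z" if "z \<in> sphere 0 1" for z
  proof -
    have z1: "z * cnj z = 1" using that complex_norm_square[of z] by simp
    have "(z * poly p z) * (cnj z * cnj (poly q' z)) = (z * cnj z) * (poly p z * cnj (poly q' z))"
      by (simp add: mult_ac)
    also have "\<dots> = u z" unfolding z1 using u(2) that by simp
    finally show ?thesis by (simp add: v_def q algebra_simps)
  qed
  ultimately show ?case by blast
qed

text \<open>This translates what Stone-Weierstrass provides into harmonic polynomials. The induction
  follows the generation of polynomial functions; only products use that z is on the circle, through
  the two mixed terms p cnj q' and p' cnj q.\<close>

lemma real_polynomial_function_harmonic:
  assumes "real_polynomial_function (g :: complex \<Rightarrow> real)"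
  shows "\<exists>u\<in>harmonic_polys. \<forall>z\<in>sphere 0 1. complex_of_real (g z) = u z"
  using assms
proof induction
  case (linear f)
  interpret f: bounded_linear f by fact
  \<comment> \<open>A real-linear functional on the plane is f z = 2 Re (c z) for exactly this
    c.\<close>
  define c where "c = (complex_of_real (f 1) - \<i> * complex_of_real (f \<i>)) / 2"
  have "complex_of_real (f z) = poly [:0, c:] z + cnj (poly [:0, c:] z)" for z
  proof -
    have "z = Re z *\<^sub>R 1 + Im z *\<^sub>R \<i>" by (simp add: complex_eq_iff)
    hence "f z = f (Re z *\<^sub>R 1 + Im z *\<^sub>R \<i>)" by simp
    also have "\<dots> = Re z * f 1 + Im z * f \<i>" by (simp only: f.add f.scaleR real_scaleR_def)
    finally show ?thesis by (simp add: c_def complex_eq_iff field_simps)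
  qed
  thus ?case by (intro bexI[OF _ harmonicI[of "[:0, c:]" "[:0, c:]"]]) blast
next
  case (const c)
  show ?case by (intro bexI[OF _ harmonic_const[of "of_real c"]]) simp
next
  case (add f g)
  then obtain u v where "u \<in> harmonic_polys" "\<forall>z\<in>sphere 0 1. complex_of_real (f z) = u z"
    "v \<in> harmonic_polys" "\<forall>z\<in>sphere 0 1. complex_of_real (g z) = v z" by blast
  thus ?case by (intro bexI[OF _ harmonic_add[of u v]]) auto
next
  case (mult f g)
  obtain u where u: "u \<in> harmonic_polys" "\<forall>z\<in>sphere 0 1. complex_of_real (f z) = u z" using mult.IH by blast
  obtain v where v: "v \<in> harmonic_polys" "\<forall>z\<in>sphere 0 1. complex_of_real (g z) = v z" using mult.IH by blast
  obtain p q where pq: "u = (\<lambda>z. poly p z + cnj (poly q z))" using u(1) by (rule harmonicE)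
  obtain p' q' where pq': "v = (\<lambda>z. poly p' z + cnj (poly q' z))" using v(1) by (rule harmonicE)
  obtain s where s: "s \<in> harmonic_polys" "\<forall>z\<in>sphere 0 1. poly p z * cnj (poly q' z) = s z"
    using poly_mult_cnj_harmonic by blast
  obtain t where t: "t \<in> harmonic_polys" "\<forall>z\<in>sphere 0 1. poly p' z * cnj (poly q z) = t z"
    using poly_mult_cnj_harmonic by blast
  define w where "w z = (poly (p * p') z + cnj (poly (q * q') z)) + (s z + t z)" for z
  have "w \<in> harmonic_polys"
    unfolding w_def[abs_def] by (intro harmonic_add[OF harmonicI] harmonic_add s t)
  moreover have "complex_of_real (f z * g z) = w z" if "z \<in> sphere 0 1" for z
  proof -
    have "complex_of_real (f z * g z) = u z * v z" using u(2) v(2) that by simp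
    also have "\<dots> = w z"
      unfolding w_def s(2)[rule_format, OF that, symmetric] t(2)[rule_format, OF that, symmetric] pq pq'
      by (simp add: algebra_simps)
    finally show ?thesis .
  qed
  ultimately show ?case by blast
qed

lemma harmonic_uniformly_dense:
  fixes v :: "complex \<Rightarrow> complex"
  assumes v: "continuous_on (sphere 0 1) v" and e: "0 < e"
  shows "\<exists>u\<in>harmonic_polys. \<forall>z\<in>sphere 0 1. norm (v z - u z) < e"
proof -
  have *: "\<exists>u\<in>harmonic_polys. \<forall>z\<in>sphere 0 1. norm (complex_of_real (g z) - u z) < e / 2"
    if g: "continuous_on (sphere 0 1) g" for g :: "complex \<Rightarrow> real"
  proof -
    obtain h where h: "real_polynomial_function h" "\<And>z. z \<in> sphere 0 1 \<Longrightarrow> \<bar>g z - h z\<bar> < e / 2"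
      using Stone_Weierstrass_real_polynomial_function[OF compact_sphere g, of "e/2"] e by auto
    obtain u where "u \<in> harmonic_polys" "\<forall>z\<in>sphere 0 1. complex_of_real (h z) = u z"
      using real_polynomial_function_harmonic[OF h(1)] by blast
    moreover have "norm (complex_of_real (g z) - complex_of_real (h z)) < e / 2" if "z \<in> sphere 0 1" for z
      using h(2)[OF that] by (simp flip: of_real_diff)
    ultimately show ?thesis by (intro bexI[of _ u]) auto
  qed
  obtain u1 where u1: "u1 \<in> harmonic_polys" "\<forall>z\<in>sphere 0 1. norm (complex_of_real (Re (v z)) - u1 z) < e / 2"
    using *[OF continuous_on_Re[OF v]] by blast
  obtain u2 where u2: "u2 \<in> harmonic_polys" "\<forall>z\<in>sphere 0 1. norm (complex_of_real (Im (v z)) - u2 z) < e / 2"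
    using *[OF continuous_on_Im[OF v]] by blast
  have "norm (v z - (u1 z + \<i> * u2 z)) < e" if z: "z \<in> sphere 0 1" for z
  proof -
    have "v z - (u1 z + \<i> * u2 z) = (complex_of_real (Re (v z)) - u1 z) + \<i> * (complex_of_real (Im (v z)) - u2 z)"
      by (simp add: complex_eq_iff)
    hence "norm (v z - (u1 z + \<i> * u2 z)) \<le> norm (complex_of_real (Re (v z)) - u1 z) + norm (\<i> * (complex_of_real (Im (v z)) - u2 z))"
      by (simp only: norm_triangle_ineq)
    also have "\<dots> = norm (complex_of_real (Re (v z)) - u1 z) + norm (complex_of_real (Im (v z)) - u2 z)"
      by (simp add: norm_mult)
    also have "\<dots> < e / 2 + e / 2" using u1(2) u2(2) z by (intro add_strict_mono) auto
    finally show ?thesis by simp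
  qed
  thus ?thesis
    by (intro bexI[of _ "\<lambda>z. u1 z + \<i> * u2 z"] harmonic_add harmonic_scale u1 u2) blast
qed

context rotsym_norm
begin

text \<open>The map sending \<open>\<zeta>\<close> to \<open>z \<mapsto> u (\<zeta> z)\<close> is a harmonic polynomial with values in functions on
  the circle, so its norm obeys a maximum principle on the disc; by rotation invariance this norm
  is constant on the unit circle.\<close>

lemma dilate_le:
  assumes u: "u \<in> harmonic_polys" and r: "0 \<le> r" "r \<le> 1"
  shows "\<alpha> (dilate u r) \<le> \<alpha> u"
proof -
  define U where "U \<zeta> z = u (\<zeta> * z)" for \<zeta> z
  define \<phi> where "\<phi> \<zeta> = \<alpha> (U \<zeta>)" for \<zeta>
  have cu: "continuous_on S u" for S by (rule harmonic_continuous[OF u])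
  have UL: "U \<zeta> \<in> Linf_circle" for \<zeta>
    unfolding U_def[abs_def]
    by (intro Linf_continuous continuous_on_compose2[OF cu[of UNIV]] continuous_intros) auto
  have uc: "uniformly_continuous_on (cball 0 1) u"
    by (intro compact_uniformly_continuous cu) simp
  have cont: "continuous_on (cball 0 1) \<phi>"
  proof (rule continuous_onI)
    fix \<zeta> :: complex and e :: real assume \<zeta>: "\<zeta> \<in> cball 0 1" and e: "0 < e"
    obtain d where d: "0 < d"
      "\<And>x y. x \<in> cball 0 1 \<Longrightarrow> y \<in> cball 0 1 \<Longrightarrow> dist y x < d \<Longrightarrow> dist (u y) (u x) < e"
      using uc e unfolding uniformly_continuous_on_def by metis
    have "dist (\<phi> \<zeta>') (\<phi> \<zeta>) \<le> e" if \<zeta>': "\<zeta>' \<in> cball 0 1" "dist \<zeta>' \<zeta> < d" for \<zeta>'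
    proof -
      have near: "norm (U \<zeta>' z - U \<zeta> z) \<le> e" if z: "norm z = 1" for z
      proof -
        have "dist (\<zeta>' * z) (\<zeta> * z) = dist \<zeta>' \<zeta>"
          using z by (simp add: dist_norm norm_mult flip: left_diff_distrib)
        thus ?thesis using d(2)[of "\<zeta> * z" "\<zeta>' * z"] \<zeta> \<zeta>' z
          by (simp add: U_def norm_mult dist_norm)
      qed
      have "\<alpha> (\<lambda>z. U \<zeta>' z - U \<zeta> z) \<le> e"
        using near e by (intro le_bound Linf_diff UL AE_I2) auto
      moreover have "\<alpha> (\<lambda>z. U \<zeta> z - U \<zeta>' z) = \<alpha> (\<lambda>z. U \<zeta>' z - U \<zeta> z)" by (intro diff_commute UL)
      ultimately show ?thesis
        using triangle_diff[OF UL UL, of \<zeta> \<zeta>'] triangle_diff[OF UL UL, of \<zeta>' \<zeta>]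
        by (simp add: \<phi>_def dist_real_def abs_le_iff)
    qed
    thus "\<exists>d>0. \<forall>x'\<in>cball 0 1. dist x' \<zeta> < d \<longrightarrow> dist (\<phi> x') (\<phi> \<zeta>) \<le> e" using d(1) by blast
  qed
  have circ: "\<phi> \<zeta> = \<alpha> u" if "norm \<zeta> = 1" for \<zeta>
    using rotate[OF harmonic_Linf[OF u], of "cnj \<zeta>"] that by (simp add: \<phi>_def U_def[abs_def])
  obtain \<zeta> where \<zeta>: "\<zeta> \<in> cball 0 1" and max: "\<forall>y\<in>cball 0 1. \<phi> y \<le> \<phi> \<zeta>"
    using continuous_attains_sup[OF compact_cball _ cont] by auto
  have "\<phi> \<zeta> \<le> \<alpha> u"
  proof -
    \<comment> \<open>The circle about \<zeta> of radius \<rho> = 1 - |\<zeta>| touches the unit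
      circle from inside at b. Its sample points \<open>w j\<close> stay in the closed disc, and
      \<open>w 0\<close> is b. For \<zeta> = 0 any unimodular b serves.\<close>
    define b where "b = (if \<zeta> = 0 then 1 else sgn \<zeta>)"
    have b: "norm b = 1" by (simp add: b_def norm_sgn)
    have \<zeta>b: "\<zeta> = of_real (norm \<zeta>) * b" by (simp add: b_def sgn_eq)
    define \<rho> where "\<rho> = 1 - norm \<zeta>"
    have \<rho>: "0 \<le> \<rho>" using \<zeta> by (simp add: \<rho>_def)
    obtain N where N: "0 < N" "\<And>x y. (\<Sum>j<N. u (x + cis (2 * pi * real j / real N) * y)) = of_nat N * u x"
      using harmonic_discrete_mean_value[OF u] by blast
    define w where "w j = \<zeta> + cis (2 * pi * real j / real N) * (of_real \<rho> * b)" for j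
    have wb: "w j \<in> cball 0 1" for j
    proof -
      have "norm (w j) \<le> norm \<zeta> + norm (cis (2 * pi * real j / real N) * (of_real \<rho> * b))"
        unfolding w_def by (rule norm_triangle_ineq)
      also have "\<dots> = 1" using b \<rho> by (simp only: norm_mult norm_cis norm_of_real) (simp add: \<rho>_def)
      finally show ?thesis by simp
    qed
    have w0: "norm (w 0) = 1"
    proof -
      have "w 0 = of_real (norm \<zeta>) * b + of_real \<rho> * b" using \<zeta>b by (simp add: w_def)
      also have "\<dots> = b" by (simp add: \<rho>_def flip: distrib_right)
      finally show ?thesis using b by simp
    qed
    have sumL: "(\<lambda>z. \<Sum>j\<in>J. U (w j) z) \<in> Linf_circle \<and> \<alpha> (\<lambda>z. \<Sum>j\<in>J. U (w j) z) \<le> (\<Sum>j\<in>J. \<phi> (w j))"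
      if "finite J" for J
      using that
    proof induction
      case empty
      show ?case by (simp add: const)
    next
      case (insert j J)
      have "\<alpha> (\<lambda>z. U (w j) z + (\<Sum>j\<in>J. U (w j) z)) \<le> \<phi> (w j) + \<alpha> (\<lambda>z. \<Sum>j\<in>J. U (w j) z)"
        unfolding \<phi>_def using insert.IH by (intro triangle UL) auto
      thus ?case using insert Linf_add[OF UL[of "w j"], of "\<lambda>z. \<Sum>j\<in>J. U (w j) z"] by simp
    qed
    have "U \<zeta> = (\<lambda>z. (1 / of_nat N) * (\<Sum>j<N. U (w j) z))"
    proof
      fix z
      have "(\<Sum>j<N. U (w j) z) = (\<Sum>j<N. u (\<zeta> * z + cis (2 * pi * real j / real N) * (of_real \<rho> * b * z)))"
        by (simp add: U_def w_def algebra_simps)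
      also have "\<dots> = of_nat N * u (\<zeta> * z)" by (rule N(2))
      finally show "U \<zeta> z = (1 / of_nat N) * (\<Sum>j<N. U (w j) z)" using N(1) by (simp add: U_def)
    qed
    hence "\<phi> \<zeta> = \<alpha> (\<lambda>z. (1 / of_nat N) * (\<Sum>j<N. U (w j) z))" by (simp only: \<phi>_def)
    also have "\<dots> = 1 / real N * \<alpha> (\<lambda>z. \<Sum>j<N. U (w j) z)"
      using sumL[of "{..<N}"] by (subst scale) (auto simp: norm_divide)
    also have "\<dots> \<le> 1 / real N * (\<Sum>j<N. \<phi> (w j))"
      using sumL[of "{..<N}"] by (intro mult_left_mono) auto
    \<comment> \<open>At the maximum point \<zeta>, all samples but \<open>w 0\<close> are bounded
      by \<phi> \<zeta> itself. Cancelling N - 1 copies leaves \<phi> \<zeta> \<le> \<phi> (w 0), a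
      value on the unit circle, so a single averaging step reaches the boundary.\<close>
    finally have "real N * \<phi> \<zeta> \<le> (\<Sum>j<N. \<phi> (w j))" using N(1) by (simp add: field_simps)
    also have "\<dots> = \<phi> (w 0) + (\<Sum>j\<in>{..<N} - {0}. \<phi> (w j))"
      using N(1) by (subst sum.remove[of _ 0]) auto
    also have "(\<Sum>j\<in>{..<N} - {0}. \<phi> (w j)) \<le> (\<Sum>j\<in>{..<N} - {0}. \<phi> \<zeta>)"
      using max wb by (intro sum_mono) blast
    also have "\<dots> = (real N - 1) * \<phi> \<zeta>" using N(1) by (simp add: of_nat_diff)
    finally show ?thesis using circ[OF w0] by (simp add: algebra_simps)
  qed
  moreover have "\<phi> (of_real r) \<le> \<phi> \<zeta>" using max r by simp
  ultimately show ?thesis by (simp add: \<phi>_def U_def[abs_def] dilate_def)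
qed

text \<open>Dilation to radius 0 turns u into the constant u 0, which is the mean of u; the claim is
  contractivity in this extreme case.\<close>

lemma integral_harmonic_le:
  assumes "u \<in> harmonic_polys"
  shows "norm (LINT z|\<mu>. u z) \<le> \<alpha> u"
proof -
  have "norm (u 0) = \<alpha> (dilate u 0)" by (simp add: dilate_def const)
  also have "\<dots> \<le> \<alpha> u" by (rule dilate_le[OF assms]) auto
  finally show ?thesis by (simp add: integral_harmonic[OF assms])
qed

end

section \<open>Strong continuity\<close>

locale strongly_continuous_rotsym_norm = rotsym_norm +
  assumes strongly_continuous: "strongly_continuous_norm \<alpha>"
begin

lemma L_space_eq: "L_space \<alpha> = script_L \<alpha>"
  using strongly_continuous by (simp add: strongly_continuous_norm_def)

text \<open>Extends the smallness condition to null sets, whose indicators have norm 0.\<close>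

lemma indicator_small:
  assumes "0 < e"
  shows "\<exists>\<delta>>0. \<forall>E\<in>sets \<mu>. measure \<mu> E < \<delta> \<longrightarrow> \<alpha> (indicator E) < e"
proof -
  obtain \<delta> where \<delta>: "0 < \<delta>" "\<forall>E\<in>sets \<mu>.
    0 < measure \<mu> E \<and> measure \<mu> E < \<delta> \<longrightarrow> \<alpha> (indicator E) < e"
    using strongly_continuous assms unfolding strongly_continuous_norm_def by blast
  have "\<alpha> (indicator E) < e" if E: "E \<in> sets \<mu>" "measure \<mu> E < \<delta>" for E
  proof (cases "measure \<mu> E = 0")
    case True
    hence "E \<in> null_sets \<mu>" using E by (intro null_setsI) (auto simp: circle.emeasure_eq_measure)
    hence "AE z in \<mu>. z \<notin> E" by (rule AE_not_in)
    hence "AE z in \<mu>. indicator E z = (0::complex)" by eventually_elim simp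
    hence "\<alpha> (indicator E) = 0" using E by (subst zero_iff) auto
    thus ?thesis using assms by simp
  next
    case False
    hence "0 < measure \<mu> E" by (simp add: zero_less_measure_iff)
    thus ?thesis using \<delta>(2) E by blast
  qed
  thus ?thesis using \<delta>(1) by blast
qed

text \<open>Approximation is carried out for \<open>\<alpha>\<close> and the \<open>L\<^sup>1\<close> norm simultaneously, because
  the comparison of the two norms is itself deduced from it.\<close>

definition \<beta> :: "(complex \<Rightarrow> complex) \<Rightarrow> real" where
  "\<beta> h = \<alpha> h + (LINT z|\<mu>. norm (h z))"

lemma \<beta>_triangle:
  assumes "g \<in> Linf_circle" "h \<in> Linf_circle"
  shows "\<beta> (\<lambda>z. g z + h z) \<le> \<beta> g + \<beta> h"
proof -
  have "(LINT z|\<mu>. norm (g z + h z)) \<le> (LINT z|\<mu>. norm (g z) + norm (h z))"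
    using assms by (intro integral_mono norm_triangle_ineq integrable_norm Bochner_Integration.integrable_add
      Linf_integrable)
  also have "\<dots> = (LINT z|\<mu>. norm (g z)) + (LINT z|\<mu>. norm (h z))"
    using assms by (intro Bochner_Integration.integral_add integrable_norm Linf_integrable)
  finally show ?thesis using triangle[OF assms] by (simp add: \<beta>_def)
qed

lemma \<beta>_scale: "h \<in> Linf_circle \<Longrightarrow> \<beta> (\<lambda>z. c * h z) = norm c * \<beta> h"
  by (simp add: \<beta>_def scale norm_mult algebra_simps)

lemma \<beta>_le:
  assumes "h \<in> Linf_circle" "AE z in \<mu>. norm (h z) \<le> C" "0 \<le> C"
  shows "\<beta> h \<le> 2 * C"
proof -
  have "(LINT z|\<mu>. norm (h z)) \<le> (LINT z|\<mu>. C)"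
    using assms by (intro integral_mono_AE integrable_norm Linf_integrable) auto
  thus ?thesis using le_bound[OF assms] by (simp add: \<beta>_def)
qed

lemma \<beta>_mono:
  assumes "g \<in> Linf_circle" "h \<in> Linf_circle" "AE z in \<mu>. norm (g z) \<le> norm (h z)"
  shows "\<beta> g \<le> \<beta> h"
proof -
  have "(LINT z|\<mu>. norm (g z)) \<le> (LINT z|\<mu>. norm (h z))"
    using assms by (intro integral_mono_AE integrable_norm Linf_integrable) auto
  thus ?thesis using mono[OF assms] by (simp add: \<beta>_def)
qed

lemma \<beta>_indicator_small:
  assumes "0 < e"
  shows "\<exists>\<delta>>0. \<forall>E\<in>sets \<mu>. measure \<mu> E < \<delta> \<longrightarrow> \<beta> (indicator E) < e"
proof -
  obtain \<delta> where \<delta>: "0 < \<delta>" "\<forall>E\<in>sets \<mu>. measure \<mu> E < \<delta> \<longrightarrow> \<alpha> (indicator E) < e / 2"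
    using indicator_small[of "e/2"] assms by auto
  have "\<beta> (indicator E) < e" if E: "E \<in> sets \<mu>" "measure \<mu> E < min \<delta> (e / 2)" for E
  proof -
    have "E \<subseteq> space \<mu>" by (rule sets.sets_into_space[OF E(1)])
    hence "E \<inter> sphere 0 1 = E" by auto
    moreover have "(LINT z|\<mu>. norm (indicator E z :: complex)) = (LINT z|\<mu>. indicator E z)"
      by (intro Bochner_Integration.integral_cong) (auto simp: indicator_def)
    ultimately have "(LINT z|\<mu>. norm (indicator E z :: complex)) = measure \<mu> E" by simp
    moreover have "\<alpha> (indicator E) < e / 2" using \<delta>(2) E by simp
    ultimately show ?thesis using E(2) by (simp add: \<beta>_def)
  qed
  thus ?thesis using \<delta>(1) assms by (intro exI[of _ "min \<delta> (e/2)"]) auto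
qed

section \<open>Density of harmonic polynomials in both norms\<close>

definition approximable :: "(complex \<Rightarrow> complex) \<Rightarrow> bool" where
  "approximable h \<longleftrightarrow> h \<in> Linf_circle \<and>
     (\<forall>e>0. \<exists>u\<in>harmonic_polys. \<beta> (\<lambda>z. h z - u z) < e)"

lemma approximable_limit:
  assumes h: "h \<in> Linf_circle" and "\<And>e. 0 < e \<Longrightarrow> \<exists>g. approximable g \<and> \<beta> (\<lambda>z. h z - g z) < e"
  shows "approximable h"
  unfolding approximable_def
proof (intro conjI h allI impI)
  fix e :: real assume e: "0 < e"
  obtain g where g: "approximable g" "\<beta> (\<lambda>z. h z - g z) < e / 2" using assms(2)[of "e/2"] e by auto
  obtain u where u: "u \<in> harmonic_polys" "\<beta> (\<lambda>z. g z - u z) < e / 2"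
    using g(1) e unfolding approximable_def by (meson half_gt_zero)
  have "\<beta> (\<lambda>z. (h z - g z) + (g z - u z)) \<le> \<beta> (\<lambda>z. h z - g z) + \<beta> (\<lambda>z. g z - u z)"
    using h g(1) harmonic_Linf[OF u(1)]
    by (intro \<beta>_triangle) (auto simp: approximable_def)
  hence "\<beta> (\<lambda>z. h z - u z) < e" using g(2) u(2) by simp
  thus "\<exists>u\<in>harmonic_polys. \<beta> (\<lambda>z. h z - u z) < e" using u(1) by blast
qed

lemma approximable_add:
  assumes g: "approximable g" and h: "approximable h"
  shows "approximable (\<lambda>z. g z + h z)"
  unfolding approximable_def
proof (intro conjI allI impI)
  have L: "g \<in> Linf_circle" "h \<in> Linf_circle" using g h by (auto simp: approximable_def)
  thus "(\<lambda>z. g z + h z) \<in> Linf_circle" by (rule Linf_add)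
  fix e :: real assume e: "0 < e"
  obtain u where u: "u \<in> harmonic_polys" "\<beta> (\<lambda>z. g z - u z) < e / 2"
    using g e unfolding approximable_def by (meson half_gt_zero)
  obtain v where v: "v \<in> harmonic_polys" "\<beta> (\<lambda>z. h z - v z) < e / 2"
    using h e unfolding approximable_def by (meson half_gt_zero)
  have "\<beta> (\<lambda>z. (g z - u z) + (h z - v z)) \<le> \<beta> (\<lambda>z. g z - u z) + \<beta> (\<lambda>z. h z - v z)"
    by (intro \<beta>_triangle Linf_diff L harmonic_Linf u v)
  hence "\<beta> (\<lambda>z. (g z + h z) - (u z + v z)) < e" using u(2) v(2) by (simp add: algebra_simps)
  thus "\<exists>u\<in>harmonic_polys. \<beta> (\<lambda>z. (g z + h z) - u z) < e"
    by (intro bexI[of _ "\<lambda>z. u z + v z"] harmonic_add u v)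
qed

lemma approximable_scale:
  assumes h: "approximable h"
  shows "approximable (\<lambda>z. c * h z)"
  unfolding approximable_def
proof (intro conjI allI impI)
  have L: "h \<in> Linf_circle" using h by (auto simp: approximable_def)
  show "(\<lambda>z. c * h z) \<in> Linf_circle" by (intro Linf_mult L Linf_const)
  fix e :: real assume e: "0 < e"
  have c: "0 < norm c + 1" by (simp add: add_nonneg_pos)
  hence "0 < e / (norm c + 1)" using e by simp
  then obtain u where u: "u \<in> harmonic_polys" "\<beta> (\<lambda>z. h z - u z) < e / (norm c + 1)"
    using h unfolding approximable_def by blast
  have "\<beta> (\<lambda>z. c * (h z - u z)) = norm c * \<beta> (\<lambda>z. h z - u z)"
    by (intro \<beta>_scale Linf_diff L harmonic_Linf u)
  also have "\<dots> \<le> norm c * (e / (norm c + 1))" using u(2) by (intro mult_left_mono) auto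
  also have "\<dots> < e" using c e by (simp add: field_simps)
  finally have "\<beta> (\<lambda>z. c * h z - c * u z) < e" by (simp add: right_diff_distrib)
  thus "\<exists>u\<in>harmonic_polys. \<beta> (\<lambda>z. c * h z - u z) < e"
    by (intro bexI[of _ "\<lambda>z. c * u z"] harmonic_scale u)
qed

lemma approximable_continuous:
  assumes h: "continuous_on (sphere 0 1) h"
  shows "approximable h"
  unfolding approximable_def
proof (intro conjI allI impI)
  show L: "h \<in> Linf_circle" by (rule Linf_continuous[OF h])
  fix e :: real assume e: "0 < e"
  obtain u where u: "u \<in> harmonic_polys" "\<forall>z\<in>sphere 0 1. norm (h z - u z) < e / 3"
    using harmonic_uniformly_dense[OF h, of "e/3"] e by auto
  have "\<beta> (\<lambda>z. h z - u z) \<le> 2 * (e / 3)"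
    using u(2) e by (intro \<beta>_le Linf_diff L harmonic_Linf u(1) AE_I2) (auto intro: less_imp_le)
  thus "\<exists>u\<in>harmonic_polys. \<beta> (\<lambda>z. h z - u z) < e" using u(1) e by (intro bexI[of _ u]) auto
qed

text \<open>The continuous tents max 0 (1 - n dist(z, K)) differ from the indicator only on the
  collar 0 < dist(z, K) < 1/n, by at most 1. The collars decrease to the empty set, so their
  measures, and with them the \<beta>-norms of their indicators, tend to 0. The empty K is separate
  because \<open>infdist\<close> to the empty set is 0.\<close>

lemma approximable_indicator_compact:
  assumes K: "compact K" "K \<subseteq> sphere 0 1"
  shows "approximable (indicator K)"
proof (cases "K = {}")
  case True
  have "indicator K = (\<lambda>z::complex. 0::complex)" using True by (simp add: fun_eq_iff)
  thus ?thesis using approximable_continuous[of "\<lambda>z. 0"] by simp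
next
  case False
  have closed: "closed K" using K(1) by (rule compact_imp_closed)
  have Ks: "K \<in> sets \<mu>"
    using sphere_Int_sets[of K] closed K(2) by (simp add: Int_absorb1)
  define A where "A n = sphere 0 1 \<inter> {z. 0 < infdist z K \<and> real n * infdist z K < 1}" for n
  have As: "A n \<in> sets \<mu>" for n
  proof -
    have "open ({z. 0 < infdist z K} \<inter> {z. real n * infdist z K < 1})"
      by (intro open_Int open_Collect_less continuous_intros)
    moreover have "{z. 0 < infdist z K} \<inter> {z. real n * infdist z K < 1} =
      {z. 0 < infdist z K \<and> real n * infdist z K < 1}" by auto
    ultimately show ?thesis unfolding A_def by (intro sphere_Int_sets) simp
  qed
  have "decseq A"
    unfolding decseq_def A_def
    by (auto intro: le_less_trans[OF mult_right_mono[OF of_nat_mono infdist_nonneg]])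
  hence "(\<lambda>n. measure \<mu> (A n)) \<longlonglongrightarrow> measure \<mu> (\<Inter>n. A n)"
    using As by (intro circle.finite_Lim_measure_decseq) auto
  moreover have "(\<Inter>n. A n) = {}"
  proof -
    have False if "\<And>n. z \<in> A n" for z
    proof -
      have "0 < infdist z K" using that[of 0] by (simp add: A_def)
      then obtain n where "1 < real n * infdist z K" using ex_less_of_nat_mult by blast
      thus False using that[of n] by (simp add: A_def)
    qed
    thus ?thesis by blast
  qed
  ultimately have Alim: "(\<lambda>n. measure \<mu> (A n)) \<longlonglongrightarrow> 0" by simp
  show ?thesis
  proof (rule approximable_limit)
    show "indicator K \<in> Linf_circle" by (rule Linf_indicator[OF Ks])
    fix e :: real assume "0 < e"
    then obtain \<delta> where \<delta>: "0 < \<delta>" "\<forall>E\<in>sets \<mu>. measure \<mu> E < \<delta> \<longrightarrow> \<beta> (indicator E) < e"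
      using \<beta>_indicator_small by blast
    from LIMSEQ_D[OF Alim \<delta>(1)] obtain n where n: "measure \<mu> (A n) < \<delta>" by auto
    define v where "v z = complex_of_real (max 0 (1 - real n * infdist z K))" for z
    have v: "approximable v"
      unfolding v_def[abs_def] by (intro approximable_continuous continuous_intros)
    have "\<beta> (\<lambda>z. indicator K z - v z) \<le> \<beta> (indicator (A n))"
    proof (intro \<beta>_mono Linf_diff Linf_indicator Ks As AE_I2)
      show "v \<in> Linf_circle" using v by (simp add: approximable_def)
      fix z assume z: "z \<in> space \<mu>"
      have "z \<in> K \<longleftrightarrow> infdist z K = 0" using in_closed_iff_infdist_zero[OF closed False] .
      moreover have "indicator K z - v z = complex_of_real (indicator K z - max 0 (1 - real n * infdist z K))"
        by (simp add: v_def indicator_def)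
      hence "norm (indicator K z - v z) = \<bar>indicator K z - max 0 (1 - real n * infdist z K)\<bar>"
        by (simp only: norm_of_real)
      ultimately show "norm (indicator K z - v z) \<le> norm (indicator (A n) z :: complex)"
        using z infdist_nonneg[of z K]
        by (auto simp: indicator_def A_def max_def not_less)
    qed
    also have "\<dots> < e" using \<delta>(2) As n by blast
    finally show "\<exists>g. approximable g \<and> \<beta> (\<lambda>z. indicator K z - g z) < e" using v by blast
  qed
qed

text \<open>By inner regularity E contains a compact K with E - K of small measure, hence of small
  \<beta>-norm.\<close>

lemma approximable_indicator:
  assumes E: "E \<in> sets \<mu>"
  shows "approximable (indicator E)"
proof (rule approximable_limit)
  show "indicator E \<in> Linf_circle" by (rule Linf_indicator[OF E])
  fix e :: real assume "0 < e"
  then obtain \<delta> where \<delta>: "0 < \<delta>" "\<forall>E\<in>sets \<mu>. measure \<mu> E < \<delta> \<longrightarrow> \<beta> (indicator E) < e"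
    using \<beta>_indicator_small by blast
  \<comment> \<open>Inner regularity concerns measures on the Borel sets of the whole plane, so
    \<mu> is pushed forward along the inclusion of the circle.\<close>
  define M where "M = distr \<mu> borel (\<lambda>z. z)"
  have id: "(\<lambda>z. z) \<in> measurable \<mu> (borel :: complex measure)"
    by (intro borel_measurable_circle_borel) simp
  have Em: "emeasure M B = emeasure \<mu> (B \<inter> sphere 0 1)" if "B \<in> sets borel" for B
    unfolding M_def using that by (subst emeasure_distr[OF id]) (auto simp: vimage_def Int_def)
  obtain B where "E = sphere 0 1 \<inter> B" "B \<in> sets borel" using E by (auto simp: sets_restrict_space)
  hence EB: "E \<in> sets borel" "E \<subseteq> sphere 0 1" by auto
  have Kfact: "K \<in> sets borel" "K \<inter> sphere 0 1 = K" "K \<in> sets \<mu>"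
    if "K \<subseteq> E" "compact K" for K
  proof -
    show K1: "K \<in> sets borel" using that(2) by (simp add: compact_imp_closed borel_closed)
    show K2: "K \<inter> sphere 0 1 = K" using that(1) EB(2) by blast
    show "K \<in> sets \<mu>"
      using sphere_Int_sets[OF K1] K2 by (simp add: Int_commute)
  qed
  have reg: "emeasure M E = (SUP K\<in>{K. K \<subseteq> E \<and> compact K}. emeasure M K)"
  proof (rule inner_regular)
    show "emeasure M (space M) \<noteq> \<infinity>" by (simp add: M_def emeasure_distr[OF id])
  qed (auto simp: M_def EB)
  have "\<exists>K. K \<subseteq> E \<and> compact K \<and> measure \<mu> E - \<delta> < measure \<mu> K"
  proof (rule ccontr)
    assume neg: "\<not> ?thesis"
    hence no: "measure \<mu> K \<le> measure \<mu> E - \<delta>" if "K \<subseteq> E" "compact K" for K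
      using that by (meson not_less)
    have "emeasure M E \<le> ennreal (measure \<mu> E - \<delta>)"
      unfolding reg
    proof (rule SUP_least)
      fix K assume "K \<in> {K. K \<subseteq> E \<and> compact K}"
      hence K: "K \<subseteq> E" "compact K" by auto
      show "emeasure M K \<le> ennreal (measure \<mu> E - \<delta>)"
        using no[OF K] Kfact[OF K] by (simp add: Em circle.emeasure_eq_measure ennreal_leI)
    qed
    moreover have "emeasure M E = ennreal (measure \<mu> E)"
      using EB by (simp add: Em circle.emeasure_eq_measure Int_absorb2)
    \<comment> \<open>The empty compact set shows that the difference is not truncated to 0 by
      \<open>ennreal\<close>, so the comparison with the measure of E is a comparison of
      reals.\<close>
    moreover have "0 \<le> measure \<mu> E - \<delta>" using no[of "{}"] by simp
    ultimately show False using \<delta>(1) by (simp add: ennreal_le_iff)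
  qed
  then obtain K where K: "K \<subseteq> E" "compact K" "measure \<mu> E - \<delta> < measure \<mu> K" by blast
  note Ks = Kfact(3)[OF K(1,2)]
  have EKs: "E - K \<in> sets \<mu>" by (rule sets.Diff[OF E Ks])
  have "measure \<mu> (E - K) = measure \<mu> E - measure \<mu> K"
    by (rule circle.finite_measure_Diff[OF E Ks K(1)])
  hence "\<beta> (indicator (E - K)) < e" using \<delta>(2) EKs K(3) by simp
  moreover have "(\<lambda>z. indicator E z - indicator K z) = (indicator (E - K) :: complex \<Rightarrow> complex)"
    using K(1) by (auto simp: fun_eq_iff indicator_def)
  ultimately have "\<beta> (\<lambda>z. indicator E z - indicator K z) < e" by simp
  thus "\<exists>g. approximable g \<and> \<beta> (\<lambda>z. indicator E z - g z) < e"
    using approximable_indicator_compact[OF K(2)] K(1) EB(2) by blast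
qed

lemma approximable_simple:
  assumes s: "simple_function \<mu> s"
  shows "approximable s"
proof -
  define E where "E y = s -` {y} \<inter> space \<mu>" for y
  have E: "E y \<in> sets \<mu>" for y unfolding E_def by (rule simple_functionD[OF s])
  have fin: "finite (s ` space \<mu>)" by (rule simple_functionD[OF s])
  have "approximable (\<lambda>z. \<Sum>y\<in>Y. y * indicator (E y) z)" if "finite Y" for Y
    using that
  proof induction
    case empty
    show ?case using approximable_continuous[of "\<lambda>z. 0"] by simp
  next
    case (insert y Y)
    have "approximable (\<lambda>z. y * indicator (E y) z)"
      by (rule approximable_scale[OF approximable_indicator[OF E]])
    from approximable_add[OF this insert.IH]
    have "approximable (\<lambda>z. y * indicator (E y) z + (\<Sum>x\<in>Y. x * indicator (E x) z))" .
    also have "(\<lambda>z. y * indicator (E y) z + (\<Sum>x\<in>Y. x * indicator (E x) z)) =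
      (\<lambda>z. \<Sum>x\<in>insert y Y. x * indicator (E x) z)"
      using insert.hyps by (intro ext) (rule sum.insert[symmetric])
    finally show ?case .
  qed
  from this[OF fin] have ap: "approximable (\<lambda>z. \<Sum>y\<in>s ` space \<mu>. y * indicator (E y) z)" .
  \<comment> \<open>This sum equals s on the circle only, its indicators being those of subsets of
    the circle. Since \<alpha> acts on functions on the plane, s is reached from t as a
    \<beta>-limit rather than by equality.\<close>
  define t where "t z = (\<Sum>y\<in>s ` space \<mu>. y * indicator (E y) z)" for z
  have t: "approximable t" using ap by (simp only: t_def[abs_def])
  have eq: "s z = t z" if z: "z \<in> space \<mu>" for z
  proof -
    have "t z = (\<Sum>y\<in>s ` space \<mu>. if y = s z then y else 0)"
      unfolding t_def using z by (intro sum.cong refl) (auto simp: E_def indicator_def)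
    also have "\<dots> = s z" using fin z by (subst sum.delta) auto
    finally show ?thesis by simp
  qed
  have sL: "s \<in> Linf_circle" by (rule Linf_simple[OF s])
  have tL: "t \<in> Linf_circle" using t by (simp only: approximable_def)
  show ?thesis
  proof (rule approximable_limit[OF sL])
    fix e :: real assume e: "0 < e"
    have "\<beta> (\<lambda>z. s z - t z) \<le> 2 * 0"
      by (rule \<beta>_le[OF Linf_diff[OF sL tL] AE_I2]) (simp_all add: eq)
    hence "\<beta> (\<lambda>z. s z - t z) < e" using e by simp
    with t show "\<exists>g. approximable g \<and> \<beta> (\<lambda>z. s z - g z) < e" by blast
  qed
qed

lemma approximable_Linf:
  assumes h: "h \<in> Linf_circle"
  shows "approximable h"
proof (rule approximable_limit[OF h])
  fix e :: real assume e: "0 < e"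
  obtain h' C where h': "h' \<in> borel_measurable \<mu>" "\<And>z. norm (h' z) \<le> C"
    "AE z in \<mu>. h' z = h z" "0 \<le> C" by (rule bounded_representative[OF h], rule that)
  obtain s where s: "simple_function \<mu> s" "\<forall>z\<in>sphere 0 1. norm (h' z - s z) \<le> e / 3"
    using uniform_simple[OF h'(1,2), of "e / 3"] e by auto
  have "\<beta> (\<lambda>z. h z - s z) \<le> 2 * (e / 3)"
  proof (rule \<beta>_le)
    show "AE z in \<mu>. norm (h z - s z) \<le> e / 3"
      using h'(3) AE_space
    proof eventually_elim
      fix z assume "h' z = h z" "z \<in> space \<mu>"
      thus "norm (h z - s z) \<le> e / 3" using s(2)[rule_format, of z] by simp
    qed
  qed (use h s e Linf_simple in auto)
  thus "\<exists>g. approximable g \<and> \<beta> (\<lambda>z. h z - g z) < e"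
    using approximable_simple[OF s(1)] e by (intro exI[of _ s]) auto
qed

lemma \<beta>_bounds:
  assumes "h \<in> Linf_circle"
  shows "\<alpha> h \<le> \<beta> h" "(LINT z|\<mu>. norm (h z)) \<le> \<beta> h"
  using nonneg[OF assms] by (simp_all add: \<beta>_def)

section \<open>Comparison with the L^1 norm and density in the extended norm\<close>

text \<open>With k = |h| and u a harmonic polynomial \<beta>-close to k, the integral of k is close
  to that of u, which is at most \<alpha> u, and \<alpha> u is close to \<alpha> k = \<alpha> h.
  Closeness in L^1 is used at the first comparison and closeness in \<alpha> at the last.\<close>

lemma integral_norm_le:
  assumes h: "h \<in> Linf_circle"
  shows "(LINT z|\<mu>. norm (h z)) \<le> \<alpha> h"
proof (rule field_le_epsilon)
  fix e :: real assume e: "0 < e"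
  define k where "k z = complex_of_real (norm (h z))" for z
  have k: "k \<in> Linf_circle" unfolding k_def[abs_def] by (rule Linf_norm[OF h])
  obtain u where u: "u \<in> harmonic_polys" "\<beta> (\<lambda>z. k z - u z) < e / 2"
    using approximable_Linf[OF k] e unfolding approximable_def by (meson half_gt_zero)
  note uL = harmonic_Linf[OF u(1)]
  note kuL = Linf_diff[OF k uL]
  have "(LINT z|\<mu>. norm (h z)) = norm (LINT z|\<mu>. k z)"
    unfolding k_def by simp
  also have "(LINT z|\<mu>. k z) = (LINT z|\<mu>. u z) + (LINT z|\<mu>. k z - u z)"
    by (simp add: Bochner_Integration.integral_diff[OF Linf_integrable[OF k] Linf_integrable[OF uL]])
  also have "norm \<dots> \<le> norm (LINT z|\<mu>. u z) + norm (LINT z|\<mu>. k z - u z)"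
    by (rule norm_triangle_ineq)
  also have "\<dots> \<le> \<alpha> u + (LINT z|\<mu>. norm (k z - u z))"
    by (intro add_mono integral_harmonic_le u(1) integral_norm_bound)
  also have "\<alpha> u \<le> \<alpha> k + \<alpha> (\<lambda>z. k z - u z)"
    using triangle_diff[OF uL k] diff_commute[OF uL k] by simp
  also have "\<alpha> k = \<alpha> h" unfolding k_def[abs_def] by (rule norm_eq[OF h])
  finally show "(LINT z|\<mu>. norm (h z)) \<le> \<alpha> h + e"
    using \<beta>_bounds[OF kuL] u(2) by linarith
qed

text \<open>The functions equal to h where |h| \<le> n and to 0 elsewhere are bounded, and their
  moduli increase to |h|; monotone convergence reduces the claim to
  \<open>integral_norm_le\<close>.\<close>

lemma nn_integral_le_norm_ext:
  assumes h [measurable]: "h \<in> borel_measurable \<mu>"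
  shows "(\<integral>\<^sup>+z. ennreal (norm (h z)) \<partial>\<mu>) \<le> norm_ext \<alpha> h"
proof -
  define k where "k n z = (if norm (h z) \<le> real n then h z else 0)" for n z
  have km [measurable]: "k n \<in> borel_measurable \<mu>" for n unfolding k_def[abs_def] by measurable
  have kL: "k n \<in> Linf_circle" for n
    using km by (rule LinfI[of _ "real n"]) (auto simp: k_def)
  have "(\<integral>\<^sup>+z. ennreal (norm (h z)) \<partial>\<mu>) = (\<integral>\<^sup>+z. (SUP n. ennreal (norm (k n z))) \<partial>\<mu>)"
  proof (rule nn_integral_cong)
    fix z
    obtain n where n: "norm (h z) \<le> real n" using real_arch_simple by blast
    show "ennreal (norm (h z)) = (SUP n. ennreal (norm (k n z)))"
    proof (rule antisym)
      have "ennreal (norm (h z)) = ennreal (norm (k n z))" using n by (simp add: k_def)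
      also have "\<dots> \<le> (SUP n. ennreal (norm (k n z)))" by (rule SUP_upper) simp
      finally show "ennreal (norm (h z)) \<le> (SUP n. ennreal (norm (k n z)))" .
    qed (auto intro!: SUP_least simp: k_def)
  qed
  also have "\<dots> = (SUP n. \<integral>\<^sup>+z. ennreal (norm (k n z)) \<partial>\<mu>)"
  proof (rule nn_integral_monotone_convergence_SUP)
    show "incseq (\<lambda>n z. ennreal (norm (k n z)))"
      unfolding incseq_def le_fun_def k_def by auto
  qed measurable
  also have "\<dots> \<le> norm_ext \<alpha> h"
  proof (rule SUP_least)
    fix n
    have "(\<integral>\<^sup>+z. ennreal (norm (k n z)) \<partial>\<mu>) = ennreal (LINT z|\<mu>. norm (k n z))"
      using kL by (intro nn_integral_eq_integral integrable_norm Linf_integrable) auto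
    also have "\<dots> \<le> ennreal (\<alpha> (k n))" by (rule ennreal_leI[OF integral_norm_le[OF kL]])
    also have "\<dots> \<le> norm_ext \<alpha> h" by (rule le_norm_ext[OF kL]) (auto simp: k_def)
    finally show "(\<integral>\<^sup>+z. ennreal (norm (k n z)) \<partial>\<mu>) \<le> norm_ext \<alpha> h" .
  qed
  finally show ?thesis .
qed

text \<open>Here the equality of \<open>L_space\<close> and \<open>script_L\<close> enters: it
  brings F close to a bounded function, which is then approximated in \<beta> by a harmonic
  polynomial.\<close>

lemma harmonic_polys_dense:
  assumes F: "F \<in> script_L \<alpha>" and e: "0 < e"
  shows "\<exists>u\<in>harmonic_polys. norm_ext \<alpha> (\<lambda>z. F z - u z) < ennreal e"
proof -
  have "F \<in> norm_closure \<alpha> Linf_circle" using F L_space_eq by (simp add: L_space_def)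
  moreover have "0 < ennreal (e / 2)" using e by simp
  ultimately obtain g where g: "g \<in> Linf_circle" "norm_ext \<alpha> (\<lambda>z. F z - g z) < ennreal (e / 2)"
    unfolding norm_closure_def by blast
  obtain u where u: "u \<in> harmonic_polys" "\<beta> (\<lambda>z. g z - u z) < e / 2"
    using approximable_Linf[OF g(1)] e unfolding approximable_def by (meson half_gt_zero)
  note guL = Linf_diff[OF g(1) harmonic_Linf[OF u(1)]]
  have [measurable]: "F \<in> borel_measurable \<mu>" "g \<in> borel_measurable \<mu>"
    "u \<in> borel_measurable \<mu>"
    using F g(1) harmonic_Linf[OF u(1)] by (auto simp: script_L_def)
  have "norm_ext \<alpha> (\<lambda>z. F z - u z) \<le> norm_ext \<alpha> (\<lambda>z. F z - g z) + norm_ext \<alpha> (\<lambda>z. g z - u z)"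
  proof (rule norm_ext_triangle)
    show "AE z in \<mu>. norm (F z - u z) \<le> norm (F z - g z) + norm (g z - u z)"
      by (intro AE_I2) norm
  qed measurable
  also have "\<dots> \<le> norm_ext \<alpha> (\<lambda>z. F z - g z) + ennreal (e / 2)"
    using \<beta>_bounds[OF guL] u(2) by (intro add_left_mono) (simp add: norm_ext_Linf[OF guL] ennreal_leI)
  also have "\<dots> < ennreal (e / 2) + ennreal (e / 2)"
    by (subst add.commute) (simp add: ennreal_add_left_cancel_less g(2))
  also have "\<dots> = ennreal e" using e by (simp flip: ennreal_plus)
  finally show ?thesis using u(1) by blast
qed

end

section \<open>Boundary functions\<close>

text \<open>The dilate of f by r is holomorphic on the closed disc, so f (r a) is its Poisson
  integral at a. For fixed a the kernel is bounded, hence convergence of the dilates to F in L^1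
  passes through the integral, while f (r a) tends to f a.\<close>

lemma poisson_integral_boundary:
  fixes F :: "complex \<Rightarrow> complex"
  assumes f: "f holomorphic_on ball 0 1" and F: "integrable \<mu> F"
    and lim: "L1_boundary f F"
    and a: "norm a < 1"
  shows "integrable \<mu> (\<lambda>w. poisson a w * F w)"
    "(LINT w|\<mu>. poisson a w * F w) = f a"
proof -
  define C where "C = 2 / (1 - norm a)"
  have pC: "norm (complex_of_real (poisson a w) * x) \<le> C * norm x" if "w \<in> space \<mu>" for w x
    using mult_right_mono[OF poisson_le[OF a, of w], of "norm x"] poisson_nonneg[of a w] a that
    by (simp add: norm_mult C_def)
  have pm: "(\<lambda>w. complex_of_real (poisson a w)) \<in> borel_measurable \<mu>"
    by (intro measurable_circle continuous_intros continuous_on_poisson a)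
  have pint: "integrable \<mu> (\<lambda>w. poisson a w * G w)" if "integrable \<mu> G" for G :: "complex \<Rightarrow> complex"
  proof (rule Bochner_Integration.integrable_bound)
    show "integrable \<mu> (\<lambda>w. C * norm (G w))" using that by simp
    show "(\<lambda>w. poisson a w * G w) \<in> borel_measurable \<mu>"
      using pm borel_measurable_integrable[OF that] by (rule borel_measurable_times)
    have "0 \<le> C" using a by (simp add: C_def)
    thus "AE w in \<mu>. norm (poisson a w * G w) \<le> norm (C * norm (G w))"
      using pC by (intro AE_I2) simp
  qed
  show PF: "integrable \<mu> (\<lambda>w. poisson a w * F w)" by (rule pint[OF F])
  have di: "integrable \<mu> (dilate f r)" if "0 < r" "r < 1" for r
    using that f by (intro integrable_circle_continuous continuous_intros) auto
  have "((\<lambda>r. f (of_real r * a) - (LINT w|\<mu>. poisson a w * F w)) \<longlongrightarrow> 0) (at_left 1)"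
  proof (rule Lim_null_comparison)
    show "((\<lambda>r. C * (LINT z|\<mu>. norm (dilate f r z - F z))) \<longlongrightarrow> 0) (at_left 1)"
      using tendsto_mult[OF tendsto_const[of C] lim] by simp
    show "\<forall>\<^sub>F r in at_left 1. norm (f (of_real r * a) - (LINT w|\<mu>. poisson a w * F w)) \<le>
      C * (LINT z|\<mu>. norm (dilate f r z - F z))"
      using eventually_unit
    proof (rule eventually_mono)
      fix r :: real assume r: "0 < r \<and> r < 1"
      have hol: "dilate f r holomorphic_on cball 0 1" using r by (intro holomorphic_dilate f) auto
      have "f (of_real r * a) = (LINT w|\<mu>. poisson a w * dilate f r w)"
        using poisson_holomorphic[OF hol a] by (simp add: dilate_def)
      hence "f (of_real r * a) - (LINT w|\<mu>. poisson a w * F w) =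
        (LINT w|\<mu>. poisson a w * dilate f r w - poisson a w * F w)"
        using Bochner_Integration.integral_diff[OF pint[OF di] PF, of r] r by simp
      also have "\<dots> = (LINT w|\<mu>. poisson a w * (dilate f r w - F w))"
        by (simp add: right_diff_distrib)
      finally have eq: "f (of_real r * a) - (LINT w|\<mu>. poisson a w * F w) =
        (LINT w|\<mu>. poisson a w * (dilate f r w - F w))" .
      have dF: "integrable \<mu> (\<lambda>w. dilate f r w - F w)"
        using r by (intro Bochner_Integration.integrable_diff di F) auto
      have "norm (LINT w|\<mu>. poisson a w * (dilate f r w - F w)) \<le>
        (LINT w|\<mu>. norm (poisson a w * (dilate f r w - F w)))"
        by (rule integral_norm_bound)
      also have "\<dots> \<le> (LINT w|\<mu>. C * norm (dilate f r w - F w))"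
        using pC by (intro integral_mono integrable_norm pint dF integrable_mult_right) auto
      also have "\<dots> = C * (LINT z|\<mu>. norm (dilate f r z - F z))" by simp
      finally show "norm (f (of_real r * a) - (LINT w|\<mu>. poisson a w * F w)) \<le>
        C * (LINT z|\<mu>. norm (dilate f r z - F z))" unfolding eq .
    qed
  qed
  hence "((\<lambda>r. f (of_real r * a)) \<longlongrightarrow> (LINT w|\<mu>. poisson a w * F w)) (at_left 1)"
    by (simp add: LIM_zero_iff)
  moreover have "((\<lambda>r. f (of_real r * a)) \<longlongrightarrow> f a) (at_left 1)"
  proof (rule continuous_on_tendsto_compose[OF holomorphic_on_imp_continuous_on[OF f]])
    have "((\<lambda>r. of_real r * a) \<longlongrightarrow> of_real 1 * a) (at_left (1::real))" by (intro tendsto_intros)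
    thus "((\<lambda>r. of_real r * a) \<longlongrightarrow> a) (at_left (1::real))" by simp
    show "\<forall>\<^sub>F r in at_left (1::real). of_real r * a \<in> ball 0 1"
      using eventually_unit
    proof (rule eventually_mono)
      fix r :: real assume r: "0 < r \<and> r < 1"
      have "norm (of_real r * a) \<le> norm a" using r by (simp add: norm_mult mult_left_le_one_le)
      thus "of_real r * a \<in> ball 0 1" using a by simp
    qed
  qed (use a in simp)
  ultimately show "(LINT w|\<mu>. poisson a w * F w) = f a"
    by (intro tendsto_unique[of "at_left (1::real)"]) auto
qed

text \<open>Both f and v are Poisson integrals of their boundary values, and at a point of modulus r
  the kernel is at most 2 / (1 - r). For fixed r, closeness in L^1 on the boundary thus becomes
  uniform closeness on the circle of radius r.\<close>

lemma dilate_diff_le_integral: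
  fixes F :: "complex \<Rightarrow> complex"
  assumes f: "f holomorphic_on ball 0 1" and F: "integrable \<mu> F"
    and lim: "L1_boundary f F"
    and v: "v \<in> harmonic_polys" and r: "0 < r" "r < 1" and z: "norm z = 1"
  shows "norm (dilate f r z - dilate v r z) \<le> 2 / (1 - r) * (LINT w|\<mu>. norm (F w - v w))"
proof -
  define a where "a = of_real r * z"
  have na: "norm a = r" using z r by (simp add: a_def norm_mult)
  have a: "norm a < 1" using na r by simp
  have vi: "integrable \<mu> (\<lambda>w. poisson a w * v w)"
    by (intro integrable_circle_continuous continuous_intros continuous_on_poisson a harmonic_continuous v)
  note P = poisson_integral_boundary[OF f F lim a]
  have Fv: "integrable \<mu> (\<lambda>w. F w - v w)"
    by (intro Bochner_Integration.integrable_diff F Linf_integrable harmonic_Linf v)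
  have "f a - v a = (LINT w|\<mu>. poisson a w * F w - poisson a w * v w)"
    using Bochner_Integration.integral_diff[OF P(1) vi] P(2) poisson_harmonic[OF v a] by simp
  hence "norm (f a - v a) \<le> (LINT w|\<mu>. norm (poisson a w * F w - poisson a w * v w))"
    by (simp only: integral_norm_bound)
  also have "\<dots> \<le> (LINT w|\<mu>. 2 / (1 - r) * norm (F w - v w))"
  proof (intro integral_mono integrable_norm integrable_mult_right Fv Bochner_Integration.integrable_diff P(1) vi)
    fix w assume "w \<in> space \<mu>"
    hence "poisson a w \<le> 2 / (1 - r)" "0 \<le> poisson a w"
      using poisson_le[OF a, of w] poisson_nonneg[of a w] a na by auto
    thus "norm (poisson a w * F w - poisson a w * v w) \<le> 2 / (1 - r) * norm (F w - v w)"
      unfolding right_diff_distrib[symmetric] norm_mult by (intro mult_right_mono) auto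
  qed
  also have "\<dots> = 2 / (1 - r) * (LINT w|\<mu>. norm (F w - v w))" by simp
  finally show ?thesis by (simp add: a_def dilate_def)
qed

context strongly_continuous_rotsym_norm
begin

text \<open>Contractivity of dilation extends from harmonic polynomials to boundary functions by
  approximation: if \<open>v\<close> is close to \<open>F\<close>, then \<open>dilate v r\<close> is uniformly close to \<open>dilate f r\<close>.\<close>

lemma dilate_diff_le_norm_ext:
  assumes f: "f holomorphic_on ball 0 1" and F: "integrable \<mu> F" "F \<in> script_L \<alpha>"
    and lim: "L1_boundary f F"
    and u: "u \<in> harmonic_polys" and r: "0 < r" "r < 1"
  shows "norm_ext \<alpha> (\<lambda>z. dilate f r z - dilate u r z) \<le> norm_ext \<alpha> (\<lambda>z. F z - u z)"
proof (rule ennreal_le_epsilon)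
  fix e :: real assume e: "0 < e"
  define C where "C = 2 / (1 - r)"
  have C: "0 < C" using r by (simp add: C_def)
  \<comment> \<open>Two errors are paid for: at most C d for the uniform distance of the dilates of
    f and v, and at most d for replacing v by F in the bound of \<alpha> (v - u). This choice makes
    their sum e.\<close>
  define d where "d = e / (C + 1)"
  have d: "0 < d" using e C by (simp add: d_def)
  have "(C + 1) * d = e" using C by (simp add: d_def)
  hence Cd: "C * d + d = e" by (simp add: distrib_right)
  obtain v where v: "v \<in> harmonic_polys" "norm_ext \<alpha> (\<lambda>z. F z - v z) < ennreal d"
    using harmonic_polys_dense[OF F(2) d] by blast
  have Fm: "F \<in> borel_measurable \<mu>" using F(1) by (rule borel_measurable_integrable)
  have um: "u \<in> borel_measurable \<mu>" and vm: "v \<in> borel_measurable \<mu>"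
    using harmonic_Linf[OF u] harmonic_Linf[OF v(1)] by auto
  note [measurable] = Fm um vm
  have Fv: "integrable \<mu> (\<lambda>z. F z - v z)"
    by (intro Bochner_Integration.integrable_diff F Linf_integrable harmonic_Linf v)
  have "ennreal (LINT w|\<mu>. norm (F w - v w)) = (\<integral>\<^sup>+w. ennreal (norm (F w - v w)) \<partial>\<mu>)"
    using Fv by (intro nn_integral_eq_integral[symmetric] integrable_norm) auto
  also have "\<dots> \<le> norm_ext \<alpha> (\<lambda>z. F z - v z)"
    by (rule nn_integral_le_norm_ext) measurable
  also have "\<dots> < ennreal d" by (rule v(2))
  finally have Fvd: "(LINT w|\<mu>. norm (F w - v w)) \<le> d"
    using d by (auto simp: ennreal_less_iff)
  have fL: "dilate f r \<in> Linf_circle" using r f by (intro Linf_continuous continuous_intros) auto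
  have dL: "dilate w r \<in> Linf_circle" if "w \<in> harmonic_polys" for w
    unfolding dilate_def
    by (intro Linf_continuous continuous_on_compose2[OF harmonic_continuous[OF that, of UNIV]] continuous_intros) auto
  have fvL: "(\<lambda>z. dilate f r z - dilate v r z) \<in> Linf_circle" by (intro Linf_diff fL dL v)
  have vuL: "(\<lambda>z. dilate v r z - dilate u r z) \<in> Linf_circle" by (intro Linf_diff dL u v)
  have 1: "\<alpha> (\<lambda>z. dilate f r z - dilate v r z) \<le> C * d"
  proof (rule le_bound[OF fvL AE_I2])
    fix z assume "z \<in> space \<mu>"
    hence "norm (dilate f r z - dilate v r z) \<le> C * (LINT w|\<mu>. norm (F w - v w))"
      unfolding C_def by (intro dilate_diff_le_integral[OF f F(1) lim v(1) r]) simp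
    also have "\<dots> \<le> C * d" using Fvd C by (intro mult_left_mono) auto
    finally show "norm (dilate f r z - dilate v r z) \<le> C * d" .
  qed (use C d in auto)
  define w where "w z = v z - u z" for z
  have w: "w \<in> harmonic_polys" unfolding w_def[abs_def] by (rule harmonic_diff[OF v(1) u])
  have "(\<lambda>z. dilate v r z - dilate u r z) = dilate w r" by (simp add: dilate_def w_def fun_eq_iff)
  hence 2: "\<alpha> (\<lambda>z. dilate v r z - dilate u r z) \<le> \<alpha> w"
    using dilate_le[OF w, of r] r by simp
  have "ennreal (\<alpha> w) = norm_ext \<alpha> w" by (rule norm_ext_Linf[symmetric, OF harmonic_Linf[OF w]])
  also have "\<dots> \<le> norm_ext \<alpha> (\<lambda>z. F z - v z) + norm_ext \<alpha> (\<lambda>z. F z - u z)"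
  proof (rule norm_ext_triangle)
    have "norm (v z - u z) \<le> norm (F z - v z) + norm (F z - u z)" for z by norm
    thus "AE z in \<mu>. norm (w z) \<le> norm (F z - v z) + norm (F z - u z)" by (simp add: w_def)
  qed measurable
  also have "\<dots> \<le> ennreal d + norm_ext \<alpha> (\<lambda>z. F z - u z)"
    using v(2) by (intro add_right_mono) (rule less_imp_le)
  finally have 3: "ennreal (\<alpha> w) \<le> ennreal d + norm_ext \<alpha> (\<lambda>z. F z - u z)" .
  have "\<alpha> (\<lambda>z. dilate f r z - dilate u r z) \<le> C * d + \<alpha> w"
    using triangle[OF fvL vuL] 1 2 by simp
  hence "ennreal (\<alpha> (\<lambda>z. dilate f r z - dilate u r z)) \<le> ennreal (C * d + \<alpha> w)" by (rule ennreal_leI)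
  also have "\<dots> = ennreal (C * d) + ennreal (\<alpha> w)"
    using C d nonneg[OF harmonic_Linf[OF w]] by (intro ennreal_plus) auto
  also have "\<dots> \<le> ennreal (C * d) + (ennreal d + norm_ext \<alpha> (\<lambda>z. F z - u z))"
    by (intro add_left_mono 3)
  also have "\<dots> = (ennreal (C * d) + ennreal d) + norm_ext \<alpha> (\<lambda>z. F z - u z)" by (simp only: add.assoc)
  also have "ennreal (C * d) + ennreal d = ennreal e"
    using C d Cd by (simp flip: ennreal_plus)
  finally show "norm_ext \<alpha> (\<lambda>z. dilate f r z - dilate u r z) \<le> norm_ext \<alpha> (\<lambda>z. F z - u z) + ennreal e"
    using norm_ext_Linf[OF Linf_diff[OF fL dL[OF u]]] by (simp add: add.commute)
qed

lemma norm_ext_dilate_le: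
  assumes "f holomorphic_on ball 0 1" "integrable \<mu> F" "F \<in> script_L \<alpha>"
    and "L1_boundary f F"
    and "0 < r" "r < 1"
  shows "norm_ext \<alpha> (dilate f r) \<le> norm_ext \<alpha> F"
  using dilate_diff_le_norm_ext[OF assms(1-4) harmonic_const[of 0] assms(5,6)]
  by (simp add: dilate_def)

text \<open>On the complement of a set that is small in measure, and hence in \<open>\<alpha>\<close>,
  the boundary function is dominated by some dilate up to a small constant.\<close>

lemma norm_ext_boundary_le:
  assumes f: "f holomorphic_on ball 0 1" and F: "integrable \<mu> F"
    and lim: "L1_boundary f F"
    and K: "\<And>r. 0 < r \<Longrightarrow> r < 1 \<Longrightarrow> norm_ext \<alpha> (dilate f r) \<le> K"
  shows "norm_ext \<alpha> F \<le> K"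
  unfolding norm_ext_def[of \<alpha> F]
proof (rule SUP_least, safe)
  fix s :: "complex \<Rightarrow> complex"
  assume s: "simple_function \<mu> s" "AE z in \<mu>. norm (s z) \<le> norm (F z)"
  note sL = Linf_simple[OF s(1)]
  obtain C where C: "0 \<le> C" "AE z in \<mu>. norm (s z) \<le> C" using Linf_bound[OF sL] by blast
  show "ennreal (\<alpha> s) \<le> K"
  proof (rule ennreal_le_epsilon)
    fix e :: real assume e: "0 < e"
    define d where "d = e / 2"
    have d: "0 < d" using e by (simp add: d_def)
    \<comment> \<open>On the exceptional set s is bounded only by C, which costs C times \<alpha> of
      the indicator, hence at most d; the denominator C + 1 also covers C = 0. By Markov's
      inequality, an L^1 distance below d \<delta> keeps the set where the dilate is d away from F
      smaller than \<delta>.\<close>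
    obtain \<delta> where \<delta>: "0 < \<delta>" "\<forall>E\<in>sets \<mu>. measure \<mu> E < \<delta> \<longrightarrow> \<alpha> (indicator E) < d / (C + 1)"
      using indicator_small[of "d / (C + 1)"] d C by (auto simp: add_nonneg_pos)
    have "\<forall>\<^sub>F r in at_left 1. dist (LINT z|\<mu>. norm (dilate f r z - F z)) 0 < d * \<delta>"
      using lim d \<delta>(1) by (intro tendstoD) auto
    hence "\<forall>\<^sub>F r in at_left (1::real). (0 < r \<and> r < 1) \<and> dist (LINT z|\<mu>. norm (dilate f r z - F z)) 0 < d * \<delta>"
      using eventually_unit by (rule eventually_conj[rotated])
    then obtain r :: real where r: "0 < r" "r < 1" and rd: "(LINT z|\<mu>. norm (dilate f r z - F z)) < d * \<delta>"
      using eventually_happens[of _ "at_left (1::real)"] by (auto simp: dist_real_def)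
    have fi: "integrable \<mu> (\<lambda>z. norm (dilate f r z - F z))"
      using r f by (intro integrable_norm Bochner_Integration.integrable_diff F integrable_circle_continuous continuous_intros) auto
    define E where "E = {z\<in>space \<mu>. d \<le> norm (dilate f r z - F z)}"
    have Es: "E \<in> sets \<mu>"
      unfolding E_def using borel_measurable_integrable[OF fi] by measurable
    have "measure \<mu> E \<le> (LINT z|\<mu>. norm (dilate f r z - F z)) / d"
      unfolding E_def
      by (rule integral_Markov_inequality_measure[OF fi, of "space \<mu>"]) (use d in auto)
    also have "\<dots> < \<delta>" using rd d by (simp add: field_simps)
    finally have E: "\<alpha> (indicator E) < d / (C + 1)" using \<delta>(2) Es by blast
    \<comment> \<open>Off E the modulus of s is lowered by d, which puts it below that of the
      dilate; on E it is set to 0. Then |s| \<le> t + d + C times the indicator of E, and d together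
      with the bound d for the last term gives e.\<close>
    define t where "t z = complex_of_real (max 0 (norm (s z) - d)) * indicator (space \<mu> - E) z" for z :: complex
    have tL: "t \<in> Linf_circle"
      unfolding t_def[abs_def]
    proof (rule Linf_mult)
      show "(\<lambda>z. complex_of_real (max 0 (norm (s z) - d))) \<in> Linf_circle"
        by (rule Linf_simple, rule simple_function_compose1[OF s(1)])
      show "indicator (space \<mu> - E) \<in> Linf_circle"
        by (rule Linf_indicator[OF sets.compl_sets[OF Es]])
    qed
    have CL: "(\<lambda>z. of_real C * indicator E z) \<in> Linf_circle"
      by (intro Linf_mult Linf_indicator Es Linf_const)
    have tdL: "(\<lambda>z. t z + of_real d) \<in> Linf_circle" by (intro Linf_add tL Linf_const)
    have "\<alpha> s \<le> \<alpha> (\<lambda>z. (t z + of_real d) + of_real C * indicator E z)"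
    proof (rule mono[OF sL Linf_add[OF tdL CL]])
      show "AE z in \<mu>. norm (s z) \<le> norm ((t z + of_real d) + of_real C * indicator E z)"
        using C(2) AE_space
      proof eventually_elim
        fix z assume z: "norm (s z) \<le> C" "z \<in> space \<mu>"
        have "(t z + of_real d) + of_real C * indicator E z =
          complex_of_real ((if z \<in> E then C else max 0 (norm (s z) - d)) + d)"
          using z(2) by (auto simp: t_def indicator_def)
        hence "norm ((t z + of_real d) + of_real C * indicator E z) = \<bar>(if z \<in> E then C else max 0 (norm (s z) - d)) + d\<bar>"
          by (simp only: norm_of_real)
        thus "norm (s z) \<le> norm ((t z + of_real d) + of_real C * indicator E z)" using z d by auto
      qed
    qed
    also have "\<dots> \<le> \<alpha> (\<lambda>z. t z + of_real d) + \<alpha> (\<lambda>z. of_real C * indicator E z)" by (rule triangle[OF tdL CL])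
    also have "\<alpha> (\<lambda>z. t z + of_real d) \<le> \<alpha> t + d" using triangle[OF tL Linf_const, of "of_real d"] d by (simp add: const)
    also have "\<alpha> (\<lambda>z. of_real C * indicator E z) = C * \<alpha> (indicator E)"
      using C by (subst scale[OF Linf_indicator[OF Es]]) simp
    also have "C * \<alpha> (indicator E) \<le> C * (d / (C + 1))" using E C by (intro mult_left_mono) auto
    also have "\<dots> \<le> d" using C d by (simp add: field_simps)
    finally have "\<alpha> s \<le> \<alpha> t + e" by (simp add: d_def)
    hence "ennreal (\<alpha> s) \<le> ennreal (\<alpha> t + e)" by (rule ennreal_leI)
    also have "\<dots> = ennreal (\<alpha> t) + ennreal e" using nonneg[OF tL] e by simp
    also have "ennreal (\<alpha> t) \<le> norm_ext \<alpha> (dilate f r)"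
    proof (rule le_norm_ext[OF tL])
      show "AE z in \<mu>. norm (t z) \<le> norm (dilate f r z)"
        using s(2) AE_space
      proof eventually_elim
        fix z assume z: "norm (s z) \<le> norm (F z)" "z \<in> space \<mu>"
        show "norm (t z) \<le> norm (dilate f r z)"
        proof (cases "z \<in> E")
          case True
          thus ?thesis by (simp add: t_def)
        next
          case False
          hence "norm (dilate f r z - F z) < d" using z(2) by (auto simp: E_def)
          hence "norm (F z) - d \<le> norm (dilate f r z)"
            using norm_triangle_ineq2[of "F z" "dilate f r z"] by (simp add: norm_minus_commute)
          thus ?thesis using z False by (simp add: t_def)
        qed
      qed
    qed
    also have "norm_ext \<alpha> (dilate f r) \<le> K" by (rule K[OF r])
    finally show "ennreal (\<alpha> s) \<le> K + ennreal e" by simp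
  qed
qed

lemma boundary_in_hardy_circle:
  assumes f: "f holomorphic_on ball 0 1" and F: "integrable \<mu> F" "F \<in> script_L \<alpha>"
    and lim: "L1_boundary f F"
  shows "F \<in> hardy_circle \<alpha>"
  unfolding hardy_circle_def norm_closure_def
proof (intro CollectI conjI F(2) allI impI)
  fix \<epsilon> :: ennreal assume "\<epsilon> > 0"
  \<comment> \<open>As \<epsilon> may be infinite, a smaller finite positive bound is chosen to work
    with reals.\<close>
  then obtain y where y: "0 < y" "y < \<epsilon>" using dense by blast
  then obtain e where e: "y = ennreal e" "0 \<le> e" by (cases y rule: ennreal_cases) auto
  hence e0: "0 < e" using y by auto
  \<comment> \<open>A quarter for each link of the chain from F to u, from u to its dilate, from
    there to the dilate of f, and from there to the polynomial p. Contractivity controls the third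
    link by the first.\<close>
  define d where "d = e / 4"
  have d: "0 < d" using e0 by (simp add: d_def)
  obtain u where u: "u \<in> harmonic_polys" "norm_ext \<alpha> (\<lambda>z. F z - u z) < ennreal d"
    using harmonic_polys_dense[OF F(2) d] by blast
  note uL = harmonic_Linf[OF u(1)]
  have "\<forall>\<^sub>F r in at_left 1. 0 < r \<and> r < 1 \<and> (\<forall>z\<in>sphere 0 1. norm (u (of_real r * z) - u z) < d)"
    using d by (intro eventually_dilate_near harmonic_continuous u)
  from eventually_happens[OF this] obtain r :: real
    where "0 < r \<and> r < 1 \<and> (\<forall>z\<in>sphere 0 1. norm (u (of_real r * z) - u z) < d)" by auto
  hence r: "0 < r" "r < 1" and ru: "\<And>z. norm z = 1 \<Longrightarrow> norm (dilate u r z - u z) < d"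
    by (auto simp: dilate_def)
  have "\<forall>\<^sub>F N in sequentially. \<forall>x\<in>cball 0 r. dist (\<Sum>k<N. tcoeff f k * x ^ k) (f x) < d"
    using uniform_limit_taylor[OF f r(2)] d by (rule uniform_limitD)
  then obtain N0 where N0: "\<forall>N\<ge>N0. \<forall>x\<in>cball 0 r. dist (\<Sum>k<N. tcoeff f k * x ^ k) (f x) < d"
    unfolding eventually_sequentially by blast
  define p where "p z = (\<Sum>k\<le>N0. tcoeff f k * of_real r ^ k * z ^ k)" for z
  have p: "p \<in> analytic_polynomials" unfolding p_def[abs_def] analytic_polynomials_def
    by (intro CollectI exI[of _ N0] exI[of _ "\<lambda>k. tcoeff f k * of_real r ^ k"]) simp
  have pc: "continuous_on S p" for S unfolding p_def[abs_def] by (intro continuous_intros)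
  have pf: "norm (dilate f r z - p z) < d" if z: "norm z = 1" for z
  proof -
    \<comment> \<open>Members of \<open>analytic_polynomials\<close> are summed over k \<le> n, so
      the partial sum with \<open>Suc N0\<close> terms is the one that matches p.\<close>
    have "of_real r * z \<in> cball 0 r" using z r by (simp add: norm_mult)
    hence "dist (\<Sum>k<Suc N0. tcoeff f k * (of_real r * z) ^ k) (f (of_real r * z)) < d"
      using N0 le_SucI[OF order_refl] by blast
    moreover have "(\<Sum>k<Suc N0. tcoeff f k * (of_real r * z) ^ k) = p z"
      by (simp only: p_def lessThan_Suc_atMost power_mult_distrib mult.assoc)
    ultimately show ?thesis by (simp add: dilate_def dist_norm norm_minus_commute)
  qed
  have pL: "p \<in> Linf_circle" by (intro Linf_continuous pc)
  have fL: "dilate f r \<in> Linf_circle" using r f by (intro Linf_continuous continuous_intros) auto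
  have urL: "dilate u r \<in> Linf_circle"
    unfolding dilate_def
    by (intro Linf_continuous continuous_on_compose2[OF harmonic_continuous[OF u(1), of UNIV]] continuous_intros) auto
  note furL = Linf_diff[OF fL urL]
  have "ennreal (\<alpha> (\<lambda>z. dilate f r z - dilate u r z)) < ennreal d"
    using dilate_diff_le_norm_ext[OF f F lim u(1) r] u(2) by (simp add: norm_ext_Linf[OF furL] le_less_trans)
  hence 1: "\<alpha> (\<lambda>z. dilate f r z - dilate u r z) \<le> d"
    using nonneg[OF furL] by (simp add: ennreal_less_iff)
  have 2: "\<alpha> (\<lambda>z. dilate u r z - u z) \<le> d"
    using ru d by (intro le_bound Linf_diff urL uL AE_I2) (auto intro: less_imp_le)
  have 3: "\<alpha> (\<lambda>z. dilate f r z - p z) \<le> d"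
    using pf d by (intro le_bound Linf_diff fL pL AE_I2) (auto intro: less_imp_le)
  have upL: "(\<lambda>z. u z - p z) \<in> Linf_circle" by (rule Linf_diff[OF uL pL])
  have "\<alpha> (\<lambda>z. u z - p z) \<le> \<alpha> (\<lambda>z. u z - dilate f r z) + \<alpha> (\<lambda>z. dilate f r z - p z)"
    using triangle[OF Linf_diff[OF uL fL] Linf_diff[OF fL pL]] by simp
  also have "\<alpha> (\<lambda>z. u z - dilate f r z) \<le> \<alpha> (\<lambda>z. u z - dilate u r z) + \<alpha> (\<lambda>z. dilate u r z - dilate f r z)"
    using triangle[OF Linf_diff[OF uL urL] Linf_diff[OF urL fL]] by simp
  also have "\<alpha> (\<lambda>z. u z - dilate u r z) = \<alpha> (\<lambda>z. dilate u r z - u z)" by (rule diff_commute[OF uL urL])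
  also have "\<alpha> (\<lambda>z. dilate u r z - dilate f r z) = \<alpha> (\<lambda>z. dilate f r z - dilate u r z)" by (rule diff_commute[OF urL fL])
  finally have up: "\<alpha> (\<lambda>z. u z - p z) \<le> 3 * d" using 1 2 3 by simp
  have [measurable]: "F \<in> borel_measurable \<mu>" "u \<in> borel_measurable \<mu>"
    "p \<in> borel_measurable \<mu>" using F(1) uL pL by auto
  have "norm_ext \<alpha> (\<lambda>z. F z - p z) \<le> norm_ext \<alpha> (\<lambda>z. F z - u z) + norm_ext \<alpha> (\<lambda>z. u z - p z)"
  proof (rule norm_ext_triangle)
    show "AE z in \<mu>. norm (F z - p z) \<le> norm (F z - u z) + norm (u z - p z)"
      by (intro AE_I2) norm
  qed measurable
  also have "\<dots> \<le> ennreal d + ennreal (3 * d)"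
    using u(2) up by (intro add_mono) (auto simp: norm_ext_Linf[OF upL] intro: ennreal_leI less_imp_le)
  also have "\<dots> = y" using d e by (simp add: d_def flip: ennreal_plus)
  finally have "norm_ext \<alpha> (\<lambda>z. F z - p z) < \<epsilon>" using y(2) by simp
  thus "\<exists>g\<in>analytic_polynomials. norm_ext \<alpha> (\<lambda>z. F z - g z) < \<epsilon>" using p by blast
qed

end

lemma hardy1_disk_boundary:
  assumes "f \<in> hardy1_disk"
  shows "\<exists>F. radial_boundary f F \<and> integrable \<mu> F \<and>
    L1_boundary f F"
proof -
  have f: "f holomorphic_on ball 0 1"
    and fin: "(SUP r\<in>{0<..<1}. \<integral>\<^sup>+z. ennreal (norm (dilate f r z)) \<partial>\<mu>) < \<infinity>"
    using assms by (auto simp: hardy1_disk_def)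
  obtain A where A: "(SUP r\<in>{0<..<1}. \<integral>\<^sup>+z. ennreal (norm (dilate f r z)) \<partial>\<mu>) = ennreal A" "0 \<le> A"
    using fin by (cases rule: ennreal_cases) auto
  show ?thesis
  proof (rule hardy1_boundary[OF f])
    fix r :: real assume r: "0 < r" "r < 1"
    have "(\<integral>\<^sup>+z. ennreal (norm (dilate f r z)) \<partial>\<mu>) = ennreal (LINT z|\<mu>. norm (dilate f r z))"
      using r f by (intro nn_integral_eq_integral integrable_norm integrable_circle_continuous continuous_intros) auto
    moreover have "(\<integral>\<^sup>+z. ennreal (norm (dilate f r z)) \<partial>\<mu>) \<le> ennreal A"
      unfolding A(1)[symmetric] by (rule SUP_upper) (use r in auto)
    ultimately show "(LINT z|\<mu>. norm (dilate f r z)) \<le> A" using A(2) by (simp add: ennreal_le_iff)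
  qed
qed

lemma radial_boundary_unique:
  assumes "radial_boundary f F" "radial_boundary f G"
  shows "AE z in \<mu>. F z = G z"
proof -
  have "AE z in \<mu>. ((\<lambda>r. dilate f r z) \<longlongrightarrow> F z) (at_left 1)"
    "AE z in \<mu>. ((\<lambda>r. dilate f r z) \<longlongrightarrow> G z) (at_left 1)"
    using assms by (auto simp: radial_boundary_def)
  thus ?thesis by eventually_elim (auto intro: tendsto_unique[of "at_left (1::real)"])
qed

theorem proposition6p4:
  fixes \<alpha> :: "(complex \<Rightarrow> complex) \<Rightarrow> real" and f :: "complex \<Rightarrow> complex"
  assumes "rotationally_symmetric_norm \<alpha>"
    and "strongly_continuous_norm \<alpha>"
  shows "f \<in> hardy_disk \<alpha> \<longleftrightarrow>
    f holomorphic_on ball 0 1 \<and> (SUP r\<in>{0<..<1}. norm_ext \<alpha> (dilate f r)) < \<infinity>"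
proof -
  interpret strongly_continuous_rotsym_norm \<alpha>
    by standard (use assms in auto)
  show ?thesis
  proof
    assume fH: "f \<in> hardy_disk \<alpha>"
    then obtain F' where f1: "f \<in> hardy1_disk" and F': "radial_boundary f F'" "F' \<in> hardy_circle \<alpha>"
      by (auto simp: hardy_disk_def)
    have f: "f holomorphic_on ball 0 1" using f1 by (simp add: hardy1_disk_def)
    obtain F where F: "radial_boundary f F" "integrable \<mu> F"
      "L1_boundary f F"
      using hardy1_disk_boundary[OF f1] by blast
    \<comment> \<open>Membership supplies F' with finite norm, while F is the function known to be
      an L^1 limit of the dilates. Uniqueness of radial limits identifies the two almost everywhere,
      so F inherits finiteness.\<close>
    have "AE z in \<mu>. norm (F z) \<le> norm (F' z)"
      using radial_boundary_unique[OF F(1) F'(1)] by eventually_elim simp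
    hence "norm_ext \<alpha> F \<le> norm_ext \<alpha> F'" by (rule norm_ext_mono)
    also have "\<dots> < \<infinity>" using F'(2) by (simp add: hardy_circle_def norm_closure_def script_L_def)
    finally have fin: "norm_ext \<alpha> F < \<infinity>" .
    hence FL: "F \<in> script_L \<alpha>" using F(2) by (auto simp: script_L_def)
    have "(SUP r\<in>{0<..<1}. norm_ext \<alpha> (dilate f r)) \<le> norm_ext \<alpha> F"
      by (intro SUP_least norm_ext_dilate_le[OF f F(2) FL F(3)]) auto
    thus "f holomorphic_on ball 0 1 \<and> (SUP r\<in>{0<..<1}. norm_ext \<alpha> (dilate f r)) < \<infinity>"
      using f fin by (auto intro: le_less_trans)
  next
    assume asm: "f holomorphic_on ball 0 1 \<and> (SUP r\<in>{0<..<1}. norm_ext \<alpha> (dilate f r)) < \<infinity>"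
    hence f: "f holomorphic_on ball 0 1" by blast
    define K where "K = (SUP r\<in>{0<..<1}. norm_ext \<alpha> (dilate f r))"
    have K: "norm_ext \<alpha> (dilate f r) \<le> K" if "0 < r" "r < 1" for r
      unfolding K_def by (rule SUP_upper) (use that in auto)
    \<comment> \<open>The comparison of L^1 with \<alpha> places f in the classical space H^1; only
      then is a boundary function available.\<close>
    have "(SUP r\<in>{0<..<1}. \<integral>\<^sup>+z. ennreal (norm (dilate f r z)) \<partial>\<mu>) \<le> K"
    proof (rule SUP_least)
      fix r :: real assume r: "r \<in> {0<..<1}"
      have "dilate f r \<in> borel_measurable \<mu>"
        using r f by (intro measurable_circle continuous_intros) auto
      from nn_integral_le_norm_ext[OF this] K[of r] r
      show "(\<integral>\<^sup>+z. ennreal (norm (dilate f r z)) \<partial>\<mu>) \<le> K" by auto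
    qed
    hence f1: "f \<in> hardy1_disk" using f asm by (auto simp: hardy1_disk_def K_def intro: le_less_trans)
    obtain F where F: "radial_boundary f F" "integrable \<mu> F"
      "L1_boundary f F"
      using hardy1_disk_boundary[OF f1] by blast
    have "norm_ext \<alpha> F \<le> K" by (rule norm_ext_boundary_le[OF f F(2,3) K])
    hence "F \<in> script_L \<alpha>" using F(2) asm by (auto simp: script_L_def K_def intro: le_less_trans)
    from boundary_in_hardy_circle[OF f F(2) this F(3)]
    show "f \<in> hardy_disk \<alpha>" using f1 F(1) by (auto simp: hardy_disk_def)
  qed
qed

end
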